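(* Let $m$ be a positive integer. (1) Let $C$ be a binary doubly even self-dual code of length $24m$ with minimum weight $4m$. Then every shell of $C$ is a combinatorial $1$-design; that is, for every $\ell$ with $C_\ell\neq\emptyset$, $C_\ell$ is a combinatorial $1$-design. (2) Let $C$ be a ternary self-dual code of length $12m$ with minimum weight $3m$. Then for every $\ell\le 6m-3$, $C_\ell$ is a combinatorial $1$-design. (3) Let $C$ be a quaternary self-dual code of length $6m$ with minimum weight $2m$. Then for every $\ell\le 3m-1$, $C_\ell$ is a combinatorial $1$-design. (4) Let $L\subset\mathbb{R}^{24m}$ be an even unimodular lattice of rank $24m$ with minimum norm $2m$. Then every shell of $L$ supports a spherical $3$-design; that is, for every $\ell>0$ with $L_\ell\ne\emptyset$, $L_\ell$ is a spherical $3$-design.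
   Context: Codes. A linear code $C$ of length $n$ over $\mathbb{F}_q$ is a linear subspace of $\mathbb{F}_q^n$. For $x\in\mathbb{F}_q^n$, $\mathrm{supp}(x)=\{i\mid x_i\neq0\}$ and the weight is $\mathrm{wt}(x)=|\mathrm{supp}(x)|$; the minimum weight of $C$ is the smallest weight of a nonzero codeword. For $q=2,3$, $C$ is self-dual if $C=C^\perp$ with respect to $(x,y)=\sum_i x_iy_i$; for $q=4$, $C$ is self-dual if it equals its dual with respect to the Hermitian inner product $(x,y)_H=\sum_i x_iy_i^2$. A binary doubly even code is a code over $\mathbb{F}_2$ with all weights divisible by $4$; ternary self-dual codes are self-dual codes over $\mathbb{F}_3$ (all weights are divisible by $3$); quaternary self-dual codes are (Hermitian) self-dual codes over $\mathbb{F}_4$ (all weights are divisible by $2$). Put $C_\ell=\{c\in C\mid \mathrm{wt}(c)=\ell\}$; it is called a shell of $C$ when it is non-empty. Combinatorial designs. A pair $(\Omega,\mathcal{B})$, with $\Omega$ a finite set and $\mathcal{B}$ a set (no repeated blocks) of $k$-element subsets of $\Omega$ (blocks), is a combinatorial $t$-design if there is a number $\lambda$ such that any $t$ points of $\Omega$ are contained in precisely $\lambda$ blocks. For a code $C$ of length $n$, $C_\ell$ is said to be a combinatorial $t$-design if $(\Omega,\mathcal{B}(C_\ell))$ is, where $\Omega=\{1,\dots,n\}$ and $\mathcal{B}(C_\ell)=\{\mathrm{supp}(x)\mid x\in C_\ell\}$ (a set, not a multiset). An empty $C_\ell$ satisfies this trivially with $\lambda=0$. Lattices. A lattice $L\subset\mathbb{R}^n$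 is the $\mathbb{Z}$-span of a basis of $\mathbb{R}^n$. It is integral if $(x,y)\in\mathbb{Z}$ for all $x,y\in L$ (standard inner product), even if moreover $(x,x)\in2\mathbb{Z}$ for all $x\in L$, and unimodular if it is integral and equals its dual lattice $\{y\in\mathbb{R}^n\mid (y,x)\in\mathbb{Z}\ \forall x\in L\}$. The minimum norm of $L$ is $\min\{(x,x)\mid 0\ne x\in L\}$. Put $L_\ell=\{x\in L\mid (x,x)=\ell\}$; it is called a shell of $L$ when it is non-empty. Spherical designs. A finite nonempty set $X\subset S^{n-1}$ (the unit sphere of $\mathbb{R}^n$) is a spherical $t$-design if $\frac{1}{|X|}\sum_{x\in X}f(x)=\frac{1}{|S^{n-1}|}\int_{S^{n-1}}f\,d\sigma$ for all polynomials $f$ in $n$ variables of degree at most $t$. $L_\ell$ (with $\ell>0$) is said to be, or to support, a spherical $t$-design if $\frac{1}{\sqrt{\ell}}L_\ell$ is a spherical $t$-design in $S^{n-1}$. *)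

theory Defs
  imports "HOL-Analysis.Analysis"
begin

section \<open>Codes\<close>

text \<open>
  Words of length \<open>n\<close> over \<open>\<bbbF>\<^sub>q\<close> are elements of \<^typ>\<open>'a ^ 'n\<close> with \<open>CARD('n) = n\<close>, where \<^typ>\<open>'a\<close> is
  any field with \<open>CARD('a) = q\<close>; the index type \<^typ>\<open>'n\<close> plays the role of \<open>{1,\<dots>,n}\<close>.
\<close>

definition supp :: "('a::zero) ^ ('n::finite) \<Rightarrow> 'n set" where
  "supp x = {i. x $ i \<noteq> 0}"

definition wt :: "('a::zero) ^ ('n::finite) \<Rightarrow> nat" where
  "wt x = card (supp x)"

definition linear_code :: "(('a::field) ^ ('n::finite)) set \<Rightarrow> bool" where
  "linear_code C \<longleftrightarrow> vec.subspace C"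

definition dual_code :: "(('a::field) ^ ('n::finite)) set \<Rightarrow> ('a ^ 'n) set" where
  "dual_code C = {x. \<forall>y\<in>C. (\<Sum>i\<in>UNIV. x $ i * y $ i) = 0}"

text \<open>The conjugation of \<open>\<bbbF>\<^sub>4\<close> over \<open>\<bbbF>\<^sub>2\<close> is squaring; this is only meaningful for \<open>CARD('a) = 4\<close>.\<close>

definition hermitian_dual_code :: "(('a::field) ^ ('n::finite)) set \<Rightarrow> ('a ^ 'n) set" where
  "hermitian_dual_code C = {x. \<forall>y\<in>C. (\<Sum>i\<in>UNIV. x $ i * (y $ i)\<^sup>2) = 0}"

definition self_dual_code :: "(('a::field) ^ ('n::finite)) set \<Rightarrow> bool" where
  "self_dual_code C \<longleftrightarrow> linear_code C \<and> C = dual_code C"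

definition hermitian_self_dual_code :: "(('a::field) ^ ('n::finite)) set \<Rightarrow> bool" where
  "hermitian_self_dual_code C \<longleftrightarrow> linear_code C \<and> C = hermitian_dual_code C"

definition doubly_even :: "(('a::field) ^ ('n::finite)) set \<Rightarrow> bool" where
  "doubly_even C \<longleftrightarrow> (\<forall>x\<in>C. 4 dvd wt x)"

definition has_min_weight :: "(('a::field) ^ ('n::finite)) set \<Rightarrow> nat \<Rightarrow> bool" where
  "has_min_weight C d \<longleftrightarrow>
     (\<exists>x\<in>C. x \<noteq> 0 \<and> wt x = d) \<and> (\<forall>x\<in>C. x \<noteq> 0 \<longrightarrow> d \<le> wt x)"

definition code_shell :: "(('a::field) ^ ('n::finite)) set \<Rightarrow> nat \<Rightarrow> ('a ^ 'n) set" where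
  "code_shell C l = {x \<in> C. wt x = l}"


section \<open>Combinatorial designs\<close>

definition combinatorial_design :: "nat \<Rightarrow> 'p set \<Rightarrow> 'p set set \<Rightarrow> bool" where
  "combinatorial_design t \<Omega> \<B> \<longleftrightarrow>
     finite \<Omega> \<and>
     (\<exists>k. \<forall>B\<in>\<B>. B \<subseteq> \<Omega> \<and> card B = k) \<and>
     (\<exists>lam::nat. \<forall>T. T \<subseteq> \<Omega> \<and> card T = t \<longrightarrow> card {B \<in> \<B>. T \<subseteq> B} = lam)"

text \<open>The blocks form a set: proportional words give the same block, counted once.\<close>

definition is_combinatorial_design :: "nat \<Rightarrow> (('a::field) ^ ('n::finite)) set \<Rightarrow> bool" where
  "is_combinatorial_design t X \<longleftrightarrow> combinatorial_design t (UNIV :: 'n set) (supp ` X)"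


section \<open>Lattices\<close>

definition is_lattice :: "(real ^ ('n::finite)) set \<Rightarrow> bool" where
  "is_lattice L \<longleftrightarrow>
     (\<exists>B. independent B \<and> span B = UNIV \<and>
          L = range (\<lambda>c :: real ^ 'n \<Rightarrow> int. \<Sum>b\<in>B. of_int (c b) *\<^sub>R b))"

definition integral_lattice :: "(real ^ ('n::finite)) set \<Rightarrow> bool" where
  "integral_lattice L \<longleftrightarrow> is_lattice L \<and> (\<forall>x\<in>L. \<forall>y\<in>L. x \<bullet> y \<in> \<int>)"

definition even_lattice :: "(real ^ ('n::finite)) set \<Rightarrow> bool" where
  "even_lattice L \<longleftrightarrow> integral_lattice L \<and> (\<forall>x\<in>L. \<exists>k::int. x \<bullet> x = 2 * of_int k)"

definition dual_lattice :: "(real ^ ('n::finite)) set \<Rightarrow> (real ^ 'n) set" where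
  "dual_lattice L = {y. \<forall>x\<in>L. y \<bullet> x \<in> \<int>}"

definition unimodular_lattice :: "(real ^ ('n::finite)) set \<Rightarrow> bool" where
  "unimodular_lattice L \<longleftrightarrow> integral_lattice L \<and> L = dual_lattice L"

definition has_min_norm :: "(real ^ ('n::finite)) set \<Rightarrow> real \<Rightarrow> bool" where
  "has_min_norm L r \<longleftrightarrow>
     (\<exists>x\<in>L. x \<noteq> 0 \<and> x \<bullet> x = r) \<and> (\<forall>x\<in>L. x \<noteq> 0 \<longrightarrow> r \<le> x \<bullet> x)"

definition lattice_shell :: "(real ^ ('n::finite)) set \<Rightarrow> real \<Rightarrow> (real ^ 'n) set" where
  "lattice_shell L l = {x \<in> L. x \<bullet> x = l}"


section \<open>Spherical designs\<close>

text \<open>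
  The surface measure on the unit sphere of an \<open>n\<close>-dimensional Euclidean space:
  \<open>\<sigma>(E) = n \<cdot> vol {r \<cdot> x | 0 < r \<le> 1, x \<in> E}\<close>, obtained from polar coordinates. It is the
  push-forward of \<open>n\<close> times Lebesgue measure on the punctured unit ball under
  \<open>x \<mapsto> x / \<parallel>x\<parallel>\<close>, which is \<^const>\<open>sgn\<close> on a normed space.
\<close>

definition sphere_measure :: "('a::euclidean_space) measure" where
  "sphere_measure =
     scale_measure (of_nat DIM('a))
       (distr (restrict_space lborel (cball 0 1 - {0})) (restrict_space borel (sphere 0 1)) sgn)"

lemma space_sphere_measure [simp]:
  "space (sphere_measure :: 'a::euclidean_space measure) = sphere 0 1"
  by (simp add: sphere_measure_def space_scale_measure space_restrict_space)

lemma sets_sphere_measure [simp, measurable_cong]: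
  "sets (sphere_measure :: 'a::euclidean_space measure) = sets (restrict_space borel (sphere 0 1))"
  by (simp add: sphere_measure_def)

lemma measurable_sgn_punctured_ball:
  "(sgn :: 'a::euclidean_space \<Rightarrow> 'a) \<in>
     restrict_space lborel (cball 0 1 - {0}) \<rightarrow>\<^sub>M restrict_space borel (sphere 0 1)"
proof (rule measurable_restrict_space2)
  show "sgn \<in> space (restrict_space lborel (cball 0 1 - {0::'a})) \<rightarrow> sphere 0 1"
    by (auto simp: space_restrict_space norm_sgn)
  have "(\<lambda>x::'a. x /\<^sub>R norm x) \<in> borel_measurable lborel"
    by measurable
  then have "(sgn :: 'a \<Rightarrow> 'a) \<in> borel_measurable lborel"
    by (simp add: sgn_div_norm[abs_def])
  then show "(sgn :: 'a \<Rightarrow> 'a) \<in> borel_measurable (restrict_space lborel (cball 0 1 - {0}))"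
    by (rule measurable_restrict_space1)
qed

lemma emeasure_sphere_measure:
  fixes E :: "'a::euclidean_space set"
  assumes "E \<in> sets borel" "E \<subseteq> sphere 0 1"
  shows "emeasure sphere_measure E =
           of_nat DIM('a) * emeasure lborel {r *\<^sub>R x | r x. 0 < r \<and> r \<le> 1 \<and> x \<in> E}"
proof -
  have E: "E \<in> sets (restrict_space borel (sphere 0 1))"
    using assms by (auto simp: sets_restrict_space)
  have eq: "sgn -` E \<inter> (cball 0 1 - {0}) = {r *\<^sub>R x | r x. 0 < r \<and> r \<le> 1 \<and> x \<in> E}"
  proof (intro set_eqI iffI)
    fix y assume y: "y \<in> sgn -` E \<inter> (cball 0 1 - {0})"
    then have "y = norm y *\<^sub>R sgn y" by (simp add: sgn_div_norm)
    with y show "y \<in> {r *\<^sub>R x | r x. 0 < r \<and> r \<le> 1 \<and> x \<in> E}"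
      by (intro CollectI exI[of _ "norm y"] exI[of _ "sgn y"]) auto
  next
    fix y assume "y \<in> {r *\<^sub>R x | r x. 0 < r \<and> r \<le> 1 \<and> x \<in> E}"
    then obtain r x where *: "y = r *\<^sub>R x" "0 < r" "r \<le> 1" "x \<in> E" by auto
    with assms have "norm x = 1" by auto
    with * show "y \<in> sgn -` E \<inter> (cball 0 1 - {0})"
      by (auto simp: sgn_div_norm)
  qed
  have "{r *\<^sub>R x | r x. 0 < r \<and> r \<le> 1 \<and> x \<in> E} \<subseteq> cball 0 1 - {0}"
    by (auto simp flip: eq)
  then have "emeasure (restrict_space lborel (cball 0 1 - {0})) {r *\<^sub>R x | r x. 0 < r \<and> r \<le> 1 \<and> x \<in> E} =
      emeasure lborel {r *\<^sub>R x | r x. 0 < r \<and> r \<le> 1 \<and> x \<in> E}"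
    by (intro emeasure_restrict_space) auto
  then show ?thesis
    using E measurable_sgn_punctured_ball[where 'a='a]
    by (simp add: sphere_measure_def emeasure_distr space_restrict_space eq)
qed

lemma emeasure_sphere_measure_sphere:
  "emeasure sphere_measure (sphere 0 1 :: 'a::euclidean_space set) =
     of_nat DIM('a) * emeasure lborel (cball 0 1 :: 'a set)"
proof -
  have "{r *\<^sub>R x | r x. 0 < r \<and> r \<le> 1 \<and> x \<in> sphere 0 1} = cball 0 1 - {0::'a}"
  proof (intro set_eqI iffI)
    fix y :: 'a assume "y \<in> cball 0 1 - {0}"
    then show "y \<in> {r *\<^sub>R x | r x. 0 < r \<and> r \<le> 1 \<and> x \<in> sphere 0 1}"
      by (intro CollectI exI[of _ "norm y"] exI[of _ "sgn y"]) (auto simp: sgn_div_norm)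
  qed auto
  moreover have "emeasure lborel (cball 0 1 - {0::'a}) = emeasure lborel (cball 0 1 :: 'a set)"
    by (rule emeasure_Diff_null_set) (auto simp: null_sets_def)
  ultimately show ?thesis
    by (simp add: emeasure_sphere_measure)
qed

text \<open>Here \<open>\<alpha>\<close> ranges over the exponent vectors of the monomials of a polynomial in the coordinates.\<close>

definition polynomial_function_deg_le :: "nat \<Rightarrow> (real ^ ('n::finite) \<Rightarrow> real) \<Rightarrow> bool" where
  "polynomial_function_deg_le t f \<longleftrightarrow>
     (\<exists>(A :: ('n \<Rightarrow> nat) set) c. finite A \<and> (\<forall>\<alpha>\<in>A. (\<Sum>i\<in>UNIV. \<alpha> i) \<le> t) \<and>
        f = (\<lambda>x. \<Sum>\<alpha>\<in>A. c \<alpha> * (\<Prod>i\<in>UNIV. x $ i ^ \<alpha> i)))"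

definition spherical_design :: "nat \<Rightarrow> (real ^ ('n::finite)) set \<Rightarrow> bool" where
  "spherical_design t X \<longleftrightarrow>
     finite X \<and> X \<noteq> {} \<and> X \<subseteq> sphere 0 1 \<and>
     (\<forall>f. polynomial_function_deg_le t f \<longrightarrow>
        1 / real (card X) * (\<Sum>x\<in>X. f x) =
        1 / measure sphere_measure (sphere 0 1 :: (real ^ 'n) set) *
          integral\<^sup>L sphere_measure f)"

definition supports_spherical_design :: "nat \<Rightarrow> (real ^ ('n::finite)) set \<Rightarrow> real \<Rightarrow> bool" where
  "supports_spherical_design t L l \<longleftrightarrow>
     spherical_design t ((\<lambda>x. (1 / sqrt l) *\<^sub>R x) ` lattice_shell L l)"

end

theory Submission
  imports Defs
    "HOL-Computational_Algebra.Polynomial"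
    "HOL-Complex_Analysis.Conformal_Mappings"
    "HOL-Probability.Characteristic_Functions"
    "HOL-Real_Asymp.Real_Asymp"
begin

text \<open>
  A shell is a design of the required strength as soon as certain sums over it vanish: for a code
  the sums of \<open>[c\<^sub>i \<noteq> 0] - [c\<^sub>k \<noteq> 0]\<close> over the words of weight \<open>l\<close>, for a lattice the sums of the
  harmonic polynomials \<open>x\<^sub>i\<^sup>2 - x\<^sub>j\<^sup>2\<close> and \<open>x\<^sub>i x\<^sub>j\<close> over the vectors of norm \<open>l\<close> (polynomials of odd
  degree cancel because of \<open>x \<mapsto> -x\<close>). The sums over all shells are collected in one generating
  function. Self-duality gives it a functional equation, the minimum weight or norm gives it a zero
  of high order, and together these leave only the zero function.

  Codes. The form \<open>Z(x,y) = \<Sum> a\<^sub>j x\<^bsup>n-1-j\<^esup> y\<^bsup>j-1\<^esup>\<close>, where \<open>a\<^sub>j\<close> is the sum over the words of weight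
  \<open>j\<close>, satisfies \<open>|C| Z(x,y) = -q Z(x+(q-1)y, x-y)\<close> (\<open>harmonic_form_relation\<close>). If the minimum
  weight is \<open>d\<close>, then \<open>y\<^bsup>d-1\<^esup>\<close> divides \<open>Z\<close>, hence so does \<open>(x-y)\<^bsup>d-1\<^esup>\<close>; as all weights are divisible
  by \<open>\<delta> = 4, 3, 2\<close> for \<open>q = 2, 3, 4\<close>, even \<open>(x\<^sup>\<delta>-y\<^sup>\<delta>)\<^bsup>d-1\<^esup>\<close> divides \<open>Z\<close>
  (\<open>harmonic_form_factorization\<close>). A count of degrees leaves \<open>Z = c x\<^sup>2 (y(x\<^sup>3-y\<^sup>3))\<^bsup>d-1\<^esup>\<close>,
  \<open>Z = c x (y(x\<^sup>2-y\<^sup>2))\<^bsup>d-1\<^esup>\<close> and \<open>Z = (xy(x\<^sup>4-y\<^sup>4))\<^bsup>d-1\<^esup> (\<alpha>x\<^sup>4+\<beta>y\<^sup>4)\<close> respectively; in the binary case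
  the all-one word also bounds the weights from above. The base of the power is only multiplied by a
  positive constant under the substitution, so the minus sign of the functional equation makes \<open>Z\<close>
  zero. Finally, two words of weight \<open>l\<close> with the same support are proportional if
  \<open>(q-2)l < (q-1)d\<close>, so that counting words amounts to counting blocks.

  Lattices. For harmonic quadratic \<open>P\<close> the function \<open>f(\<tau>) = \<Sum>\<^sub>x P(x) exp(\<pi>i\<tau>|x|\<^sup>2)\<close> is a modular form
  of weight \<open>12m+2\<close> with a zero of order at least \<open>m\<close> at infinity. Dividing it by the \<open>m\<close>-th power
  of \<open>(\<theta>\<^sub>2\<theta>\<^sub>3\<theta>\<^sub>4)\<^sup>8\<close>, a form of weight 12 that has no zero in the upper half-plane and a simple one at
  infinity, gives a form \<open>g\<close> of weight 2 that is bounded near infinity. A primitive \<open>G\<close> of \<open>g\<close> changes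
  only by constants under \<open>\<tau> \<mapsto> \<tau>+1\<close> and \<open>\<tau> \<mapsto> -1/\<tau>\<close>, and the fixed points \<open>i\<close> and \<open>exp(\<pi>i/3)\<close> of
  \<open>\<tau> \<mapsto> -1/\<tau>\<close> and \<open>\<tau> \<mapsto> 1-1/\<tau>\<close> show that these constants are 0. So \<open>G\<close> is a function of
  \<open>q = exp(2\<pi>i\<tau>)\<close> whose modulus on a small disc has its maximum inside, whence \<open>G\<close> is constant and
  \<open>g = f = 0\<close> (\<open>modular_vanishing\<close>).

  The transformation of \<open>f\<close> and of the theta constants comes from Poisson summation for self-dual
  lattices (\<open>self_dual_poisson\<close>), and the theta constants have no zeros because of
  \<open>\<theta>\<^sub>3(\<tau>)\<theta>\<^sub>4(\<tau>) = \<theta>\<^sub>4(2\<tau>)\<^sup>2\<close> and \<open>\<theta>\<^sub>4(2\<^sup>k\<tau>) \<rightarrow> 1\<close>.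
\<close>

section \<open>Forms killed by the MacWilliams substitution\<close>

text \<open>
  The form \<open>Z(x,y)\<close> of degree \<open>n - 2\<close> attached to the shell sums
  \<open>a\<^sub>j\<close>; the terms with \<open>j = 0\<close> and \<open>j = n\<close> are left
  out because they vanish for a code.
\<close>

definition harmonic_form :: "nat \<Rightarrow> (nat \<Rightarrow> real) \<Rightarrow> real \<Rightarrow> real \<Rightarrow> real" where
  "harmonic_form n a x y = (\<Sum>j\<in>{1..<n}. a j * x ^ (n - 1 - j) * y ^ (j - 1))"

lemma pcompose_one: "pcompose 1 q = 1"
  by (metis one_pCons pcompose_const)

lemma pcompose_power_poly: "pcompose (p ^ k) q = pcompose p q ^ k" for p q :: "real poly"
  by (induction k) (simp_all add: pcompose_mult pcompose_one)

text \<open>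
  The order of the zero at 1 does not change under \<open>s \<mapsto> s\<^sup>\<delta>\<close>,
  since \<open>s\<^sup>\<delta> - 1\<close> has a simple zero there. This replaces the factor
  \<open>(1-s)\<^bsup>d-1\<^esup>\<close> by
  \<open>(1-s\<^sup>\<delta>)\<^bsup>d-1\<^esup>\<close> without recourse to roots of unity.
\<close>

lemma order_1_pcompose_monom:
  fixes Q :: "real poly"
  assumes "Q \<noteq> 0" "\<delta> > 0"
  shows "order 1 (pcompose Q (monom 1 \<delta>)) = order 1 Q"
proof -
  define T where "T = order 1 Q"
  obtain Q1 where Q1: "Q = [:- 1, 1:] ^ T * Q1" "\<not> [:- 1, 1:] dvd Q1"
    using order_decomp[OF assms(1), of 1] by (auto simp: T_def)
  have Q1': "poly Q1 1 \<noteq> 0" using Q1(2) by (simp add: poly_eq_0_iff_dvd)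
  define E where "E = (\<Sum>i<\<delta>. monom (1::real) i)"
  have E: "[:- 1, 1:] * E = monom 1 \<delta> - 1"
  proof -
    have "poly ([:- 1, 1:] * E) s = poly (monom 1 \<delta> - 1) s" for s :: real
    proof -
      have "poly E s = (\<Sum>i<\<delta>. s ^ i)" by (simp add: E_def poly_sum poly_monom)
      thus ?thesis by (simp add: poly_monom power_diff_1_eq algebra_simps)
    qed
    thus ?thesis by (simp add: poly_eq_poly_eq_iff[symmetric] fun_eq_iff)
  qed
  have E1: "poly E 1 \<noteq> 0" using assms(2) by (simp add: E_def poly_sum poly_monom)
  have "pcompose Q (monom 1 \<delta>) = pcompose [:- 1, 1:] (monom 1 \<delta>) ^ T * pcompose Q1 (monom 1 \<delta>)"
    by (subst Q1(1)) (simp add: pcompose_mult pcompose_power_poly)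
  also have "pcompose [:- 1, 1:] (monom 1 \<delta>) = monom (1::real) \<delta> - 1"
    by (simp add: pcompose_pCons pcompose_one) (metis minus_pCons minus_zero one_pCons)
  also have "\<dots> = [:- 1, 1:] * E" by (rule E[symmetric])
  finally have eq: "pcompose Q (monom 1 \<delta>) = [:- 1, 1:] ^ T * (E ^ T * pcompose Q1 (monom 1 \<delta>))"
    by (simp only: power_mult_distrib mult_ac)
  have nz: "poly (E ^ T * pcompose Q1 (monom 1 \<delta>)) 1 \<noteq> 0"
    using E1 Q1' by (simp add: poly_pcompose poly_monom)
  have "E ^ T * pcompose Q1 (monom 1 \<delta>) \<noteq> 0" using nz by auto
  hence "order 1 (pcompose Q (monom 1 \<delta>)) = order 1 ([:- 1, 1::real:] ^ T) + order 1 (E ^ T * pcompose Q1 (monom 1 \<delta>))"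
    unfolding eq by (intro order_mult) auto
  also have "\<dots> = T" using order_power_n_n[of 1 T] order_0I[OF nz] by simp
  finally show ?thesis by (simp add: T_def)
qed

text \<open>
  Write \<open>Z(1,s) = s\<^bsup>d-1\<^esup> Q(s\<^sup>\<delta>)\<close> with \<open>d =
  \<delta>m\<close>. By the functional equation \<open>Z(1,s)\<close> is a combination of the
  polynomials \<open>(1-s)\<^bsup>j-1\<^esup>(1+(q-1)s)\<^bsup>n-1-j\<^esup>\<close> with \<open>j
  \<ge> d\<close>, hence divisible by \<open>(1-s)\<^bsup>d-1\<^esup>\<close>; the order of the
  zero at 1 then passes to \<open>Q\<close>.
\<close>

theorem harmonic_form_factorization:
  fixes a :: "nat \<Rightarrow> real" and N :: real
  assumes rel: "\<And>x y. x \<noteq> 0 \<Longrightarrow> y \<noteq> 0 \<Longrightarrow>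
      N * harmonic_form n a x y = - q * harmonic_form n a (x + (q - 1) * y) (x - y)"
    and N: "N \<noteq> 0" and pos: "\<delta> > 0" "m > 0"
    and supp: "\<And>j. a j \<noteq> 0 \<Longrightarrow> \<delta> dvd j \<and> \<delta> * m \<le> j \<and> j \<le> \<delta> * (m + D) \<and> j < n"
  obtains U where "degree U \<le> D - (\<delta> * m - 1)"
    "\<And>s. harmonic_form n a 1 s = (s * (s ^ \<delta> - 1)) ^ (\<delta> * m - 1) * poly U (s ^ \<delta>)"
proof -
  define d where "d = \<delta> * m"
  have d: "d > 0" using pos by (simp add: d_def)
  define Q where "Q = (\<Sum>k\<le>D. monom (a (\<delta> * (m + k))) k)"
  define p where "p = monom 1 (d - 1) * pcompose Q (monom 1 \<delta>)"
  have form_p: "harmonic_form n a 1 s = poly p s" for s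
  proof -
    have "harmonic_form n a 1 s = (\<Sum>j\<in>{1..<n}. a j * s ^ (j - 1))"
      by (simp add: harmonic_form_def)
    also have "\<dots> = (\<Sum>j\<in>(\<lambda>k. \<delta> * (m + k)) ` {..D}. a j * s ^ (j - 1))"
    proof (rule sum.mono_neutral_cong)
      show "a j * s ^ (j - 1) = 0" if "j \<in> {1..<n} - (\<lambda>k. \<delta> * (m + k)) ` {..D}" for j
      proof (rule ccontr)
        assume "a j * s ^ (j - 1) \<noteq> 0"
        hence j: "\<delta> dvd j" "\<delta> * m \<le> j" "j \<le> \<delta> * (m + D)" using supp[of j] by auto
        then obtain t where t: "j = \<delta> * t" by (elim dvdE)
        hence "m \<le> t" "t \<le> m + D" using j pos by auto
        hence "j = \<delta> * (m + (t - m))" "t - m \<le> D" using t by auto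
        thus False using that by blast
      qed
      show "a j * s ^ (j - 1) = 0" if "j \<in> (\<lambda>k. \<delta> * (m + k)) ` {..D} - {1..<n}" for j
      proof -
        have "j \<ge> 1" using that pos by (auto simp: Suc_le_eq)
        thus ?thesis using that supp[of j] by auto
      qed
    qed auto
    also have "\<dots> = (\<Sum>k\<le>D. a (\<delta> * (m + k)) * s ^ (\<delta> * (m + k) - 1))"
      using pos by (subst sum.reindex) (auto simp: inj_on_def)
    also have "\<dots> = (\<Sum>k\<le>D. s ^ (d - 1) * (a (\<delta> * (m + k)) * (s ^ \<delta>) ^ k))"
    proof (rule sum.cong[OF refl])
      fix k
      have "\<delta> * (m + k) - 1 = (d - 1) + \<delta> * k" using d by (simp add: d_def algebra_simps)
      thus "a (\<delta> * (m + k)) * s ^ (\<delta> * (m + k) - 1) = s ^ (d - 1) * (a (\<delta> * (m + k)) * (s ^ \<delta>) ^ k)"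
        by (simp add: power_add power_mult)
    qed
    also have "\<dots> = poly p s"
      by (simp add: p_def Q_def poly_pcompose poly_monom poly_sum sum_distrib_left)
    finally show ?thesis .
  qed
  define r where "r = (\<Sum>j\<in>{1..<n}. smult (a j) ([:1, q - 1:] ^ (n - 1 - j) * [:1, - 1:] ^ (j - 1)))"
  have eq: "smult N p = smult (- q) r"
  proof (rule ccontr)
    assume ne: "smult N p \<noteq> smult (- q) r"
    have "finite {s. poly (smult N p - smult (- q) r) s = 0}"
      using ne by (intro poly_roots_finite) simp
    moreover have "UNIV - {0} \<subseteq> {s. poly (smult N p - smult (- q) r) s = 0}"
    proof
      fix s :: real assume "s \<in> UNIV - {0}"
      hence "N * harmonic_form n a 1 s = - q * harmonic_form n a (1 + (q - 1) * s) (1 - s)"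
        using rel[of 1 s] by simp
      moreover have "harmonic_form n a (1 + (q - 1) * s) (1 - s) = poly r s"
        by (simp add: harmonic_form_def r_def poly_sum poly_power mult_ac)
      ultimately show "s \<in> {s. poly (smult N p - smult (- q) r) s = 0}" by (simp add: form_p)
    qed
    ultimately have "finite (UNIV - {0::real})" by (rule finite_subset[rotated])
    thus False using infinite_UNIV_char_0[where 'a = real] by simp
  qed
  have dvd_r: "[:1, - 1:] ^ (d - 1) dvd r"
    unfolding r_def
  proof (rule dvd_sum)
    fix j
    show "[:1, - 1:] ^ (d - 1) dvd smult (a j) ([:1, q - 1:] ^ (n - 1 - j) * [:1, - 1:] ^ (j - 1))"
    proof (cases "a j = 0")
      case False
      hence "d - 1 \<le> j - 1" using supp[of j] by (auto simp: d_def)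
      thus ?thesis by (intro dvd_smult dvd_mult le_imp_power_dvd)
    qed simp
  qed
  have "[:1, - 1:] ^ (d - 1) dvd smult N p" unfolding eq using dvd_r by (rule dvd_smult)
  hence "[:1, - 1:] ^ (d - 1) dvd p" using N by (simp add: dvd_smult_iff)
  moreover have "[:1, - 1:] ^ (d - 1) = smult ((- 1) ^ (d - 1)) ([:- 1, 1::real:] ^ (d - 1))"
    by (simp add: smult_power[symmetric])
  ultimately have dvd_p: "[:- 1, 1:] ^ (d - 1) dvd p"
    by (simp add: smult_dvd_iff)
  have dvd_Q: "[:- 1, 1:] ^ (d - 1) dvd Q"
  proof (cases "Q = 0")
    case False
    have "p \<noteq> 0"
      using False pos by (auto simp: p_def pcompose_eq_0_iff degree_monom_eq)
    hence "d - 1 \<le> order 1 p" using dvd_p order_divides[of 1 "d - 1" p] by auto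
    also have "order 1 p = order 1 (monom (1::real) (d - 1)) + order 1 (pcompose Q (monom 1 \<delta>))"
      using \<open>p \<noteq> 0\<close> unfolding p_def by (rule order_mult)
    also have "order 1 (monom (1::real) (d - 1)) = 0"
      by (rule order_0I) (simp add: poly_monom)
    also have "order 1 (pcompose Q (monom 1 \<delta>)) = order 1 Q"
      by (rule order_1_pcompose_monom[OF False pos(1)])
    finally show ?thesis using order_divides[of 1 "d - 1" Q] by auto
  qed simp
  then obtain U where U: "Q = [:- 1, 1:] ^ (d - 1) * U" by (elim dvdE)
  show ?thesis
  proof (rule that[of U])
    have "degree Q \<le> D" unfolding Q_def by (intro degree_sum_le) (auto intro: order_trans[OF degree_monom_le])
    moreover have "degree Q = (d - 1) + degree U" if "U \<noteq> 0"
      using that unfolding U by (subst degree_mult_eq) (auto simp: degree_power_eq)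
    ultimately show "degree U \<le> D - (\<delta> * m - 1)" by (cases "U = 0") (auto simp: d_def)
    fix s
    have "poly p s = s ^ (d - 1) * ((s ^ \<delta> - 1) ^ (d - 1) * poly U (s ^ \<delta>))"
      by (simp add: p_def poly_pcompose poly_monom U poly_power)
    thus "harmonic_form n a 1 s = (s * (s ^ \<delta> - 1)) ^ (\<delta> * m - 1) * poly U (s ^ \<delta>)"
      by (simp add: form_p power_mult_distrib d_def)
  qed
qed

lemma harmonic_form_homogeneous:
  assumes "x \<noteq> 0"
  shows "harmonic_form n a x y = x ^ (n - 2) * harmonic_form n a 1 (y / x)"
  unfolding harmonic_form_def sum_distrib_left
proof (rule sum.cong[OF refl])
  fix j assume "j \<in> {1..<n}"
  hence "n - 2 = (n - 1 - j) + (j - 1)" by auto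
  thus "a j * x ^ (n - 1 - j) * y ^ (j - 1) = x ^ (n - 2) * (a j * 1 ^ (n - 1 - j) * (y / x) ^ (j - 1))"
    using assms by (simp add: power_add power_divide)
qed

text \<open>
  The functional equation in the single variable \<open>s = y/x\<close>; it is evaluated below at
  a few numbers.
\<close>

lemma harmonic_form_rel_1:
  assumes rel: "\<And>x y. x \<noteq> 0 \<Longrightarrow> y \<noteq> 0 \<Longrightarrow>
      N * harmonic_form n a x y = - q * harmonic_form n a (x + (q - 1) * y) (x - y)"
    and s: "s \<noteq> 0" "1 + (q - 1) * s \<noteq> 0"
  shows "N * harmonic_form n a 1 s
    = - q * ((1 + (q - 1) * s) ^ (n - 2) * harmonic_form n a 1 ((1 - s) / (1 + (q - 1) * s)))"
  using rel[of 1 s] s harmonic_form_homogeneous[OF s(2), of n a "1 - s"] by simp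

lemma harmonic_form_zero_coeffs:
  assumes "\<And>s. harmonic_form n a 1 s = 0" "j \<in> {1..<n}"
  shows "a j = 0"
proof -
  define p where "p = (\<Sum>j\<in>{1..<n}. monom (a j) (j - 1))"
  have "poly p s = 0" for s using assms(1)[of s] by (simp add: p_def harmonic_form_def poly_sum poly_monom)
  hence "p = 0" by (simp add: poly_all_0_iff_0[symmetric])
  hence "0 = coeff p (j - 1)" by simp
  also have "\<dots> = (\<Sum>i\<in>{1..<n}. if i = j then a i else 0)"
    unfolding p_def coeff_sum coeff_monom using assms(2) by (intro sum.cong) auto
  also have "\<dots> = a j" using assms(2) by simp
  finally show ?thesis by simp
qed

lemma degree_le_0_poly: "degree U \<le> 0 \<Longrightarrow> poly U s = poly U 0" for U :: "real poly"
proof -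
  assume "degree U \<le> 0"
  then obtain c where "U = [:c:]" by (metis le_zero_eq degree_eq_zeroE)
  thus ?thesis by simp
qed

text \<open>
  Here \<open>U\<close> is a constant \<open>\<alpha>\<close>. At \<open>s = 2\<close> the
  equation reads \<open>N 14\<^sup>e \<alpha> = -75 \<cdot> 126\<^sup>e \<alpha>\<close> with
  \<open>e = 3m - 1\<close>, so that \<open>\<alpha>\<close> has a positive factor. The exponents
  come from \<open>12m - 2 = 4e + 2\<close>.
\<close>

theorem harmonic_form_zero_ternary:
  fixes N :: real
  assumes rel: "\<And>x y. x \<noteq> 0 \<Longrightarrow> y \<noteq> 0 \<Longrightarrow>
      N * harmonic_form (12 * m) a x y = - 3 * harmonic_form (12 * m) a (x + (3 - 1) * y) (x - y)"
    and N: "N > 0" and m: "m > 0"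
    and supp: "\<And>j. a j \<noteq> 0 \<Longrightarrow> 3 dvd j \<and> 3 * m \<le> j \<and> j < 12 * m"
  shows "a j = 0"
proof -
  have s': "3 dvd j \<and> 3 * m \<le> j \<and> j \<le> 3 * (m + (3 * m - 1)) \<and> j < 12 * m" if "a j \<noteq> 0" for j
    using supp[OF that] by (auto elim!: dvdE)
  obtain U where U: "degree U \<le> (3 * m - 1) - (3 * m - 1)"
    "\<And>s. harmonic_form (12 * m) a 1 s = (s * (s ^ 3 - 1)) ^ (3 * m - 1) * poly U (s ^ 3)"
    using harmonic_form_factorization[OF rel _ _ m s'] N by auto
  define \<alpha> where "\<alpha> = poly U 0"
  have U': "poly U s = \<alpha>" for s using degree_le_0_poly[of U s] U(1) by (simp add: \<alpha>_def)
  define e where "e = 3 * m - 1"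
  have e: "12 * m - 2 = 4 * e + 2" using m by (simp add: e_def)
  have "N * harmonic_form (12 * m) a 1 2 = - 3 * ((1 + (3 - 1) * 2) ^ (12 * m - 2) * harmonic_form (12 * m) a 1 ((1 - 2) / (1 + (3 - 1) * 2)))"
    by (rule harmonic_form_rel_1[OF rel]) auto
  moreover have "1 + (3 - 1) * 2 = (5 :: real)" "(1 - 2) / 5 * (((1 - 2) / 5) ^ 3 - 1) = (126 / 625 :: real)"
    "2 * (2 ^ 3 - 1) = (14 :: real)"
    by (simp_all add: power3_eq_cube)
  ultimately have "N * (14 ^ e * \<alpha>) = - 3 * (5 ^ (4 * e + 2) * ((126 / 625) ^ e * \<alpha>))"
    unfolding U(2) U' e_def[symmetric] e by (simp only:)
  moreover have "5 ^ (4 * e + 2) * (126 / 625) ^ e = 25 * (126 :: real) ^ e"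
    by (simp add: power_add power_mult power_mult_distrib[symmetric])
  ultimately have "(N * 14 ^ e + 75 * 126 ^ e) * \<alpha> = 0" by (simp add: algebra_simps)
  moreover have "N * 14 ^ e + 75 * 126 ^ e > 0" using N by (simp add: add_pos_pos)
  ultimately have "\<alpha> = 0" by simp
  hence "harmonic_form (12 * m) a 1 s = 0" for s by (simp add: U(2) U')
  thus ?thesis using harmonic_form_zero_coeffs[of "12 * m" a j] supp[of j] m by (cases "a j = 0") auto
qed

text \<open>
  As in the ternary case: at \<open>s = 2\<close> the equation reads \<open>N 6\<^sup>e \<alpha> =
  -28 \<cdot> 48\<^sup>e \<alpha>\<close> with \<open>e = 2m - 1\<close> and \<open>6m - 2 = 3e +
  1\<close>.
\<close>

theorem harmonic_form_zero_quaternary: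
  fixes N :: real
  assumes rel: "\<And>x y. x \<noteq> 0 \<Longrightarrow> y \<noteq> 0 \<Longrightarrow>
      N * harmonic_form (6 * m) a x y = - 4 * harmonic_form (6 * m) a (x + (4 - 1) * y) (x - y)"
    and N: "N > 0" and m: "m > 0"
    and supp: "\<And>j. a j \<noteq> 0 \<Longrightarrow> 2 dvd j \<and> 2 * m \<le> j \<and> j < 6 * m"
  shows "a j = 0"
proof -
  have s': "2 dvd j \<and> 2 * m \<le> j \<and> j \<le> 2 * (m + (2 * m - 1)) \<and> j < 6 * m" if "a j \<noteq> 0" for j
    using supp[OF that] by (auto elim!: dvdE)
  obtain U where U: "degree U \<le> (2 * m - 1) - (2 * m - 1)"
    "\<And>s. harmonic_form (6 * m) a 1 s = (s * (s ^ 2 - 1)) ^ (2 * m - 1) * poly U (s ^ 2)"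
    using harmonic_form_factorization[OF rel _ _ m s'] N by auto
  define \<alpha> where "\<alpha> = poly U 0"
  have U': "poly U s = \<alpha>" for s using degree_le_0_poly[of U s] U(1) by (simp add: \<alpha>_def)
  define e where "e = 2 * m - 1"
  have e: "6 * m - 2 = 3 * e + 1" using m by (simp add: e_def)
  have "N * harmonic_form (6 * m) a 1 2 = - 4 * ((1 + (4 - 1) * 2) ^ (6 * m - 2) * harmonic_form (6 * m) a 1 ((1 - 2) / (1 + (4 - 1) * 2)))"
    by (rule harmonic_form_rel_1[OF rel]) auto
  moreover have "1 + (4 - 1) * 2 = (7 :: real)" "(1 - 2) / 7 * (((1 - 2) / 7) ^ 2 - 1) = (48 / 343 :: real)"
    "2 * (2 ^ 2 - 1) = (6 :: real)"
    by (simp_all add: power2_eq_square)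
  ultimately have "N * (6 ^ e * \<alpha>) = - 4 * (7 ^ (3 * e + 1) * ((48 / 343) ^ e * \<alpha>))"
    unfolding U(2) U' e_def[symmetric] e by (simp only:)
  moreover have "7 ^ (3 * e + 1) * (48 / 343) ^ e = 7 * (48 :: real) ^ e"
    by (simp add: power_add power_mult power_mult_distrib[symmetric])
  ultimately have "(N * 6 ^ e + 28 * 48 ^ e) * \<alpha> = 0" by (simp add: algebra_simps)
  moreover have "N * 6 ^ e + 28 * 48 ^ e > 0" using N by (simp add: add_pos_pos)
  ultimately have "\<alpha> = 0" by simp
  hence "harmonic_form (6 * m) a 1 s = 0" for s by (simp add: U(2) U')
  thus ?thesis using harmonic_form_zero_coeffs[of "6 * m" a j] supp[of j] m by (cases "a j = 0") auto
qed

text \<open>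
  Here \<open>U\<close> is linear, \<open>U(s\<^sup>4) = \<alpha> + \<beta>s\<^sup>4\<close>. The
  points \<open>s = 2\<close> and \<open>s = 1/2\<close> have images \<open>-1/3\<close> and
  \<open>1/3\<close> under \<open>s \<mapsto> (1-s)/(1+s)\<close>, where \<open>U\<close> takes
  the same value; this gives \<open>\<alpha> = \<beta>\<close>, and then the sign decides.
\<close>

theorem harmonic_form_zero_binary:
  fixes N :: real
  assumes rel: "\<And>x y. x \<noteq> 0 \<Longrightarrow> y \<noteq> 0 \<Longrightarrow>
      N * harmonic_form (24 * m) a x y = - 2 * harmonic_form (24 * m) a (x + (2 - 1) * y) (x - y)"
    and N: "N > 0" and m: "m > 0"
    and supp: "\<And>j. a j \<noteq> 0 \<Longrightarrow> 4 dvd j \<and> 4 * m \<le> j \<and> j \<le> 20 * m"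
  shows "a j = 0"
proof -
  have s': "4 dvd j \<and> 4 * m \<le> j \<and> j \<le> 4 * (m + 4 * m) \<and> j < 24 * m" if "a j \<noteq> 0" for j
    using supp[OF that] m by auto
  obtain U where U: "degree U \<le> 4 * m - (4 * m - 1)"
    "\<And>s. harmonic_form (24 * m) a 1 s = (s * (s ^ 4 - 1)) ^ (4 * m - 1) * poly U (s ^ 4)"
    using harmonic_form_factorization[OF rel _ _ m s'] N by auto
  obtain \<alpha> \<beta> where U': "poly U s = \<alpha> + \<beta> * s" for s
  proof -
    have deg: "degree U \<le> 1" using U(1) m by simp
    obtain c V where V: "U = pCons c V" by (cases U) auto
    have "degree V \<le> 0" using deg unfolding V by (cases "V = 0") auto
    hence "poly U s = c + poly V 0 * s" for s
      using degree_le_0_poly[of V s] by (simp add: V mult.commute)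
    thus ?thesis by (rule that)
  qed
  define e where "e = 4 * m - 1"
  have e: "24 * m - 2 = 6 * e + 4" using m by (simp add: e_def)
  have 1: "N * (\<alpha> + 16 * \<beta>) = - 2 * 8 ^ e * (81 * \<alpha> + \<beta>)"
  proof -
    have "N * harmonic_form (24 * m) a 1 2 = - 2 * ((1 + (2 - 1) * 2) ^ (24 * m - 2) * harmonic_form (24 * m) a 1 ((1 - 2) / (1 + (2 - 1) * 2)))"
      by (rule harmonic_form_rel_1[OF rel]) auto
    moreover have "1 + (2 - 1) * 2 = (3 :: real)" "((1 - 2) / 3) ^ 4 = (1 / 81 :: real)" "2 ^ 4 = (16 :: real)"
      "(1 - 2) / 3 * (1 / 81 - 1) = (80 / 243 :: real)" "2 * (16 - 1) = (30 :: real)"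
      by (simp_all add: power4_eq_xxxx)
    ultimately have "N * (30 ^ e * (\<alpha> + \<beta> * 16)) = - 2 * (3 ^ (6 * e + 4) * ((80 / 243) ^ e * (\<alpha> + \<beta> * (1 / 81))))"
      unfolding U(2) U' e_def[symmetric] e by (simp only:)
    moreover have "3 ^ (6 * e + 4) * (80 / 243) ^ e = 81 * ((30 :: real) ^ e * 8 ^ e)"
      by (simp add: power_add power_mult power_mult_distrib[symmetric])
    ultimately have "30 ^ e * (N * (\<alpha> + 16 * \<beta>)) = - 2 * (81 * (30 ^ e * 8 ^ e)) * (\<alpha> + \<beta> * (1 / 81))"
      by (simp only: mult.assoc[symmetric]) (simp only: mult_ac)
    hence "30 ^ e * (N * (\<alpha> + 16 * \<beta>)) = 30 ^ e * (- 2 * 8 ^ e * (81 * \<alpha> + \<beta>))"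
      by (simp add: algebra_simps)
    thus ?thesis by (subst (asm) mult_left_cancel) auto
  qed
  have 2: "N * (16 * \<alpha> + \<beta>) = - 2 * 8 ^ e * (81 * \<alpha> + \<beta>)"
  proof -
    have "N * harmonic_form (24 * m) a 1 (1 / 2) = - 2 * ((1 + (2 - 1) * (1 / 2)) ^ (24 * m - 2) * harmonic_form (24 * m) a 1 ((1 - 1 / 2) / (1 + (2 - 1) * (1 / 2))))"
      by (rule harmonic_form_rel_1[OF rel]) auto
    moreover have "1 + (2 - 1) * (1 / 2) = (3 / 2 :: real)" "((1 - 1 / 2) / (3 / 2)) ^ 4 = (1 / 81 :: real)"
      "(1 / 2) ^ 4 = (1 / 16 :: real)" "(1 - 1 / 2) / (3 / 2) * (1 / 81 - 1) = (- 80 / 243 :: real)"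
      "1 / 2 * (1 / 16 - 1) = (- 15 / 32 :: real)"
      by (simp_all add: power4_eq_xxxx)
    ultimately have "N * ((- 15 / 32) ^ e * (\<alpha> + \<beta> * (1 / 16)))
       = - 2 * ((3 / 2) ^ (6 * e + 4) * ((- 80 / 243) ^ e * (\<alpha> + \<beta> * (1 / 81))))"
      unfolding U(2) U' e_def[symmetric] e by (simp only:)
    moreover have "(3 / 2) ^ (6 * e + 4) * (- 80 / 243) ^ e = 81 / 16 * ((- 15 / 32 :: real) ^ e * 8 ^ e)"
    proof -
      have "(3 / 2) ^ (6 * e + 4) = ((3 / 2) ^ 6) ^ e * (3 / 2 :: real) ^ 4"
        by (simp only: power_add power_mult)
      hence "(3 / 2) ^ (6 * e + 4) * (- 80 / 243) ^ e = (3 / 2) ^ 4 * ((3 / 2) ^ 6 * (- 80 / 243 :: real)) ^ e"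
        by (simp only: power_mult_distrib mult_ac)
      also have "(3 / 2) ^ 6 * (- 80 / 243 :: real) = (- 15 / 32) * 8" by (simp add: eval_nat_numeral)
      finally show ?thesis by (simp only: power_mult_distrib) (simp add: power4_eq_xxxx)
    qed
    ultimately have "(- 15 / 32) ^ e * (N * (\<alpha> + \<beta> * (1 / 16))) = - 2 * (81 / 16 * ((- 15 / 32) ^ e * 8 ^ e)) * (\<alpha> + \<beta> * (1 / 81))"
      by (simp only: mult.assoc[symmetric]) (simp only: mult_ac)
    hence "16 * ((- 15 / 32) ^ e * (N * (\<alpha> + \<beta> * (1 / 16)))) = 16 * (- 2 * (81 / 16 * ((- 15 / 32) ^ e * 8 ^ e)) * (\<alpha> + \<beta> * (1 / 81)))"
      by (simp only:)
    moreover have "16 * (K * (N * (\<alpha> + \<beta> * (1 / 16)))) = K * (N * (16 * \<alpha> + \<beta>))"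
      "16 * (- 2 * (81 / 16 * (K * M)) * (\<alpha> + \<beta> * (1 / 81))) = K * (- 2 * M * (81 * \<alpha> + \<beta>))" for K M
      by (simp_all add: algebra_simps)
    ultimately have "(- 15 / 32) ^ e * (N * (16 * \<alpha> + \<beta>)) = (- 15 / 32) ^ e * (- 2 * 8 ^ e * (81 * \<alpha> + \<beta>))"
      by (simp only:)
    thus ?thesis by (subst (asm) mult_left_cancel) auto
  qed
  have "N * (\<alpha> + 16 * \<beta>) = N * (16 * \<alpha> + \<beta>)" using 1 2 by simp
  hence ab: "\<beta> = \<alpha>" using N by simp
  have "(17 * N + 164 * 8 ^ e) * \<alpha> = 0" using 1 by (simp add: ab algebra_simps)
  moreover have "17 * N + 164 * 8 ^ e > 0" using N by (simp add: add_pos_pos)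
  ultimately have "\<alpha> = 0" by simp
  hence "harmonic_form (24 * m) a 1 s = 0" for s by (simp add: U(2) U' ab)
  thus ?thesis using harmonic_form_zero_coeffs[of "24 * m" a j] supp[of j] m by (cases "a j = 0") auto
qed

section \<open>The harmonic MacWilliams identity\<close>

text \<open>
  A sum over all words of a product over the coordinates factors; this is what makes the Fourier
  transform of a weight enumerator computable.
\<close>

lemma sum_vec_prod:
  fixes g :: "'n::finite \<Rightarrow> 'a \<Rightarrow> complex"
  assumes fin: "finite (UNIV :: 'a set)"
  shows "finite (UNIV :: ('a ^ 'n) set)"
    and "(\<Sum>v\<in>(UNIV :: ('a ^ 'n) set). \<Prod>k\<in>UNIV. g k (v $ k)) = (\<Prod>k\<in>UNIV. \<Sum>a\<in>UNIV. g k a)"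
proof -
  have bij: "bij_betw (vec_lambda :: ('n \<Rightarrow> 'a) \<Rightarrow> _) (PiE UNIV (\<lambda>_. UNIV)) UNIV"
    by (rule bij_betwI[of _ _ _ vec_nth]) auto
  have "finite (PiE (UNIV :: 'n set) (\<lambda>_. UNIV :: 'a set))"
    using fin by (intro finite_PiE) auto
  thus "finite (UNIV :: ('a ^ 'n) set)" using bij_betw_finite[OF bij] by simp
  have "(\<Sum>v\<in>(UNIV :: ('a ^ 'n) set). \<Prod>k\<in>UNIV. g k (v $ k))
      = (\<Sum>f\<in>PiE UNIV (\<lambda>_. UNIV). \<Prod>k\<in>UNIV. g k (vec_lambda f $ k))"
    by (rule sum.reindex_bij_betw[OF bij, symmetric])
  also have "\<dots> = (\<Prod>k\<in>UNIV. \<Sum>a\<in>UNIV. g k a)"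
    using fin by (subst prod_sum_PiE) auto
  finally show "(\<Sum>v\<in>(UNIV :: ('a ^ 'n) set). \<Prod>k\<in>UNIV. g k (v $ k)) = (\<Prod>k\<in>UNIV. \<Sum>a\<in>UNIV. g k a)" .
qed

text \<open>
  A code that is its own dual for the form \<open>\<Sum> x\<^sub>i \<sigma>(y\<^sub>i)\<close>.
  The Euclidean case is \<open>\<sigma> = id\<close>, the Hermitian case over the field with four
  elements is squaring, and \<open>\<psi>\<close> is a nontrivial character of the additive group
  of the field.
\<close>

locale self_dual_form_code =
  fixes \<psi> :: "'a::field \<Rightarrow> complex" and \<sigma> :: "'a \<Rightarrow> 'a" and C :: "('a ^ 'n::finite) set"
  assumes fin: "finite (UNIV :: 'a set)"
    and psi_add: "\<psi> (a + b) = \<psi> a * \<psi> b" and psi_nontrivial: "\<exists>a. \<psi> a \<noteq> 1" and psi_0: "\<psi> 0 = 1"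
    and sigma_add: "\<sigma> (a + b) = \<sigma> a + \<sigma> b" and sigma_mult: "\<sigma> (a * b) = \<sigma> a * \<sigma> b" and sigma_bij: "bij \<sigma>"
    and subspace: "vec.subspace C"
    and self_dual: "C = {x. \<forall>y\<in>C. (\<Sum>i\<in>UNIV. x $ i * \<sigma> (y $ i)) = 0}"
begin

definition form :: "'a ^ 'n \<Rightarrow> 'a ^ 'n \<Rightarrow> 'a" where
  "form v c = (\<Sum>i\<in>UNIV. v $ i * \<sigma> (c $ i))"

lemma sigma_0: "\<sigma> 0 = 0"
proof -
  have "\<sigma> 0 + \<sigma> 0 = \<sigma> 0 + 0" unfolding add_0_right
    by (rule sigma_add[of 0 0, unfolded add_0_right, symmetric])
  thus ?thesis by (rule add_left_imp_eq)
qed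

lemma sigma_eq_0: "\<sigma> a = 0 \<longleftrightarrow> a = 0"
  using bij_is_inj[OF sigma_bij] by (metis injD sigma_0)

lemma finite_words: "finite (X :: ('a ^ 'n) set)"
  using sum_vec_prod(1)[OF fin] by (rule finite_subset[rotated]) simp

lemma form_add: "form v (c + c') = form v c + form v c'"
  by (simp add: form_def sigma_add distrib_left sum.distrib)

lemma form_scale: "form v (a *s c) = \<sigma> a * form v c"
  by (simp add: form_def sigma_mult sum_distrib_left mult_ac)

text \<open>
  Orthogonality of characters: if \<open>v\<close> is not in the dual, translation by a word on
  which \<open>v\<close> takes a value outside the kernel of \<open>\<psi>\<close> multiplies the
  sum by a number different from 1.
\<close>

lemma char_sum_code: "(\<Sum>c\<in>C. \<psi> (form v c)) = (if v \<in> C then of_nat (card C) else 0)"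
proof (cases "v \<in> C")
  case True
  hence "form v c = 0" if "c \<in> C" for c
    using that self_dual unfolding form_def by blast
  thus ?thesis using True psi_0 by simp
next
  case False
  then obtain c0 where c0: "c0 \<in> C" "form v c0 \<noteq> 0"
    using self_dual unfolding form_def by blast
  obtain a where a: "\<psi> a \<noteq> 1" using psi_nontrivial by blast
  obtain b where b: "\<sigma> b = a / form v c0" using bij_is_surj[OF sigma_bij] by (metis surjD)
  define c1 where "c1 = b *s c0"
  have c1: "c1 \<in> C" "form v c1 = a"
    using c0 b subspace by (auto simp: c1_def form_scale vec.subspace_scale)
  have "bij_betw (\<lambda>c. c + c1) C C"
    by (rule bij_betwI[of _ _ _ "\<lambda>c. c - c1"])
      (use c1 subspace in \<open>auto simp: vec.subspace_add vec.subspace_diff\<close>)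
  hence "(\<Sum>c\<in>C. \<psi> (form v c)) = (\<Sum>c\<in>C. \<psi> (form v (c + c1)))"
    by (rule sum.reindex_bij_betw[symmetric])
  also have "\<dots> = \<psi> a * (\<Sum>c\<in>C. \<psi> (form v c))"
    by (simp add: form_add psi_add c1 sum_distrib_left mult.commute)
  finally have "(1 - \<psi> a) * (\<Sum>c\<in>C. \<psi> (form v c)) = 0" by (simp add: algebra_simps)
  thus ?thesis using a False by simp
qed

lemma psi_sum: "\<psi> (\<Sum>i\<in>I. f i) = (\<Prod>i\<in>I. \<psi> (f i))"
  by (induction I rule: infinite_finite_induct) (auto simp: psi_0 psi_add)

lemma char_sum_field:
  "(\<Sum>a\<in>UNIV - {0}. \<psi> (a * b)) = (if b = 0 then of_nat CARD('a) - 1 else - 1)"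
proof -
  have "(\<Sum>a\<in>UNIV. \<psi> (a * b)) = 0" if b: "b \<noteq> 0"
  proof -
    obtain d where d: "\<psi> d \<noteq> 1" using psi_nontrivial by blast
    have "bij (\<lambda>a. a + d / b)" by (rule bij_betwI[of _ _ _ "\<lambda>a. a - d / b"]) auto
    hence "(\<Sum>a\<in>UNIV. \<psi> (a * b)) = (\<Sum>a\<in>UNIV. \<psi> ((a + d / b) * b))"
      by (rule sum.reindex_bij_betw[symmetric])
    also have "\<dots> = \<psi> d * (\<Sum>a\<in>UNIV. \<psi> (a * b))"
    proof -
      have "(a + d / b) * b = d + a * b" for a using b by (simp add: field_simps)
      thus ?thesis by (simp only: psi_add sum_distrib_left)
    qed
    finally have "(1 - \<psi> d) * (\<Sum>a\<in>UNIV. \<psi> (a * b)) = 0" by (simp add: algebra_simps)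
    thus ?thesis using d by simp
  qed
  moreover have "(\<Sum>a\<in>UNIV. \<psi> (a * b)) = 1 + (\<Sum>a\<in>UNIV - {0}. \<psi> (a * b))"
    using fin by (simp add: sum.remove[of UNIV 0] psi_0)
  moreover have "(\<Sum>a\<in>UNIV - {0}. \<psi> (a * b)) = of_nat CARD('a) - 1" if "b = 0"
  proof -
    have "CARD('a) \<ge> 1" using fin by (simp add: Suc_le_eq card_gt_0_iff)
    thus ?thesis using fin that by (simp add: psi_0 card_Diff_singleton of_nat_diff)
  qed
  ultimately show ?thesis by (auto simp: eq_neg_iff_add_eq_0 add.commute)
qed

text \<open>
  The complex-valued indicator of \<open>i\<close> being in the support, a weight in the character
  sums below.
\<close>

definition covers :: "'n \<Rightarrow> 'a ^ 'n \<Rightarrow> complex" where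
  "covers i v = (if v $ i \<noteq> 0 then 1 else 0)"

definition wexp :: "complex \<Rightarrow> complex \<Rightarrow> 'a ^ 'n \<Rightarrow> complex" where
  "wexp x y v = x ^ (CARD('n) - wt v) * y ^ wt v"

lemma prod_by_support:
  fixes x y :: complex and c :: "'a ^ 'n"
  shows "(\<Prod>j\<in>J. if c $ j = 0 then x else y) = x ^ card {j\<in>J. c $ j = 0} * y ^ card {j\<in>J. c $ j \<noteq> 0}"
  by (simp add: prod.If_cases Int_def)

text \<open>
  The Fourier transform factors over the coordinates. A coordinate \<open>j \<noteq> i\<close>
  contributes \<open>X\<close> or \<open>Y\<close> according to whether \<open>c\<^sub>j\<close>
  vanishes, and coordinate \<open>i\<close>, which must be covered, contributes
  \<open>y(q-1)\<close> or \<open>-y\<close>.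
\<close>

lemma transform_covers:
  fixes c :: "'a ^ 'n" and x y :: complex
  defines "X \<equiv> x + (of_nat CARD('a) - 1) * y" and "Y \<equiv> x - y"
  shows "(\<Sum>v\<in>UNIV. \<psi> (form v c) * (covers i v * wexp x y v))
    = y * (if c $ i = 0 then (of_nat CARD('a) - 1) * (X ^ (CARD('n) - wt c - 1) * Y ^ wt c)
           else - (X ^ (CARD('n) - wt c) * Y ^ (wt c - 1)))"
proof -
  define g where "g j a = \<psi> (a * \<sigma> (c $ j)) * (if a \<noteq> 0 then y else if j = i then 0 else x)" for j a
  have "\<psi> (form v c) * (covers i v * wexp x y v) = (\<Prod>j\<in>UNIV. g j (v $ j))" for v
  proof -
    have "covers i v * wexp x y v = (\<Prod>j\<in>UNIV. if v $ j \<noteq> 0 then y else if j = i then 0 else x)"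
    proof (cases "v $ i = 0")
      case True
      thus ?thesis by (simp add: covers_def prod_zero_iff) (metis True)
    next
      case False
      have "(\<Prod>j\<in>UNIV. if v $ j \<noteq> 0 then y else if j = i then 0 else x) = (\<Prod>j\<in>UNIV. if v $ j = 0 then x else y)"
        using False by (intro prod.cong) auto
      also have "\<dots> = x ^ card {j. v $ j = 0} * y ^ card {j. v $ j \<noteq> 0}"
        using prod_by_support[where J = UNIV and c = v] by simp
      also have "{j. v $ j = 0} = UNIV - supp v" by (auto simp: supp_def)
      also have "card (UNIV - supp v) = CARD('n) - wt v" by (simp add: wt_def card_Diff_subset)
      finally show ?thesis using False by (simp add: covers_def wexp_def wt_def supp_def)
    qed
    thus ?thesis by (simp add: form_def psi_sum g_def prod.distrib)
  qed
  hence "(\<Sum>v\<in>UNIV. \<psi> (form v c) * (covers i v * wexp x y v)) = (\<Prod>j\<in>UNIV. \<Sum>a\<in>UNIV. g j a)"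
    using sum_vec_prod(2)[OF fin, of g] by simp
  also have "\<dots> = (\<Sum>a\<in>UNIV. g i a) * (\<Prod>j\<in>UNIV - {i}. \<Sum>a\<in>UNIV. g j a)"
    by (simp add: prod.remove[of UNIV i])
  also have G: "(\<Sum>a\<in>UNIV. g j a) = (if j = i then 0 else x) + y * (if c $ j = 0 then of_nat CARD('a) - 1 else - 1)" for j
  proof -
    have "(\<Sum>a\<in>UNIV. g j a) = g j 0 + (\<Sum>a\<in>UNIV - {0}. g j a)"
      using fin by (simp add: sum.remove[of UNIV 0])
    also have "(\<Sum>a\<in>UNIV - {0}. g j a) = (\<Sum>a\<in>UNIV - {0}. y * \<psi> (a * \<sigma> (c $ j)))"
      by (intro sum.cong) (auto simp: g_def)
    also have "\<dots> = y * (if c $ j = 0 then of_nat CARD('a) - 1 else - 1)"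
      by (simp add: sum_distrib_left[symmetric] char_sum_field sigma_eq_0)
    finally show ?thesis by (simp add: g_def psi_0)
  qed
  also have "(\<Prod>j\<in>UNIV - {i}. \<Sum>a\<in>UNIV. g j a) = (\<Prod>j\<in>UNIV - {i}. if c $ j = 0 then X else Y)"
    by (intro prod.cong refl) (auto simp: G X_def Y_def mult.commute)
  also have "\<dots> = X ^ card {j\<in>UNIV - {i}. c $ j = 0} * Y ^ card {j\<in>UNIV - {i}. c $ j \<noteq> 0}"
    by (rule prod_by_support)
  finally have main: "(\<Sum>v\<in>UNIV. \<psi> (form v c) * (covers i v * wexp x y v))
    = y * (if c $ i = 0 then of_nat CARD('a) - 1 else - 1)
      * (X ^ card {j\<in>UNIV - {i}. c $ j = 0} * Y ^ card {j\<in>UNIV - {i}. c $ j \<noteq> 0})" by simp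
  have z: "card (UNIV - supp c) = CARD('n) - wt c" by (simp add: wt_def card_Diff_subset)
  show ?thesis
  proof (cases "c $ i = 0")
    case True
    have "{j\<in>UNIV - {i}. c $ j = 0} = (UNIV - supp c) - {i}" "{j\<in>UNIV - {i}. c $ j \<noteq> 0} = supp c"
      using True by (auto simp: supp_def)
    hence "card {j\<in>UNIV - {i}. c $ j = 0} = CARD('n) - wt c - 1" "card {j\<in>UNIV - {i}. c $ j \<noteq> 0} = wt c"
      using True z by (simp_all add: wt_def card_Diff_singleton supp_def)
    thus ?thesis using True by (simp add: main)
  next
    case False
    have "{j\<in>UNIV - {i}. c $ j = 0} = UNIV - supp c" "{j\<in>UNIV - {i}. c $ j \<noteq> 0} = supp c - {i}"
      using False by (auto simp: supp_def)
    hence "card {j\<in>UNIV - {i}. c $ j = 0} = CARD('n) - wt c" "card {j\<in>UNIV - {i}. c $ j \<noteq> 0} = wt c - 1"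
      using False z by (simp_all add: wt_def card_Diff_singleton supp_def)
    thus ?thesis using False by (simp add: main)
  qed
qed

lemma wt_bounds:
  fixes c :: "'a ^ 'n"
  assumes "c $ i \<noteq> 0" "c $ k = 0"
  shows "1 \<le> wt c" "wt c \<le> CARD('n) - 1" "1 \<le> CARD('n)"
proof -
  have "i \<in> supp c" using assms by (simp add: supp_def)
  hence "supp c \<noteq> {}" by blast
  thus "1 \<le> wt c" by (simp add: wt_def Suc_le_eq card_gt_0_iff)
  have "supp c \<subseteq> UNIV - {k}" using assms by (auto simp: supp_def)
  hence "card (supp c) \<le> card (UNIV - {k})" by (intro card_mono) auto
  thus "wt c \<le> CARD('n) - 1" by (simp add: wt_def card_Diff_singleton)
  show "1 \<le> CARD('n)" by (simp add: Suc_le_eq)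
qed

text \<open>
  The function \<open>[v\<^sub>i \<noteq> 0] - [v\<^sub>k \<noteq> 0]\<close> is harmonic of
  degree 1, so it is an eigenfunction of the transform: only words that cover exactly one of
  \<open>i\<close>, \<open>k\<close> survive, and \<open>X + (q-1)Y = qx\<close> produces the
  factor \<open>-qxy\<close>.
\<close>

lemma transform_difference:
  fixes c :: "'a ^ 'n" and x y :: complex
  defines "X \<equiv> x + (of_nat CARD('a) - 1) * y" and "Y \<equiv> x - y"
  shows "(\<Sum>v\<in>UNIV. \<psi> (form v c) * ((covers i v - covers k v) * wexp x y v))
    = - of_nat CARD('a) * x * y * ((covers i c - covers k c) * (X ^ (CARD('n) - 1 - wt c) * Y ^ (wt c - 1)))"
proof -
  let ?T = "\<lambda>i. \<Sum>v\<in>UNIV. \<psi> (form v c) * (covers i v * wexp x y v)"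
  let ?q = "of_nat CARD('a) :: complex"
  have "(\<Sum>v\<in>UNIV. \<psi> (form v c) * ((covers i v - covers k v) * wexp x y v)) = ?T i - ?T k"
    by (simp add: sum_subtractf[symmetric] algebra_simps)
  also have "\<dots> = - ?q * x * y * ((covers i c - covers k c) * (X ^ (CARD('n) - 1 - wt c) * Y ^ (wt c - 1)))"
  proof -
    have step: "?T i - ?T k = - ?q * x * y * (X ^ (CARD('n) - 1 - wt c) * Y ^ (wt c - 1))"
      if ik: "c $ i \<noteq> 0" "c $ k = 0" for i k
    proof -
      define A where "A = X ^ (CARD('n) - 1 - wt c) * Y ^ (wt c - 1)"
      have e: "CARD('n) - wt c = Suc (CARD('n) - 1 - wt c)" "wt c = Suc (wt c - 1)"
        "CARD('n) - wt c - 1 = CARD('n) - 1 - wt c"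
        using wt_bounds[OF ik] by auto
      have p: "X ^ (CARD('n) - wt c) = X * X ^ (CARD('n) - 1 - wt c)" "Y ^ wt c = Y * Y ^ (wt c - 1)"
        by (subst e, simp)+
      have "?T i = - y * (X * A)" "?T k = y * ((?q - 1) * (Y * A))"
        unfolding transform_covers X_def[symmetric] Y_def[symmetric]
        using ik by (simp_all add: A_def p e(3) mult_ac)
      hence "?T i - ?T k = - y * (X + (?q - 1) * Y) * A" by (simp add: algebra_simps)
      also have "X + (?q - 1) * Y = ?q * x" by (simp add: X_def Y_def algebra_simps)
      finally show ?thesis by (simp add: A_def mult_ac)
    qed
    show ?thesis
    proof (cases "c $ i = 0 \<longleftrightarrow> c $ k = 0")
      case True
      hence "?T i = ?T k" by (simp add: transform_covers)
      thus ?thesis using True by (simp add: covers_def)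
    next
      case False
      show ?thesis
      proof (cases "c $ i = 0")
        case True
        hence "c $ k \<noteq> 0" using False by simp
        from step[OF this True] have "?T i - ?T k = ?q * x * y * (X ^ (CARD('n) - 1 - wt c) * Y ^ (wt c - 1))"
          by (simp add: algebra_simps)
        thus ?thesis using True \<open>c $ k \<noteq> 0\<close> by (simp add: covers_def)
      next
        case False
        hence "c $ k = 0" using \<open>\<not> (c $ i = 0 \<longleftrightarrow> c $ k = 0)\<close> by simp
        from step[OF False this] show ?thesis using False \<open>c $ k = 0\<close> by (simp add: covers_def)
      qed
    qed
  qed
  finally show ?thesis .
qed

text \<open>
  Sum \<open>transform_difference\<close> over \<open>c \<in> C\<close> in two ways. Both sides
  carry the factor \<open>xy\<close>, which is why \<open>x\<close> and \<open>y\<close> have to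
  be nonzero.
\<close>

theorem macwilliams_harmonic:
  fixes x y :: complex and i k :: 'n
  assumes xy: "x \<noteq> 0" "y \<noteq> 0"
  defines "Z \<equiv> \<lambda>x y. \<Sum>c\<in>C. (covers i c - covers k c) * (x ^ (CARD('n) - 1 - wt c) * y ^ (wt c - 1))"
  shows "of_nat (card C) * Z x y = - of_nat CARD('a) * Z (x + (of_nat CARD('a) - 1) * y) (x - y)"
proof -
  let ?q = "of_nat CARD('a) :: complex"
  define f where "f v = covers i v - covers k v" for v
  have wz: "f v * wexp x y v = x * y * (f v * (x ^ (CARD('n) - 1 - wt v) * y ^ (wt v - 1)))" for v
  proof (cases "f v = 0")
    case False
    hence "(v $ i \<noteq> 0 \<and> v $ k = 0) \<or> (v $ k \<noteq> 0 \<and> v $ i = 0)" by (auto simp: f_def covers_def split: if_splits)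
    hence b: "1 \<le> wt v" "wt v \<le> CARD('n) - 1" "1 \<le> CARD('n)" using wt_bounds[of v] by blast+
    have "CARD('n) - wt v = Suc (CARD('n) - 1 - wt v)" "wt v = Suc (wt v - 1)" using b by auto
    hence "x ^ (CARD('n) - wt v) = x * x ^ (CARD('n) - 1 - wt v)" "y ^ wt v = y * y ^ (wt v - 1)"
      by (metis power_Suc)+
    thus ?thesis by (simp add: wexp_def mult_ac)
  qed simp
  have "(\<Sum>c\<in>C. \<Sum>v\<in>UNIV. \<psi> (form v c) * (f v * wexp x y v))
      = - ?q * x * y * Z (x + (?q - 1) * y) (x - y)"
    unfolding f_def transform_difference Z_def by (rule sum_distrib_left[symmetric])
  moreover have "(\<Sum>c\<in>C. \<Sum>v\<in>UNIV. \<psi> (form v c) * (f v * wexp x y v))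
      = (\<Sum>v\<in>UNIV. (\<Sum>c\<in>C. \<psi> (form v c)) * (f v * wexp x y v))"
    by (subst sum.swap) (simp add: sum_distrib_right)
  moreover have "\<dots> = (\<Sum>v\<in>C. of_nat (card C) * (f v * wexp x y v))"
    unfolding char_sum_code using finite_words[of UNIV]
    by (intro sum.mono_neutral_cong_right) auto
  moreover have "\<dots> = x * y * (of_nat (card C) * Z x y)"
    by (simp only: wz Z_def f_def[symmetric] sum_distrib_left mult_ac)
  ultimately have eq: "x * y * (of_nat (card C) * Z x y) = x * y * (- ?q * Z (x + (?q - 1) * y) (x - y))"
    by (simp add: mult_ac)
  have "x * y \<noteq> 0" using xy by simp
  from mult_left_cancel[OF this, THEN iffD1, OF eq] show ?thesis .
qed

definition point_count :: "nat \<Rightarrow> 'n \<Rightarrow> nat" where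
  "point_count j i = card {c \<in> C. wt c = j \<and> c $ i \<noteq> 0}"

lemma point_count_difference:
  "real (point_count j i) - real (point_count j k) = (\<Sum>c\<in>{c\<in>C. wt c = j}. Re (covers i c - covers k c))"
proof -
  have "real (point_count j i) = (\<Sum>c\<in>{c\<in>C. wt c = j}. Re (covers i c))" for i
  proof -
    have "(\<Sum>c\<in>{c\<in>C. wt c = j}. Re (covers i c)) = (\<Sum>c\<in>{c\<in>C. wt c = j}. if c \<in> {c. c $ i \<noteq> 0} then 1 else 0)"
      by (intro sum.cong) (auto simp: covers_def)
    also have "\<dots> = real (card ({c\<in>C. wt c = j} \<inter> {c. c $ i \<noteq> 0}))"
      using finite_words[of "{c\<in>C. wt c = j}"] by (simp add: sum.If_cases)
    also have "{c\<in>C. wt c = j} \<inter> {c. c $ i \<noteq> 0} = {c \<in> C. wt c = j \<and> c $ i \<noteq> 0}" by blast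
    finally show ?thesis by (simp add: point_count_def)
  qed
  thus ?thesis by (simp add: sum_subtractf)
qed

lemma harmonic_form_relation:
  fixes x y :: real and i k :: 'n
  assumes xy: "x \<noteq> 0" "y \<noteq> 0"
  defines "a \<equiv> \<lambda>j. real (point_count j i) - real (point_count j k)"
  shows "real (card C) * harmonic_form CARD('n) a x y
    = - real CARD('a) * harmonic_form CARD('n) a (x + (real CARD('a) - 1) * y) (x - y)"
proof -
  define Z where "Z = (\<lambda>x y. \<Sum>c\<in>C. (covers i c - covers k c) * (x ^ (CARD('n) - 1 - wt c) * y ^ (wt c - 1)))"
  have Z: "Z (of_real x) (of_real y) = of_real (harmonic_form CARD('n) a x y)" for x y
  proof -
    define F where "F c = Re (covers i c - covers k c) * (x ^ (CARD('n) - 1 - wt c) * y ^ (wt c - 1))" for c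
    have nz: "wt c \<in> {1..<CARD('n)}" if "F c \<noteq> 0" for c
    proof -
      have "(c $ i \<noteq> 0 \<and> c $ k = 0) \<or> (c $ k \<noteq> 0 \<and> c $ i = 0)"
        using that by (auto simp: F_def covers_def split: if_splits)
      thus ?thesis using wt_bounds[of c] by force
    qed
    have "Z (of_real x) (of_real y) = of_real (\<Sum>c\<in>C. F c)"
      unfolding Z_def F_def of_real_sum by (intro sum.cong) (auto simp: covers_def)
    also have "(\<Sum>c\<in>C. F c) = (\<Sum>c\<in>{c\<in>C. wt c \<in> {1..<CARD('n)}}. F c)"
      using nz by (intro sum.mono_neutral_right finite_words) auto
    also have "\<dots> = (\<Sum>j\<in>{1..<CARD('n)}. \<Sum>c\<in>{c\<in>{c\<in>C. wt c \<in> {1..<CARD('n)}}. wt c = j}. F c)"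
      by (rule sum.group[symmetric]) (auto intro: finite_words)
    also have "\<dots> = (\<Sum>j\<in>{1..<CARD('n)}. a j * x ^ (CARD('n) - 1 - j) * y ^ (j - 1))"
    proof (rule sum.cong[OF refl])
      fix j assume j: "j \<in> {1..<CARD('n)}"
      hence "{c\<in>{c\<in>C. wt c \<in> {1..<CARD('n)}}. wt c = j} = {c\<in>C. wt c = j}" by auto
      thus "(\<Sum>c\<in>{c\<in>{c\<in>C. wt c \<in> {1..<CARD('n)}}. wt c = j}. F c) = a j * x ^ (CARD('n) - 1 - j) * y ^ (j - 1)"
        unfolding a_def point_count_difference sum_distrib_right by (intro sum.cong) (auto simp: F_def)
    qed
    finally show ?thesis by (simp add: harmonic_form_def)
  qed
  have "of_nat (card C) * Z (of_real x) (of_real y)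
      = - of_nat CARD('a) * Z (of_real x + (of_nat CARD('a) - 1) * of_real y) (of_real x - of_real y)"
    unfolding Z_def using xy by (intro macwilliams_harmonic) auto
  also have "of_real x + (of_nat CARD('a) - 1) * of_real y = complex_of_real (x + (real CARD('a) - 1) * y)" by simp
  also have "of_real x - of_real y = complex_of_real (x - y)" by simp
  finally have "complex_of_real (real (card C) * harmonic_form CARD('n) a x y)
     = of_real (- real CARD('a) * harmonic_form CARD('n) a (x + (real CARD('a) - 1) * y) (x - y))"
    unfolding Z by simp
  thus ?thesis unfolding of_real_eq_iff .
qed

lemma card_C_pos: "real (card C) > 0"
proof -
  have "0 \<in> C" using subspace by (rule vec.subspace_0)
  thus ?thesis using finite_words[of C] by (auto simp: card_gt_0_iff)
qed

lemma point_count_difference_support: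
  assumes "real (point_count j i) - real (point_count j k) \<noteq> 0"
  shows "\<exists>c\<in>C. wt c = j \<and> c \<noteq> 0 \<and> (\<exists>l. c $ l = 0)" "j < CARD('n)"
proof -
  have "\<exists>c\<in>{c\<in>C. wt c = j}. Re (covers i c - covers k c) \<noteq> 0"
    using assms unfolding point_count_difference by (metis (mono_tags, lifting) sum.neutral)
  then obtain c where c: "c \<in> C" "wt c = j" "Re (covers i c - covers k c) \<noteq> 0" by blast
  hence d: "(c $ i \<noteq> 0 \<and> c $ k = 0) \<or> (c $ k \<noteq> 0 \<and> c $ i = 0)"
    by (auto simp: covers_def split: if_splits)
  thus "\<exists>c\<in>C. wt c = j \<and> c \<noteq> 0 \<and> (\<exists>l. c $ l = 0)" using c by (intro bexI[of _ c]) auto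
  show "j < CARD('n)" using d wt_bounds[of c] c(2) by force
qed

text \<open>
  If the two words were different, all \<open>q-1\<close> combinations \<open>c - a c'\<close>
  with \<open>a \<noteq> 0\<close> would be nonzero and have weight at least \<open>d\<close>. But
  each coordinate of the support vanishes in exactly one of them, so their weights add up to
  \<open>(q-2)l\<close>.
\<close>

lemma proportional_if_same_support:
  fixes c c' :: "'a ^ 'n"
  assumes d: "\<And>c. c \<in> C \<Longrightarrow> c \<noteq> 0 \<Longrightarrow> d \<le> wt c"
    and small: "(CARD('a) - 2) * l < (CARD('a) - 1) * d"
    and c: "c \<in> C" "wt c = l" "c $ i = 1" and c': "c' \<in> C" "c' $ i = 1" "supp c' = supp c"
  shows "c = c'"
proof (rule ccontr)
  assume ne: "c \<noteq> c'"
  let ?F = "UNIV - {0::'a}"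
  have finF: "finite ?F" using fin by simp
  have s: "c' $ j \<noteq> 0 \<longleftrightarrow> c $ j \<noteq> 0" for j
    using arg_cong[OF c'(3), of "\<lambda>S. j \<in> S"] by (simp add: supp_def)
  have "d \<le> wt (c - a *s c')" if "a \<in> ?F" for a
  proof (rule d)
    show "c - a *s c' \<in> C" using c c' subspace by (intro vec.subspace_diff vec.subspace_scale)
    show "c - a *s c' \<noteq> 0"
    proof
      assume eq: "c - a *s c' = 0"
      hence "(c - a *s c') $ i = 0" by simp
      hence "a = 1" using c c' by simp
      thus False using eq ne by simp
    qed
  qed
  hence "(\<Sum>a\<in>?F. d) \<le> (\<Sum>a\<in>?F. wt (c - a *s c'))" by (rule sum_mono)
  also have "(\<Sum>a\<in>?F. d) = (CARD('a) - 1) * d" using fin by (simp add: card_Diff_singleton)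
  also have "(\<Sum>a\<in>?F. wt (c - a *s c')) = (\<Sum>a\<in>?F. \<Sum>j\<in>supp c. if c $ j \<noteq> a * c' $ j then 1 else 0)"
  proof (rule sum.cong[OF refl])
    fix a
    have "supp (c - a *s c') = {j\<in>supp c. c $ j \<noteq> a * c' $ j}"
      using s by (fastforce simp: supp_def)
    thus "wt (c - a *s c') = (\<Sum>j\<in>supp c. if c $ j \<noteq> a * c' $ j then 1 else 0)"
      by (simp add: wt_def sum.If_cases Int_def)
  qed
  also have "\<dots> = (\<Sum>j\<in>supp c. \<Sum>a\<in>?F. if c $ j \<noteq> a * c' $ j then 1 else 0)" by (rule sum.swap)
  also have "\<dots> = (\<Sum>j\<in>supp c. CARD('a) - 2)"
  proof (rule sum.cong[OF refl])
    fix j assume "j \<in> supp c"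
    hence nz: "c $ j \<noteq> 0" "c' $ j \<noteq> 0" using s by (auto simp: supp_def)
    have "(\<Sum>a\<in>?F. if c $ j \<noteq> a * c' $ j then 1 else 0) = card {a\<in>?F. c $ j \<noteq> a * c' $ j}"
      using finF by (simp add: sum.If_cases Int_def)
    also have "{a\<in>?F. c $ j \<noteq> a * c' $ j} = UNIV - {0, c $ j / c' $ j}"
      using nz by (auto simp: field_simps)
    also have "card \<dots> = CARD('a) - 2"
      using nz fin by (subst card_Diff_subset) auto
    finally show "(\<Sum>a\<in>?F. if c $ j \<noteq> a * c' $ j then 1 else 0) = CARD('a) - 2" .
  qed
  also have "\<dots> = l * (CARD('a) - 2)" using c(2) by (simp add: wt_def)
  finally show False using small by (simp add: mult.commute)
qed

text \<open>
  Every word covering \<open>i\<close> is a unique scalar multiple of a word with entry 1 there.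
\<close>

lemma point_count_normalized:
  "point_count j i = (CARD('a) - 1) * card {c \<in> C. wt c = j \<and> c $ i = 1}"
proof -
  let ?N = "{c \<in> C. wt c = j \<and> c $ i = 1}"
  have wt_scale: "wt (a *s c) = wt c" if "a \<noteq> 0" for a and c :: "'a ^ 'n"
    using that by (simp add: wt_def supp_def)
  have "bij_betw (\<lambda>(a, c). a *s c) ((UNIV - {0}) \<times> ?N) {c \<in> C. wt c = j \<and> c $ i \<noteq> 0}"
  proof (rule bij_betwI[of _ _ _ "\<lambda>c. (c $ i, inverse (c $ i) *s c)"])
    show "(\<lambda>(a, c). a *s c) \<in> (UNIV - {0}) \<times> ?N \<rightarrow> {c \<in> C. wt c = j \<and> c $ i \<noteq> 0}"
      using subspace by (auto simp: wt_scale vec.subspace_scale)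
    show "(\<lambda>c. (c $ i, inverse (c $ i) *s c)) \<in> {c \<in> C. wt c = j \<and> c $ i \<noteq> 0} \<rightarrow> (UNIV - {0}) \<times> ?N"
      using subspace by (auto simp: wt_scale vec.subspace_scale)
  qed (auto simp: vec_eq_iff)
  hence "card ((UNIV - {0::'a}) \<times> ?N) = point_count j i"
    unfolding point_count_def by (rule bij_betw_same_card)
  thus ?thesis using fin by (simp add: card_cartesian_product card_Diff_singleton)
qed

text \<open>
  Words normalized to have entry 1 at \<open>i\<close> correspond to the blocks through
  \<open>i\<close>, by \<open>proportional_if_same_support\<close>.
\<close>

theorem shell_is_1_design:
  assumes d: "\<And>c. c \<in> C \<Longrightarrow> c \<noteq> 0 \<Longrightarrow> d \<le> wt c"
    and small: "(CARD('a) - 2) * l < (CARD('a) - 1) * d"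
    and eq: "\<And>i k. point_count l i = point_count l k"
  shows "is_combinatorial_design 1 (code_shell C l)"
proof -
  let ?B = "supp ` code_shell C l"
  have "CARD('a) \<ge> 2"
  proof -
    have "card {0, 1 :: 'a} \<le> CARD('a)" using fin by (intro card_mono) auto
    thus ?thesis by simp
  qed
  have count: "card {B \<in> ?B. {i} \<subseteq> B} = card {c \<in> C. wt c = l \<and> c $ i = 1}" for i
  proof -
    have "bij_betw supp {c \<in> C. wt c = l \<and> c $ i = 1} {B \<in> ?B. {i} \<subseteq> B}"
      unfolding bij_betw_def
    proof
      show "inj_on supp {c \<in> C. wt c = l \<and> c $ i = 1}"
        using proportional_if_same_support[OF d small, of _ i] by (auto simp: inj_on_def)
      show "supp ` {c \<in> C. wt c = l \<and> c $ i = 1} = {B \<in> ?B. {i} \<subseteq> B}"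
      proof (intro equalityI subsetI)
        fix B assume "B \<in> {B \<in> ?B. {i} \<subseteq> B}"
        then obtain c where c: "c \<in> C" "wt c = l" "B = supp c" "c $ i \<noteq> 0"
          by (auto simp: code_shell_def supp_def)
        define c1 where "c1 = inverse (c $ i) *s c"
        have s: "supp c1 = supp c" using c(4) by (simp add: c1_def supp_def)
        moreover have "c1 \<in> C" using c(1) subspace by (simp add: c1_def vec.subspace_scale)
        moreover have "c1 $ i = 1" using c(4) by (simp add: c1_def)
        moreover have "wt c1 = l" using s c(2) by (simp add: wt_def)
        ultimately show "B \<in> supp ` {c \<in> C. wt c = l \<and> c $ i = 1}" using c(3) by blast
      qed (auto simp: code_shell_def supp_def)
    qed
    thus ?thesis by (rule bij_betw_same_card[symmetric])
  qed
  obtain i0 :: 'n where True by blast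
  have "card {c \<in> C. wt c = l \<and> c $ i = 1} = card {c \<in> C. wt c = l \<and> c $ i0 = 1}" for i
    using eq[of i i0] \<open>CARD('a) \<ge> 2\<close> unfolding point_count_normalized by simp
  hence const: "card {B \<in> ?B. {i} \<subseteq> B} = card {B \<in> ?B. {i0} \<subseteq> B}" for i by (simp only: count)
  show ?thesis
    unfolding is_combinatorial_design_def combinatorial_design_def
  proof (intro conjI)
    show "\<exists>k. \<forall>B\<in>?B. B \<subseteq> UNIV \<and> card B = k"
      by (intro exI[of _ l]) (auto simp: code_shell_def wt_def)
    show "\<exists>lam. \<forall>T. T \<subseteq> UNIV \<and> card T = 1 \<longrightarrow> card {B \<in> ?B. T \<subseteq> B} = lam"
      using const by (intro exI[of _ "card {B \<in> ?B. {i0} \<subseteq> B}"]) (auto simp: card_1_singleton_iff)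
  qed simp
qed

end

section \<open>Binary, ternary and quaternary codes\<close>

text \<open>
  Compare the sum of all elements with the sum of their translates by 1.
\<close>

lemma of_nat_CARD_eq_0:
  assumes "finite (UNIV :: 'a::ring_1 set)"
  shows "of_nat CARD('a) = (0 :: 'a)"
proof -
  have "bij (\<lambda>a :: 'a. a + 1)" by (rule bij_betwI[of _ _ _ "\<lambda>a. a - 1"]) auto
  hence "(\<Sum>a\<in>(UNIV :: 'a set). a) = (\<Sum>a\<in>UNIV. a + 1)" by (rule sum.reindex_bij_betw[symmetric])
  also have "\<dots> = (\<Sum>a\<in>(UNIV :: 'a set). a) + of_nat CARD('a)" by (simp add: sum.distrib)
  finally show ?thesis by simp
qed

lemma finite_UNIV_if_CARD: "CARD('a) > 0 \<Longrightarrow> finite (UNIV :: 'a set)"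
  by (rule ccontr) simp

lemma sum_products_eq_wt:
  fixes c :: "('a::field) ^ 'n"
  assumes "\<And>i. c $ i \<noteq> 0 \<Longrightarrow> f i = (1 :: 'a)" "\<And>i. c $ i = 0 \<Longrightarrow> f i = 0"
  shows "(\<Sum>i\<in>UNIV. f i) = of_nat (wt c)"
proof -
  have "(\<Sum>i\<in>UNIV. f i) = (\<Sum>i\<in>supp c. 1)"
    using assms by (intro sum.mono_neutral_cong_right) (auto simp: supp_def)
  thus ?thesis by (simp add: wt_def)
qed

text \<open>
  The all-one word lies in the code because all weights are even. Adding it to a word that is
  neither zero nor all-one shows that weights between \<open>20m\<close> and \<open>24m\<close> do
  not occur.
\<close>

theorem binary_shells_are_1_designs:
  fixes C :: "(('a::field) ^ 'n) set"
  assumes q: "CARD('a) = 2" and n: "CARD('n) = 24 * m" and m: "m > 0"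
    and sd: "self_dual_code C" and de: "doubly_even C" and min: "has_min_weight C (4 * m)"
  shows "is_combinatorial_design 1 (code_shell C l)"
proof -
  have fin: "finite (UNIV :: 'a set)" using q by (intro finite_UNIV_if_CARD) simp
  have U: "(UNIV :: 'a set) = {0, 1}"
    by (rule card_subset_eq[symmetric]) (use fin q in auto)
  have cases: "a = 0 \<or> a = 1" for a :: 'a using U by blast
  have two: "(1 :: 'a) + 1 = 0" using of_nat_CARD_eq_0[OF fin] q by simp
  define \<psi> where "\<psi> a = (if a = 0 then 1 else - 1 :: complex)" for a :: 'a
  interpret self_dual_form_code \<psi> "\<lambda>a. a" C
  proof
    fix a b :: 'a
    show "\<psi> (a + b) = \<psi> a * \<psi> b"
      using cases[of a] cases[of b] two by (auto simp: \<psi>_def)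
    show "\<exists>a. \<psi> a \<noteq> 1" by (rule exI[of _ 1]) (simp add: \<psi>_def)
    show "\<psi> 0 = 1" by (simp add: \<psi>_def)
    show "bij (\<lambda>a :: 'a. a)" by (simp add: bij_def inj_def surj_def)
    show "vec.subspace C" using sd by (simp add: self_dual_code_def linear_code_def)
    show "C = {x. \<forall>y\<in>C. (\<Sum>i\<in>UNIV. x $ i * y $ i) = 0}"
      using sd unfolding self_dual_code_def dual_code_def by blast
  qed (use fin in auto)
  have d: "4 * m \<le> wt c" if "c \<in> C" "c \<noteq> 0" for c
    using min that by (simp add: has_min_weight_def)
  have four: "4 dvd wt c" if "c \<in> C" for c using de that by (simp add: doubly_even_def)
  have ones: "(\<chi> i. 1) \<in> C"
  proof -
    have "(\<Sum>i\<in>UNIV. ((\<chi> i. 1) :: 'a ^ 'n) $ i * c $ i) = 0" if "c \<in> C" for c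
    proof -
      have "(\<Sum>i\<in>UNIV. ((\<chi> i. 1) :: 'a ^ 'n) $ i * c $ i) = of_nat (wt c)"
      proof (rule sum_products_eq_wt[of c "\<lambda>i. ((\<chi> i. 1) :: 'a ^ 'n) $ i * c $ i"])
        show "((\<chi> i. 1) :: 'a ^ 'n) $ i * c $ i = 1" if "c $ i \<noteq> 0" for i
          using cases[of "c $ i"] that by (elim disjE) simp_all
      qed simp
      moreover have "even (wt c)" using four[OF that] by (rule dvd_trans[rotated]) simp
      then obtain k where k: "wt c = k + k" by (metis evenE mult_2)
      have "of_nat k + of_nat k = (0 :: 'a)"
        using cases[of "of_nat k"] two by (elim disjE) (simp_all only: add_0_left)
      hence "of_nat (wt c) = (0 :: 'a)" unfolding k of_nat_add .
      ultimately show ?thesis by simp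
    qed
    thus ?thesis by (subst self_dual) blast
  qed
  have supp_a: "4 dvd j \<and> 4 * m \<le> j \<and> j \<le> 20 * m"
    if nz: "real (point_count j i) - real (point_count j k) \<noteq> 0" for i k j
  proof -
    obtain c p where c: "c \<in> C" "wt c = j" "c \<noteq> 0" "c $ p = 0"
      using point_count_difference_support(1)[OF nz] by blast
    define c' where "c' = (\<chi> i. 1) - c"
    have "c' \<in> C" unfolding c'_def using ones c(1) subspace by (rule vec.subspace_diff[rotated])
    moreover have "c' $ p = 1" using c(4) by (simp add: c'_def)
    hence "c' \<noteq> 0" by auto
    ultimately have "4 * m \<le> wt c'" by (rule d)
    moreover have "supp c' = UNIV - supp c" using cases by (auto simp: supp_def c'_def)
    hence "wt c' = CARD('n) - wt c" by (simp add: wt_def card_Diff_subset)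
    ultimately have "j \<le> 20 * m" using n c(2) m by simp
    thus ?thesis using four[OF c(1)] d[OF c(1,3)] c(2) by simp
  qed
  have eq: "point_count l i = point_count l k" for i k
  proof -
    have "real (point_count l i) - real (point_count l k) = 0"
    proof (rule harmonic_form_zero_binary[where a = "\<lambda>j. real (point_count j i) - real (point_count j k)" and j = l,
          OF _ card_C_pos m supp_a])
      show "real (card C) * harmonic_form (24 * m) (\<lambda>j. real (point_count j i) - real (point_count j k)) x y
        = - 2 * harmonic_form (24 * m) (\<lambda>j. real (point_count j i) - real (point_count j k)) (x + (2 - 1) * y) (x - y)"
        if "x \<noteq> 0" "y \<noteq> 0" for x y
        using harmonic_form_relation[OF that, of i k] unfolding q n by simp
    qed
    thus ?thesis by simp
  qed
  show ?thesis
    by (rule shell_is_1_design[OF d _ eq]) (use q m in auto)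
qed

text \<open>
  A word is orthogonal to itself and nonzero squares are 1, so weights are divisible by 3.
\<close>

theorem ternary_shells_are_1_designs:
  fixes C :: "(('a::field) ^ 'n) set"
  assumes q: "CARD('a) = 3" and n: "CARD('n) = 12 * m" and m: "m > 0"
    and sd: "self_dual_code C" and min: "has_min_weight C (3 * m)" and l: "l \<le> 6 * m - 3"
  shows "is_combinatorial_design 1 (code_shell C l)"
proof -
  have fin: "finite (UNIV :: 'a set)" using q by (intro finite_UNIV_if_CARD) simp
  have three: "(1 :: 'a) + 1 + 1 = 0"
    using of_nat_CARD_eq_0[OF fin] q by simp
  have ne: "(1 :: 'a) \<noteq> - 1" 
  proof
    assume "(1 :: 'a) = - 1"
    hence "(1 :: 'a) + 1 = 0" by (metis add.left_inverse)
    thus False using three by simp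
  qed
  have U: "(UNIV :: 'a set) = {0, 1, - 1}"
    by (rule card_subset_eq[symmetric]) (use fin q ne in auto)
  have cases: "a = 0 \<or> a = 1 \<or> a = - 1" for a :: 'a using U by blast
  have two: "(1 :: 'a) + 1 = - 1" "(- 1 :: 'a) + - 1 = 1"
    using three by (simp_all add: eq_neg_iff_add_eq_0 neg_eq_iff_add_eq_0 add.assoc)
  define \<omega> where "\<omega> = cis (2 * pi / 3)"
  have \<omega>3: "\<omega> * \<omega> * \<omega> = 1" by (simp add: \<omega>_def cis_mult)
  have \<omega>1: "\<omega> \<noteq> 1"
  proof
    assume "\<omega> = 1"
    hence "cos (2 * pi / 3) = 1" by (simp add: \<omega>_def complex_eq_iff)
    thus False by (simp add: cos_120)
  qed
  define \<psi> where "\<psi> a = (if a = 0 then 1 else if a = 1 then \<omega> else \<omega> * \<omega>)" for a :: 'a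
  have \<psi>: "\<psi> 0 = 1" "\<psi> 1 = \<omega>" "\<psi> (- 1) = \<omega> * \<omega>"
    using ne by (auto simp: \<psi>_def)
  have \<omega>3': "\<omega> * (\<omega> * \<omega>) = 1" using \<omega>3 by (simp only: mult.assoc)
  have \<omega>4: "\<omega> * \<omega> * (\<omega> * \<omega>) = \<omega>" using \<omega>3 by (metis mult.assoc mult_1)
  interpret self_dual_form_code \<psi> "\<lambda>a. a" C
  proof
    fix a b :: 'a
    show "\<psi> (a + b) = \<psi> a * \<psi> b"
      using cases[of a] cases[of b] by (elim disjE) (simp_all only: two \<psi> add_0_left add_0_right add.left_inverse add.right_inverse
          mult_1_left mult_1_right \<omega>3 \<omega>3' \<omega>4)
    show "bij (\<lambda>a :: 'a. a)" by (simp add: bij_def inj_def surj_def)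
    show "\<exists>a. \<psi> a \<noteq> 1" by (rule exI[of _ 1]) (simp add: \<psi> \<omega>1)
    show "\<psi> 0 = 1" by (rule \<psi>)
    show "vec.subspace C" using sd by (simp add: self_dual_code_def linear_code_def)
    show "C = {x. \<forall>y\<in>C. (\<Sum>i\<in>UNIV. x $ i * y $ i) = 0}"
      using sd unfolding self_dual_code_def dual_code_def by blast
  qed (use fin in auto)
  have d: "3 * m \<le> wt c" if "c \<in> C" "c \<noteq> 0" for c
    using min that by (simp add: has_min_weight_def)
  have dvd: "3 dvd wt c" if "c \<in> C" for c
  proof -
    have "(\<Sum>i\<in>UNIV. c $ i * c $ i) = 0" using self_dual that by blast
    moreover have "(\<Sum>i\<in>UNIV. c $ i * c $ i) = of_nat (wt c)"
    proof (rule sum_products_eq_wt[of c "\<lambda>i. c $ i * c $ i"])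
      show "c $ i * c $ i = 1" if "c $ i \<noteq> 0" for i using cases[of "c $ i"] that by (elim disjE) simp_all
    qed simp
    ultimately have 0: "of_nat (wt c) = (0 :: 'a)" by simp
    have 3: "of_nat 3 = (0 :: 'a)" using of_nat_CARD_eq_0[OF fin] q by simp
    have "of_nat (wt c) = (of_nat (3 * (wt c div 3) + wt c mod 3) :: 'a)" by simp
    also have "\<dots> = of_nat 3 * of_nat (wt c div 3) + of_nat (wt c mod 3)" by (simp only: of_nat_add of_nat_mult)
    finally have r: "of_nat (wt c mod 3) = (0 :: 'a)" using 0 by (simp only: 3 mult_zero_left add_0_left)
    have "of_nat 2 = (- 1 :: 'a)" using two(1) by simp
    hence "of_nat 2 \<noteq> (0 :: 'a)" by (simp only: neg_equal_0_iff_equal one_neq_zero not_False_eq_True)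
    moreover have "wt c mod 3 = 0 \<or> wt c mod 3 = 1 \<or> wt c mod 3 = 2" by arith
    ultimately have "wt c mod 3 = 0" using r by (elim disjE) (simp_all only: of_nat_1 one_neq_zero)
    thus ?thesis by (simp add: dvd_eq_mod_eq_0)
  qed
  have supp_a: "3 dvd j \<and> 3 * m \<le> j \<and> j < 12 * m"
    if nz: "real (point_count j i) - real (point_count j k) \<noteq> 0" for i k j
    using point_count_difference_support[OF nz] d dvd n by auto
  have eq: "point_count l i = point_count l k" for i k
  proof -
    have "real (point_count l i) - real (point_count l k) = 0"
    proof (rule harmonic_form_zero_ternary[where a = "\<lambda>j. real (point_count j i) - real (point_count j k)" and j = l,
          OF _ card_C_pos m supp_a])
      show "real (card C) * harmonic_form (12 * m) (\<lambda>j. real (point_count j i) - real (point_count j k)) x y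
        = - 3 * harmonic_form (12 * m) (\<lambda>j. real (point_count j i) - real (point_count j k)) (x + (3 - 1) * y) (x - y)"
        if "x \<noteq> 0" "y \<noteq> 0" for x y
        using harmonic_form_relation[OF that, of i k] unfolding q n by simp
    qed
    thus ?thesis by simp
  qed
  show ?thesis
    by (rule shell_is_1_design[OF d _ eq]) (use q m l in auto)
qed

text \<open>
  The norm of a nonzero element is \<open>a \<cdot> a\<^sup>2 = 1\<close>, so weights are even. A
  character is obtained from the subgroup \<open>{0, 1}\<close> of index 2.
\<close>

theorem quaternary_shells_are_1_designs:
  fixes C :: "(('a::field) ^ 'n) set"
  assumes q: "CARD('a) = 4" and n: "CARD('n) = 6 * m" and m: "m > 0"
    and sd: "hermitian_self_dual_code C" and min: "has_min_weight C (2 * m)" and l: "l \<le> 3 * m - 1"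
  shows "is_combinatorial_design 1 (code_shell C l)"
proof -
  have fin: "finite (UNIV :: 'a set)" using q by (intro finite_UNIV_if_CARD) simp
  have two: "(1 :: 'a) + 1 = 0"
  proof -
    have "((1 :: 'a) + 1) * (1 + 1) = 0" using of_nat_CARD_eq_0[OF fin] q by simp
    thus ?thesis by (simp only: mult_eq_0_iff disj_absorb)
  qed
  have dbl: "a + a = 0" for a :: 'a
    using arg_cong[OF two, of "\<lambda>t. a * t"] by (simp only: distrib_left mult_1_right mult_zero_right)
  have dbl': "a + (a + b) = b" for a b :: 'a by (simp add: dbl add.assoc[symmetric])
  have eq_iff: "a + b = 0 \<longleftrightarrow> a = b" for a b :: 'a
    by (metis dbl' dbl add.right_neutral)
  obtain \<theta> :: 'a where \<theta>: "\<theta> \<noteq> 0" "\<theta> \<noteq> 1"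
  proof -
    have "card {0, 1 :: 'a} < CARD('a)" using q by simp
    hence "{0, 1 :: 'a} \<noteq> UNIV" by (metis less_irrefl)
    thus ?thesis using that by blast
  qed
  have \<theta>1: "\<theta> + 1 \<noteq> 0" "\<theta> + 1 \<noteq> 1" "\<theta> + 1 \<noteq> \<theta>"
    using \<theta> by (auto simp: eq_iff)
  have U: "(UNIV :: 'a set) = {0, 1, \<theta>, \<theta> + 1}"
    by (rule card_subset_eq[symmetric]) (use fin q \<theta> \<theta>1 in auto)
  have cases: "a = 0 \<or> a = 1 \<or> a = \<theta> \<or> a = \<theta> + 1" for a :: 'a using U by blast
  have sq: "a\<^sup>2 = a + 1" if "a \<noteq> 0" "a \<noteq> 1" for a :: 'a
  proof -
    have "(a + 1)\<^sup>2 = a\<^sup>2 + (a + a) + 1" by (simp add: power2_eq_square algebra_simps)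
    hence "(a + 1)\<^sup>2 = a\<^sup>2 + 1" by (simp only: dbl add_0_right)
    moreover have "(a + 1)\<^sup>2 \<noteq> 0" using that by (simp add: eq_iff)
    ultimately have "a\<^sup>2 \<noteq> 1" using dbl[of 1] by metis
    moreover have "a\<^sup>2 \<noteq> 0" "a\<^sup>2 \<noteq> a" using that by (auto simp: power2_eq_square)
    moreover have "card {0, 1, a, a + 1} = CARD('a)"
      using that q by (simp add: eq_iff)
    hence "{0, 1, a, a + 1} = UNIV" using fin by (intro card_subset_eq) auto
    ultimately show ?thesis by blast
  qed
  have cube: "a * a\<^sup>2 = 1" if "a \<noteq> 0" for a :: 'a
  proof (cases "a = 1")
    case False
    have "a * a\<^sup>2 = a\<^sup>2 + a" by (simp add: sq[OF that False] distrib_left power2_eq_square[symmetric]) 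
    also have "\<dots> = a + (a + 1)" by (simp only: sq[OF that False] add.commute)
    also have "\<dots> = 1" by (rule dbl')
    finally show ?thesis .
  qed simp
  define \<psi> where "\<psi> a = (if a = 0 \<or> a = 1 then 1 else - 1 :: complex)" for a :: 'a
  have \<psi>: "\<psi> 0 = 1" "\<psi> 1 = 1" "\<psi> \<theta> = - 1" "\<psi> (\<theta> + 1) = - 1"
    using \<theta> \<theta>1 by (auto simp: \<psi>_def)
  interpret self_dual_form_code \<psi> "\<lambda>a. a\<^sup>2" C
  proof
    fix a b :: 'a
    have e: "\<theta> + (\<theta> + 1) = 1" "\<theta> + 1 + \<theta> = 1" "\<theta> + 1 + (\<theta> + 1) = 0" "1 + \<theta> = \<theta> + 1" "1 + (\<theta> + 1) = \<theta>" "\<theta> + 1 + 1 = \<theta>"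
      "\<theta> + \<theta> = 0"
      by (simp_all only: add_ac dbl' dbl add_0_left add_0_right)
    show "\<psi> (a + b) = \<psi> a * \<psi> b"
      using cases[of a] cases[of b] by (elim disjE) (simp_all only: e two \<psi> add_0_left add_0_right mult_1_left mult_1_right minus_mult_minus)
    show "\<exists>a. \<psi> a \<noteq> 1" by (rule exI[of _ \<theta>]) (simp add: \<psi>)
    show "\<psi> 0 = 1" by (rule \<psi>)
    show "(a + b)\<^sup>2 = a\<^sup>2 + b\<^sup>2"
    proof -
      have "(a + b)\<^sup>2 = a\<^sup>2 + b\<^sup>2 + (a * b + a * b)" by (simp add: power2_eq_square algebra_simps)
      thus ?thesis by (simp only: dbl add_0_right)
    qed
    show "(a * b)\<^sup>2 = a\<^sup>2 * b\<^sup>2" by (rule power_mult_distrib)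
    show "bij (\<lambda>a :: 'a. a\<^sup>2)"
    proof (rule bij_betwI[of _ _ _ "\<lambda>a. a\<^sup>2"])
      have "(a\<^sup>2)\<^sup>2 = a" for a :: 'a
      proof (cases "a = 0")
        case False
        have "(a\<^sup>2)\<^sup>2 = a * (a * a\<^sup>2)" by (simp add: power2_eq_square mult_ac)
        thus ?thesis using cube[OF False] by simp
      qed simp
      thus "(a\<^sup>2)\<^sup>2 = a" "(a\<^sup>2)\<^sup>2 = a" for a :: 'a by auto
    qed auto
    show "vec.subspace C" using sd by (simp add: hermitian_self_dual_code_def linear_code_def)
    show "C = {x. \<forall>y\<in>C. (\<Sum>i\<in>UNIV. x $ i * (y $ i)\<^sup>2) = 0}"
      using sd unfolding hermitian_self_dual_code_def hermitian_dual_code_def by blast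
  qed (use fin in auto)
  have d: "2 * m \<le> wt c" if "c \<in> C" "c \<noteq> 0" for c
    using min that by (simp add: has_min_weight_def)
  have dvd: "2 dvd wt c" if "c \<in> C" for c
  proof -
    have "(\<Sum>i\<in>UNIV. c $ i * (c $ i)\<^sup>2) = 0" using self_dual that by blast
    moreover have "(\<Sum>i\<in>UNIV. c $ i * (c $ i)\<^sup>2) = of_nat (wt c)"
      by (rule sum_products_eq_wt[of c "\<lambda>i. c $ i * (c $ i)\<^sup>2"]) (simp_all add: cube)
    ultimately have 0: "of_nat (wt c) = (0 :: 'a)" by simp
    show ?thesis
    proof (rule ccontr)
      assume "\<not> 2 dvd wt c"
      then obtain k where "wt c = k + k + 1" by (metis oddE mult_2)
      hence "of_nat (wt c) = (1 :: 'a)" by (simp only: of_nat_add of_nat_1 dbl add_0_left)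
      thus False using 0 by simp
    qed
  qed
  have supp_a: "2 dvd j \<and> 2 * m \<le> j \<and> j < 6 * m"
    if nz: "real (point_count j i) - real (point_count j k) \<noteq> 0" for i k j
    using point_count_difference_support[OF nz] d dvd n by auto
  have eq: "point_count l i = point_count l k" for i k
  proof -
    have "real (point_count l i) - real (point_count l k) = 0"
    proof (rule harmonic_form_zero_quaternary[where a = "\<lambda>j. real (point_count j i) - real (point_count j k)" and j = l,
          OF _ card_C_pos m supp_a])
      show "real (card C) * harmonic_form (6 * m) (\<lambda>j. real (point_count j i) - real (point_count j k)) x y
        = - 4 * harmonic_form (6 * m) (\<lambda>j. real (point_count j i) - real (point_count j k)) (x + (4 - 1) * y) (x - y)"
        if "x \<noteq> 0" "y \<noteq> 0" for x y
        using harmonic_form_relation[OF that, of i k] unfolding q n by simp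
    qed
    thus ?thesis by simp
  qed
  show ?thesis
    by (rule shell_is_1_design[OF d _ eq]) (use q m l in auto)
qed

section \<open>Tilings of space by a lattice; Gaussian integrals\<close>

text \<open>
  The translates of the bounded Borel set \<open>P\<close> by the subgroup \<open>L\<close> tile
  the space. Poisson summation can be carried out with this alone; neither determinants nor a
  change of variables occur.
\<close>

locale lattice_tiling =
  fixes L P :: "'a::euclidean_space set"
  assumes zero_L: "0 \<in> L" and add_L: "\<And>x y. x \<in> L \<Longrightarrow> y \<in> L \<Longrightarrow> x + y \<in> L"
    and minus_L: "\<And>x. x \<in> L \<Longrightarrow> - x \<in> L"
    and countable_L: "countable L"
    and P_borel [measurable]: "P \<in> sets borel" and bounded_P: "bounded P"
    and tile: "\<And>v. \<exists>!x. x \<in> L \<and> v - x \<in> P"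
begin

lemma diff_L: "x \<in> L \<Longrightarrow> y \<in> L \<Longrightarrow> x - y \<in> L"
  using add_L[of x "-y"] minus_L[of y] by simp

definition corner :: "'a \<Rightarrow> 'a" where
  "corner v = (THE x. x \<in> L \<and> v - x \<in> P)"

lemma corner: "corner v \<in> L" "v - corner v \<in> P"
  using theI'[OF tile[of v]] by (auto simp: corner_def)

lemma corner_eq: "x \<in> L \<Longrightarrow> v - x \<in> P \<Longrightarrow> corner v = x"
  using tile[of v] corner[of v] by auto

lemma emeasure_P_finite: "emeasure lborel P < \<infinity>"
  using bounded_P by (rule emeasure_bounded_finite)

lemma integral_translate_tile:
  fixes h :: "'a \<Rightarrow> 'b::euclidean_space"
  assumes [measurable]: "h \<in> borel_measurable borel"
  shows "(\<integral>w. indicator P w *\<^sub>R h (x + w) \<partial>lborel) = (\<integral>v. indicator P (v - x) *\<^sub>R h v \<partial>lborel)"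
proof -
  have "distr lborel borel ((+) x) = (lborel :: 'a measure)"
    by (rule lborel_distr_plus)
  hence "(\<integral>v. indicator P (v - x) *\<^sub>R h v \<partial>lborel)
      = (\<integral>v. indicator P (v - x) *\<^sub>R h v \<partial>distr lborel borel ((+) x))"
    by simp
  also have "\<dots> = (\<integral>w. indicator P w *\<^sub>R h (x + w) \<partial>lborel)"
    by (subst integral_distr) auto
  finally show ?thesis by simp
qed

text \<open>
  Unfolding of an integral over the whole space into integrals over the tile. The partial sum over
  a finite \<open>S \<subseteq> L\<close> is the integral of \<open>h\<close> over the points
  whose corner lies in \<open>S\<close>, and dominated convergence applies along an exhausting
  sequence of finite sets.
\<close>

lemma unfold:
  fixes h :: "'a \<Rightarrow> 'b::euclidean_space"
  assumes h: "integrable lborel h"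
  shows "((\<lambda>x. \<integral>w. indicator P w *\<^sub>R h (x + w) \<partial>lborel) has_sum (\<integral>v. h v \<partial>lborel)) L"
proof -
  note [measurable] = borel_measurable_integrable[OF h]
  define I where "I S v = (\<Sum>x\<in>S. indicator P (v - x) :: real)" for S v
  have [measurable]: "I S \<in> borel_measurable borel" for S
    unfolding I_def by measurable
  have I_eq: "I S v = (if corner v \<in> S then 1 else 0)" if "finite S" "S \<subseteq> L" for S v
  proof -
    have "I S v = (\<Sum>x\<in>S. if x = corner v then 1 else 0)"
      unfolding I_def
    proof (intro sum.cong refl)
      fix x assume "x \<in> S"
      hence "v - x \<in> P \<longleftrightarrow> x = corner v" using that corner(2) corner_eq by blast
      thus "indicator P (v - x) = (if x = corner v then 1 else 0 :: real)" by (cases "x = corner v") auto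
    qed
    thus ?thesis using that by simp
  qed
  have tile_int: "integrable lborel (\<lambda>v. indicator P (v - x) *\<^sub>R h v)" for x
    by (rule Bochner_Integration.integrable_bound[OF h]) (auto simp: indicator_def)
  have partial: "(\<Sum>x\<in>S. \<integral>w. indicator P w *\<^sub>R h (x + w) \<partial>lborel) = (\<integral>v. I S v *\<^sub>R h v \<partial>lborel)"
    if "finite S" "S \<subseteq> L" for S
    using Bochner_Integration.integral_sum[of S lborel "\<lambda>x v. indicator P (v - x) *\<^sub>R h v"]
    by (simp add: integral_translate_tile tile_int scaleR_sum_left I_def)
  have Ih: "integrable lborel (\<lambda>v. (1 - I S v) *\<^sub>R h v)" if "finite S" "S \<subseteq> L" for S
    by (rule Bochner_Integration.integrable_bound[OF h], measurable) (use that in \<open>auto simp: I_eq\<close>)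
  define T where "T k = {x\<in>L. to_nat_on L x < k}" for k
  have T: "finite (T k)" "T k \<subseteq> L" for k
  proof -
    have "inj_on (to_nat_on L) (T k)"
      using inj_on_to_nat_on[OF countable_L] by (rule inj_on_subset) (auto simp: T_def)
    moreover have "to_nat_on L ` T k \<subseteq> {..<k}" by (auto simp: T_def)
    ultimately show "finite (T k)" by (meson finite_imageD finite_lessThan finite_subset)
  qed (auto simp: T_def)
  have lim: "(\<lambda>k. \<integral>v. norm ((1 - I (T k) v) *\<^sub>R h v) \<partial>lborel) \<longlonglongrightarrow> (\<integral>v. 0 \<partial>(lborel :: 'a measure))"
  proof (rule integral_dominated_convergence[where w = "\<lambda>v. norm (h v)"])
    show "AE v in lborel. (\<lambda>k. norm ((1 - I (T k) v) *\<^sub>R h v)) \<longlonglongrightarrow> 0"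
    proof (intro AE_I2 tendsto_eventually)
      fix v :: 'a
      show "\<forall>\<^sub>F k in sequentially. norm ((1 - I (T k) v) *\<^sub>R h v) = 0"
        using eventually_gt_at_top[of "to_nat_on L (corner v)"]
        by eventually_elim (use T corner[of v] in \<open>auto simp: I_eq T_def\<close>)
    qed
    show "(\<lambda>v. norm ((1 - I (T k) v) *\<^sub>R h v)) \<in> borel_measurable lborel" for k by measurable
    show "AE v in lborel. norm (norm ((1 - I (T k) v) *\<^sub>R h v)) \<le> norm (h v)" for k
      using T by (auto simp: I_eq)
  qed (use h in auto)
  show ?thesis
    unfolding has_sum_def
  proof (rule tendstoI)
    fix e :: real assume e: "e > 0"
    from lim have "(\<lambda>k. \<integral>v. norm ((1 - I (T k) v) *\<^sub>R h v) \<partial>lborel) \<longlonglongrightarrow> 0" by simp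
    hence "\<forall>\<^sub>F k in sequentially. (\<integral>v. norm ((1 - I (T k) v) *\<^sub>R h v) \<partial>lborel) < e"
      using e by (rule order_tendstoD)
    then obtain k where k: "(\<integral>v. norm ((1 - I (T k) v) *\<^sub>R h v) \<partial>lborel) < e"
      by (auto simp: eventually_sequentially)
    show "\<forall>\<^sub>F S in finite_subsets_at_top L.
        dist (\<Sum>x\<in>S. \<integral>w. indicator P w *\<^sub>R h (x + w) \<partial>lborel) (\<integral>v. h v \<partial>lborel) < e"
      unfolding eventually_finite_subsets_at_top
    proof (intro exI[of _ "T k"] conjI allI impI)
      fix S assume S: "finite S \<and> T k \<subseteq> S \<and> S \<subseteq> L"
      have "integrable lborel (\<lambda>v. I S v *\<^sub>R h v)"
        by (rule Bochner_Integration.integrable_bound[OF h], measurable) (use S in \<open>auto simp: I_eq\<close>)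
      hence "(\<integral>v. h v \<partial>lborel) - (\<integral>v. I S v *\<^sub>R h v \<partial>lborel) = (\<integral>v. (1 - I S v) *\<^sub>R h v \<partial>lborel)"
        using Bochner_Integration.integral_diff[OF h, of "\<lambda>v. I S v *\<^sub>R h v"]
        by (simp only: scaleR_diff_left scaleR_one)
      hence "dist (\<Sum>x\<in>S. \<integral>w. indicator P w *\<^sub>R h (x + w) \<partial>lborel) (\<integral>v. h v \<partial>lborel)
          = norm (\<integral>v. (1 - I S v) *\<^sub>R h v \<partial>lborel)"
        using S by (simp add: partial dist_norm norm_minus_commute)
      also have "\<dots> \<le> (\<integral>v. norm ((1 - I S v) *\<^sub>R h v) \<partial>lborel)"
        by (rule integral_norm_bound)
      also have "\<dots> \<le> (\<integral>v. norm ((1 - I (T k) v) *\<^sub>R h v) \<partial>lborel)"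
        using S T Ih by (intro integral_mono integrable_norm) (auto simp: I_eq)
      finally show "dist (\<Sum>x\<in>S. \<integral>w. indicator P w *\<^sub>R h (x + w) \<partial>lborel) (\<integral>v. h v \<partial>lborel) < e"
        using k by simp
    qed (use T in auto)
  qed
qed


text \<open>
  Otherwise every integral would unfold to 0.
\<close>

lemma measure_P_pos: "measure lborel P > 0"
proof (rule ccontr)
  assume "\<not> measure lborel P > 0"
  hence "measure lborel P = 0" using measure_nonneg[of lborel P] by linarith
  hence "emeasure lborel P = 0"
    using emeasure_P_finite by (simp add: emeasure_eq_ennreal_measure top.not_eq_extremum)
  hence null: "AE w in lborel. w \<notin> P" by (intro AE_not_in) auto
  define h :: "'a \<Rightarrow> real" where "h = indicator (cball 0 1)"
  have "integrable lborel h"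
    unfolding h_def using emeasure_bounded_finite[of "cball 0 1 :: 'a set"]
    by (intro integrable_real_indicator) auto
  from unfold[OF this] have "((\<lambda>x. \<integral>w. indicator P w *\<^sub>R h (x + w) \<partial>lborel) has_sum (\<integral>v. h v \<partial>lborel)) L" .
  moreover have "(\<integral>w. indicator P w *\<^sub>R h (x + w) \<partial>lborel) = 0" for x
    using null by (intro integral_eq_zero_AE) (auto simp: indicator_def)
  ultimately have "((\<lambda>x. 0) has_sum (\<integral>v. h v \<partial>lborel)) L" by simp
  hence "(\<integral>v. h v \<partial>lborel) = 0"
    using has_sum_unique[OF _ has_sum_0[of L "\<lambda>_. 0::real"]] by blast
  moreover have "(\<integral>v. h v \<partial>lborel) = measure lborel (cball 0 1 :: 'a set)"
    by (simp add: h_def)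
  moreover have "measure lborel (cball 0 1 :: 'a set) > 0"
    using content_cball_pos[of 1 "0::'a"] by (simp add: measure_completion)
  ultimately show False by simp
qed

end


text \<open>
  Integrals of products of functions of single coordinates, used for Gaussians times monomials.
\<close>

lemma lborel_prod_coords:
  fixes f :: "'a::euclidean_space \<Rightarrow> real \<Rightarrow> complex"
  assumes f: "\<And>b. b \<in> Basis \<Longrightarrow> integrable lborel (f b)"
  shows "integrable lborel (\<lambda>x::'a. \<Prod>b\<in>Basis. f b (x \<bullet> b))"
    and "(\<integral>x. (\<Prod>b\<in>Basis. f b (x \<bullet> b)) \<partial>lborel) = (\<Prod>b\<in>Basis. \<integral>x. f b x \<partial>lborel)"
proof -
  interpret product_sigma_finite "\<lambda>_::'a. lborel :: real measure" ..
  have m [measurable]: "b \<in> Basis \<Longrightarrow> f b \<in> borel_measurable borel" for b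
    using f[of b] by (simp add: borel_measurable_integrable)
  let ?g = "\<lambda>x::'a. \<Prod>b\<in>Basis. f b (x \<bullet> b)"
  have g: "?g \<in> borel_measurable borel" by measurable
  let ?T = "\<lambda>z::'a \<Rightarrow> real. \<Sum>b\<in>Basis. z b *\<^sub>R b"
  have T: "?T \<in> measurable (Pi\<^sub>M Basis (\<lambda>_. lborel)) borel" by measurable
  have eq: "?g (?T z) = (\<Prod>b\<in>Basis. f b (z b))" for z
    by (intro prod.cong refl) (simp add: inner_sum_left inner_Basis if_distrib cong: if_cong)
  show "integrable lborel ?g"
    using product_integrable_prod[of "Basis::'a set" f] f
    by (subst lborel_eq, subst integrable_distr_eq[OF T g]) (simp add: eq)
  show "(\<integral>x. ?g x \<partial>lborel) = (\<Prod>b\<in>Basis. \<integral>x. f b x \<partial>lborel)"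
    using product_integral_prod[of "Basis::'a set" f] f
    by (subst lborel_eq, subst integral_distr[OF T g]) (simp add: eq)
qed

lemma gaussian_moment_integrable:
  assumes a: "a > 0"
  shows "integrable lborel (\<lambda>x::real. x ^ k * exp (- a * x\<^sup>2))"
proof -
  define \<sigma> where "\<sigma> = sqrt (1 / (2 * a))"
  have \<sigma>: "\<sigma> > 0" "2 * \<sigma>\<^sup>2 = 1 / a" using a by (auto simp: \<sigma>_def field_simps)
  have "integrable lborel (\<lambda>x. sqrt (2 * pi * \<sigma>\<^sup>2) * (normal_density 0 \<sigma> x * (x - 0) ^ k))"
    using \<sigma> by (intro integrable_mult_right integrable_normal_moment)
  also have "(\<lambda>x. sqrt (2 * pi * \<sigma>\<^sup>2) * (normal_density 0 \<sigma> x * (x - 0) ^ k)) = (\<lambda>x. x ^ k * exp (- a * x\<^sup>2))"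
    using \<sigma> by (auto simp: normal_density_def fun_eq_iff real_sqrt_mult)
  finally show ?thesis .
qed

text \<open>
  The integrand \<open>exp(-\<pi>tx\<^sup>2 - 2\<pi>ixy)\<close> of the Fourier transform of a
  Gaussian.
\<close>

definition gauss_wave :: "real \<Rightarrow> real \<Rightarrow> real \<Rightarrow> complex" where
  "gauss_wave t y x = exp (- of_real (pi * t * x\<^sup>2)) * cis (- 2 * pi * (x * y))"

lemma continuous_gauss_wave: "continuous_on A (gauss_wave t y)"
  unfolding gauss_wave_def cis_conv_exp by (intro continuous_intros)

lemma norm_gauss_wave: "norm (gauss_wave t y x) = exp (- (pi * t) * x\<^sup>2)"
  by (simp add: gauss_wave_def norm_mult)

lemma gauss_wave_measurable [measurable]: "gauss_wave t y \<in> borel_measurable borel"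
  by (rule borel_measurable_continuous_onI) (rule continuous_gauss_wave)

lemma gauss_wave_moment_integrable:
  assumes t: "t > 0"
  shows "integrable lborel (\<lambda>x. of_real (x ^ k) * gauss_wave t y x)"
proof (rule Bochner_Integration.integrable_bound)
  show "integrable lborel (\<lambda>x. x ^ k * exp (- (pi * t) * x\<^sup>2))"
    using t by (intro gaussian_moment_integrable) auto
qed (auto simp: norm_mult norm_gauss_wave norm_power power_abs abs_mult)

lemma gauss_wave_deriv:
  "((\<lambda>x. of_real (x ^ k) * gauss_wave t y x) has_vector_derivative
     (of_real (real k * x ^ (k - 1)) * gauss_wave t y x
       - 2 * of_real (pi * t) * (of_real (x ^ (k + 1)) * gauss_wave t y x)
       - 2 * \<i> * of_real (pi * y) * (of_real (x ^ k) * gauss_wave t y x))) (at x)"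
proof -
  have *: "((\<lambda>z. z ^ k * exp (- of_real (pi * t) * z\<^sup>2 - 2 * \<i> * of_real (pi * y) * z)) has_field_derivative
     (of_nat k * z ^ (k - 1) + z ^ k * (- of_real (pi * t) * (2 * z) - 2 * \<i> * of_real (pi * y)))
       * exp (- of_real (pi * t) * z\<^sup>2 - 2 * \<i> * of_real (pi * y) * z)) (at z)" for z
    by (auto intro!: derivative_eq_intros simp: algebra_simps)
  have eq: "of_real (x ^ k) * gauss_wave t y x
     = (of_real x) ^ k * exp (- of_real (pi * t) * (of_real x)\<^sup>2 - 2 * \<i> * of_real (pi * y) * of_real x)" for x k
    by (simp add: gauss_wave_def cis_conv_exp exp_add[symmetric] algebra_simps)
  have "((\<lambda>x. of_real (x ^ k) * gauss_wave t y x) has_vector_derivative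
     (of_nat k * (of_real x) ^ (k - 1) + (of_real x) ^ k * (- of_real (pi * t) * (2 * of_real x) - 2 * \<i> * of_real (pi * y)))
       * exp (- of_real (pi * t) * (of_real x)\<^sup>2 - 2 * \<i> * of_real (pi * y) * of_real x)) (at x)"
    unfolding eq by (rule has_vector_derivative_real_field[OF *])
  moreover have "gauss_wave t y x = exp (- of_real (pi * t) * (of_real x)\<^sup>2 - 2 * \<i> * of_real (pi * y) * of_real x)"
    using eq[of x 0] by simp
  ultimately show ?thesis by (simp add: algebra_simps)
qed

text \<open>
  The integral of the derivative of \<open>x\<^sup>k exp(-\<pi>tx\<^sup>2 - 2\<pi>ixy)\<close>
  vanishes. For \<open>k = 0, 1\<close> this expresses the first and second moments by the zeroth.
\<close>

lemma gauss_wave_parts: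
  assumes t: "t > 0" and k: "k \<le> 1"
  shows "of_nat k * (\<integral>x. of_real (x ^ (k - 1)) * gauss_wave t y x \<partial>lborel)
       - 2 * of_real (pi * t) * (\<integral>x. of_real (x ^ (k + 1)) * gauss_wave t y x \<partial>lborel)
       - 2 * \<i> * of_real (pi * y) * (\<integral>x. of_real (x ^ k) * gauss_wave t y x \<partial>lborel) = 0"
proof -
  note int = gauss_wave_moment_integrable[OF t]
  let ?F = "\<lambda>x. of_real (x ^ k) * gauss_wave t y x"
  let ?f = "\<lambda>x. of_nat k * (of_real (x ^ (k - 1)) * gauss_wave t y x)
       - 2 * of_real (pi * t) * (of_real (x ^ (k + 1)) * gauss_wave t y x)
       - 2 * \<i> * of_real (pi * y) * (of_real (x ^ k) * gauss_wave t y x)"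
  have intf: "integrable lborel ?f"
    by (intro Bochner_Integration.integrable_diff integrable_mult_right int)
  have lim: "(?F \<longlongrightarrow> 0) F" if "F = at_top \<or> F = at_bot" for F
  proof (rule tendsto_norm_zero_cancel)
    from k have "k = 0 \<or> k = 1" by auto
    hence "((\<lambda>x. \<bar>x\<bar> ^ k * exp (- (pi * t) * x\<^sup>2)) \<longlongrightarrow> 0) F"
      using that
    proof (elim disjE)
      assume "k = 0" "F = at_top"
      thus ?thesis using t by simp real_asymp
    next
      assume "k = 1" "F = at_top"
      thus ?thesis using t by simp real_asymp
    next
      assume "k = 0" "F = at_bot"
      thus ?thesis using t by simp real_asymp
    next
      assume "k = 1" "F = at_bot"
      thus ?thesis using t by simp real_asymp
    qed
    thus "((\<lambda>x. norm (?F x)) \<longlongrightarrow> 0) F"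
      by (simp add: norm_mult norm_gauss_wave norm_power)
  qed
  have "interval_lebesgue_integral lborel (-\<infinity>) \<infinity> ?f = 0 - 0"
  proof (rule interval_integral_FTC_integrable[where F = ?F])
    fix x :: real
    show "(?F has_vector_derivative ?f x) (at x)"
      using gauss_wave_deriv[of k t y x] by (simp add: mult.assoc)
    have "continuous_on UNIV ?f"
      by (intro continuous_intros continuous_gauss_wave)
    thus "isCont ?f x" by (simp add: continuous_on_eq_continuous_at)
  next
    show "set_integrable lborel (einterval (-\<infinity>) \<infinity>) ?f"
      using intf by (simp add: set_integrable_def)
    show "((?F \<circ> real_of_ereal) \<longlongrightarrow> 0) (at_right (-\<infinity>))"
      using lim[of at_bot] by (simp add: ereal_tendsto_simps1 del: of_real_power)
    show "((?F \<circ> real_of_ereal) \<longlongrightarrow> 0) (at_left \<infinity>)"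
      using lim[of at_top] by (simp add: ereal_tendsto_simps1 del: of_real_power)
  qed simp
  hence "integral\<^sup>L lborel ?f = 0"
    by (simp add: interval_lebesgue_integral_def set_lebesgue_integral_def)
  thus ?thesis
    by (simp only: Bochner_Integration.integral_diff Bochner_Integration.integrable_diff
        integrable_mult_right int integral_mult_right_zero)
qed

text \<open>
  The characteristic function of the normal distribution after the substitution \<open>u =
  \<surd>(2\<pi>t) x\<close>.
\<close>

lemma gauss_wave_moment_0:
  assumes t: "t > 0"
  shows "(\<integral>x. gauss_wave t y x \<partial>lborel) = of_real (exp (- pi * y\<^sup>2 / t) / sqrt t)"
proof -
  define c where "c = sqrt (2 * pi * t)"
  have c: "c > 0" "c\<^sup>2 = 2 * pi * t" using t by (auto simp: c_def)
  define s where "s = - 2 * pi * y / c"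
  have "of_real (exp (- s\<^sup>2 / 2)) = char std_normal_distribution s"
    by (simp add: char_std_normal_distribution)
  also have "\<dots> = (\<integral>u. std_normal_density u *\<^sub>R iexp (s * u) \<partial>lborel)"
    unfolding char_def by (subst integral_density) (auto simp: normal_density_nonneg)
  also have "\<dots> = \<bar>c\<bar> *\<^sub>R (\<integral>x. std_normal_density (0 + c * x) *\<^sub>R iexp (s * (0 + c * x)) \<partial>lborel)"
    using c by (intro lborel_integral_real_affine) auto
  also have "(\<lambda>x. std_normal_density (0 + c * x) *\<^sub>R iexp (s * (0 + c * x)))
     = (\<lambda>x. of_real (1 / sqrt (2 * pi)) * gauss_wave t y x)"
  proof
    fix x
    have "(c * x)\<^sup>2 / 2 = pi * t * x\<^sup>2" using c by (simp add: power_mult_distrib)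
    moreover have "s * (c * x) = - 2 * pi * (x * y)" using c by (simp add: s_def)
    ultimately show "std_normal_density (0 + c * x) *\<^sub>R iexp (s * (0 + c * x)) = of_real (1 / sqrt (2 * pi)) * gauss_wave t y x"
      unfolding std_normal_density_def gauss_wave_def cis_conv_exp
      by (simp add: scaleR_conv_of_real exp_of_real[symmetric] del: exp_of_real of_real_mult)
  qed
  finally have "of_real (exp (- s\<^sup>2 / 2)) = of_real (\<bar>c\<bar> / sqrt (2 * pi)) * (\<integral>x. gauss_wave t y x \<partial>lborel)"
    by (simp add: scaleR_conv_of_real)
  moreover have "\<bar>c\<bar> / sqrt (2 * pi) = sqrt t" using c t by (simp add: c_def real_sqrt_mult)
  moreover have "s\<^sup>2 / 2 = pi * y\<^sup>2 / t"
    using c t by (simp add: s_def power_divide power_mult_distrib field_simps power2_eq_square)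
  ultimately show ?thesis using t by (simp add: field_simps)
qed

lemma gauss_wave_moment_1:
  assumes t: "t > 0"
  shows "(\<integral>x. of_real x * gauss_wave t y x \<partial>lborel) = - \<i> * of_real (y / t) * of_real (exp (- pi * y\<^sup>2 / t) / sqrt t)"
proof -
  define G where "G = complex_of_real (exp (- pi * y\<^sup>2 / t) / sqrt t)"
  have "2 * of_real (pi * t) * (\<integral>x. of_real x * gauss_wave t y x \<partial>lborel) = - (2 * \<i> * of_real (pi * y) * G)"
  proof -
    have solve: "0 * c - a - b = 0 \<Longrightarrow> a = - b" for a b c :: complex
      by algebra
    show ?thesis
      using gauss_wave_parts[OF t, of 0 y]
      unfolding power_0 of_real_1 mult_1_left gauss_wave_moment_0[OF t] G_def[symmetric] of_nat_0 add_0 power_one_right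
      by (rule solve) simp
  qed
  also have "\<dots> = 2 * of_real (pi * t) * (- \<i> * of_real (y / t) * G)"
    using t by simp
  finally show ?thesis
    using t by (subst (asm) mult_cancel_left) (simp add: G_def)
qed

lemma gauss_wave_moment_2:
  assumes t: "t > 0"
  shows "(\<integral>x. of_real (x\<^sup>2) * gauss_wave t y x \<partial>lborel)
     = of_real (1 / (2 * pi * t) - y\<^sup>2 / t\<^sup>2) * of_real (exp (- pi * y\<^sup>2 / t) / sqrt t)"
proof -
  define G where "G = complex_of_real (exp (- pi * y\<^sup>2 / t) / sqrt t)"
  have "2 * of_real (pi * t) * (\<integral>x. of_real (x\<^sup>2) * gauss_wave t y x \<partial>lborel)
     = G - 2 * \<i> * of_real (pi * y) * (- \<i> * of_real (y / t) * G)"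
    using gauss_wave_parts[OF t, of 1 y] gauss_wave_moment_0[OF t, of y, folded G_def]
      gauss_wave_moment_1[OF t, of y, folded G_def]
    by (simp add: numeral_2_eq_2 algebra_simps del: of_real_power)
  also have "\<dots> = 2 * of_real (pi * t) * (of_real (1 / (2 * pi * t) - y\<^sup>2 / t\<^sup>2) * G)"
    using t by (simp add: field_simps power2_eq_square)
  finally show ?thesis
    using t by (subst (asm) mult_cancel_left) (simp add: G_def)
qed

lemma gaussian_integrable:
  assumes a: "a > 0"
  shows "integrable lborel (\<lambda>v::'a::euclidean_space. exp (- a * (norm v)\<^sup>2))"
proof -
  have "integrable lborel (\<lambda>v::'a. \<Prod>b\<in>Basis. complex_of_real (exp (- a * (v \<bullet> b)\<^sup>2)))"
    using gaussian_moment_integrable[OF a, of 0]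
    by (intro lborel_prod_coords(1) integrable_of_real) simp
  hence "integrable lborel (\<lambda>v::'a. norm (\<Prod>b\<in>Basis. complex_of_real (exp (- a * (v \<bullet> b)\<^sup>2))))"
    by (rule integrable_norm)
  moreover have "norm (\<Prod>b\<in>Basis. complex_of_real (exp (- a * (v \<bullet> b)\<^sup>2))) = exp (- a * (norm v)\<^sup>2)" for v :: 'a
  proof -
    have "- a * (norm v)\<^sup>2 = (\<Sum>b\<in>Basis. - a * (v \<bullet> b)\<^sup>2)"
      unfolding power2_norm_eq_inner euclidean_inner[of v v] sum_distrib_left by (simp add: power2_eq_square)
    thus ?thesis by (simp add: prod_norm[symmetric] exp_sum)
  qed
  ultimately show ?thesis by simp
qed

lemma norm_add_sq_le: "(norm (x + y))\<^sup>2 \<le> 2 * (norm x)\<^sup>2 + 2 * (norm y)\<^sup>2" for x y :: "'a::real_inner"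
proof -
  have "(norm (x + y))\<^sup>2 + (norm (x - y))\<^sup>2 = 2 * (norm x)\<^sup>2 + 2 * (norm y)\<^sup>2"
    by (simp add: power2_norm_eq_inner inner_simps inner_commute)
  thus ?thesis by (smt (verit) zero_le_power2)
qed

text \<open>
  Continuity and Gaussian decay, a class of functions for which all sums over a lattice below
  converge absolutely.
\<close>

definition gauss_decay :: "('a::euclidean_space \<Rightarrow> complex) \<Rightarrow> bool" where
  "gauss_decay h \<longleftrightarrow> continuous_on UNIV h \<and> (\<exists>C a. a > 0 \<and> (\<forall>v. norm (h v) \<le> C * exp (- a * (norm v)\<^sup>2)))"

lemma gauss_decay_integrable:
  assumes "gauss_decay h"
  shows "integrable lborel h"
proof -
  obtain C a where a: "a > 0" "\<And>v. norm (h v) \<le> C * exp (- a * (norm v)\<^sup>2)" and c: "continuous_on UNIV h"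
    using assms by (auto simp: gauss_decay_def)
  show ?thesis
  proof (rule Bochner_Integration.integrable_bound)
    show "integrable lborel (\<lambda>v. C * exp (- a * (norm v)\<^sup>2))"
      using gaussian_integrable[OF a(1)] by (rule integrable_mult_right)
    show "h \<in> borel_measurable lborel" using c by (simp add: borel_measurable_continuous_onI)
    show "AE v in lborel. norm (h v) \<le> norm (C * exp (- a * (norm v)\<^sup>2))"
      using order_trans[OF a(2) abs_ge_self] by (intro AE_I2) simp
  qed
qed

context lattice_tiling begin

lemma P_radius: obtains R where "R > 0" "\<And>w. w \<in> P \<Longrightarrow> norm w \<le> R"
  using bounded_P bounded_pos by blast

text \<open>
  Compare \<open>exp(-a|x|\<^sup>2)\<close> with the integral of
  \<open>exp(-a|v|\<^sup>2/2)\<close> over the tile at \<open>x\<close>; these integrals add up to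
  the integral over the space.
\<close>

lemma gaussian_summable:
  assumes a: "a > 0"
  shows "(\<lambda>x. exp (- a * (norm x)\<^sup>2)) summable_on L"
proof -
  obtain R where R: "R > 0" "\<And>w. w \<in> P \<Longrightarrow> norm w \<le> R" using P_radius by blast
  let ?g = "\<lambda>v::'a. exp (- (a / 2) * (norm v)\<^sup>2)"
  have g: "integrable lborel ?g" using a by (intro gaussian_integrable) auto
  let ?I = "\<lambda>x. \<integral>w. indicator P w *\<^sub>R ?g (x + w) \<partial>lborel"
  have "(?I has_sum (\<integral>v. ?g v \<partial>lborel)) L" by (rule unfold[OF g])
  hence s: "?I summable_on L" by (rule has_sum_imp_summable)
  have "(\<lambda>x. (exp (a * R\<^sup>2) / measure lborel P) * ?I x) summable_on L"
    using s by (rule summable_on_cmult_right)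
  thus ?thesis
  proof (rule summable_on_comparison_test)
    fix x assume "x \<in> L"
    have "measure lborel P * exp (- a * (norm x)\<^sup>2) = (\<integral>w. indicator P w *\<^sub>R exp (- a * (norm x)\<^sup>2) \<partial>lborel)"
      by simp
    also have "\<dots> \<le> (\<integral>w. exp (a * R\<^sup>2) * (indicator P w *\<^sub>R ?g (x + w)) \<partial>lborel)"
    proof (rule integral_mono)
      show "integrable lborel (\<lambda>w. indicator P w *\<^sub>R exp (- a * (norm x)\<^sup>2))"
        using emeasure_P_finite by (intro integrable_scaleR_left integrable_real_indicator) auto
      show "integrable lborel (\<lambda>w. exp (a * R\<^sup>2) * (indicator P w *\<^sub>R ?g (x + w)))"
      proof (rule Bochner_Integration.integrable_bound)
        show "integrable lborel (\<lambda>w. exp (a * R\<^sup>2) * indicator P w :: real)"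
          using emeasure_P_finite by (intro integrable_mult_right integrable_real_indicator) auto
      qed (use a in \<open>auto simp: indicator_def\<close>)
      fix w :: 'a
      have "exp (- a * (norm x)\<^sup>2) \<le> exp (a * R\<^sup>2) * ?g (x + w)" if w: "w \<in> P"
      proof -
        have "(norm w)\<^sup>2 \<le> R\<^sup>2" using R(2)[OF w] by (simp add: power_mono)
        hence "(norm (x + w))\<^sup>2 \<le> 2 * (norm x)\<^sup>2 + 2 * R\<^sup>2"
          using norm_add_sq_le[of x w] by linarith
        hence "a * (norm (x + w))\<^sup>2 \<le> a * (2 * (norm x)\<^sup>2 + 2 * R\<^sup>2)" using a by simp
        thus ?thesis by (simp add: exp_add[symmetric] algebra_simps)
      qed
      thus "indicator P w *\<^sub>R exp (- a * (norm x)\<^sup>2) \<le> exp (a * R\<^sup>2) * (indicator P w *\<^sub>R ?g (x + w))"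
        by (auto simp: indicator_def)
    qed
    also have "\<dots> = exp (a * R\<^sup>2) * ?I x" by simp
    finally show "exp (- a * (norm x)\<^sup>2) \<le> (exp (a * R\<^sup>2) / measure lborel P) * ?I x"
      using measure_P_pos by (simp add: field_simps)
  qed auto
qed

lemma integrable_on_tile:
  fixes g :: "'a \<Rightarrow> complex"
  assumes "continuous_on UNIV g"
  shows "integrable lborel (\<lambda>w. indicator P w *\<^sub>R g w)"
proof -
  obtain R where R: "R > 0" "\<And>w. w \<in> P \<Longrightarrow> norm w \<le> R" using P_radius by blast
  have "compact (g ` cball 0 R)"
    using assms by (intro compact_continuous_image) (auto intro: continuous_on_subset)
  then obtain B where B: "\<And>w. w \<in> cball 0 R \<Longrightarrow> norm (g w) \<le> B"
    using compact_imp_bounded bounded_iff by (metis image_eqI)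
  have [measurable]: "g \<in> borel_measurable borel" using assms by (rule borel_measurable_continuous_onI)
  show ?thesis
  proof (rule Bochner_Integration.integrable_bound)
    show "integrable lborel (\<lambda>w. B * indicator P w :: real)"
      using emeasure_P_finite by (intro integrable_mult_right integrable_real_indicator) auto
    show "AE w in lborel. norm (indicator P w *\<^sub>R g w) \<le> norm (B * indicator P w :: real)"
      using order_trans[OF B abs_ge_self] R by (intro AE_I2) (auto simp: indicator_def)
  qed measurable
qed

lemma norm_tile_integral_le:
  fixes g :: "'a \<Rightarrow> complex"
  assumes "continuous_on UNIV g" "\<And>w. w \<in> P \<Longrightarrow> norm (g w) \<le> B"
  shows "norm (\<integral>w. indicator P w *\<^sub>R g w \<partial>lborel) \<le> B * measure lborel P"
proof -
  have "norm (\<integral>w. indicator P w *\<^sub>R g w \<partial>lborel) \<le> (\<integral>w. norm (indicator P w *\<^sub>R g w) \<partial>lborel)"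
    by (rule integral_norm_bound)
  also have "\<dots> \<le> (\<integral>w. B * indicator P w \<partial>lborel)"
    using emeasure_P_finite assms
    by (intro integral_mono integrable_norm integrable_on_tile integrable_mult_right integrable_real_indicator)
      (auto simp: indicator_def)
  also have "\<dots> = B * measure lborel P" by simp
  finally show ?thesis .
qed

text \<open>
  A uniformly convergent sum may be integrated termwise over the bounded tile.
\<close>

lemma tile_integral_infsum:
  fixes f :: "'i \<Rightarrow> 'a \<Rightarrow> complex"
  assumes f: "\<And>i. i \<in> I \<Longrightarrow> continuous_on UNIV (f i)" and F: "continuous_on UNIV F"
    and bound: "\<And>i w. i \<in> I \<Longrightarrow> w \<in> P \<Longrightarrow> norm (f i w) \<le> M i" and M: "M summable_on I"
    and sum: "\<And>w. w \<in> P \<Longrightarrow> ((\<lambda>i. f i w) has_sum F w) I"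
  shows "((\<lambda>i. \<integral>w. indicator P w *\<^sub>R f i w \<partial>lborel) has_sum (\<integral>w. indicator P w *\<^sub>R F w \<partial>lborel)) I"
  unfolding has_sum_def
proof (rule tendstoI)
  fix e :: real assume e: "e > 0"
  define d where "d = e / (2 * measure lborel P)"
  have d: "d > 0" "d * measure lborel P < e" using e measure_P_pos by (auto simp: d_def)
  have "uniform_limit P (\<lambda>X w. \<Sum>i\<in>X. f i w) F (finite_subsets_at_top I)"
    by (rule Weierstrass_m_test_general'[OF bound sum M])
  hence "\<forall>\<^sub>F X in finite_subsets_at_top I. \<forall>w\<in>P. dist (\<Sum>i\<in>X. f i w) (F w) < d"
    using d(1) by (rule uniform_limitD)
  moreover have "\<forall>\<^sub>F X in finite_subsets_at_top I. finite X \<and> X \<subseteq> I"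
    by (rule eventually_finite_subsets_at_top_weakI) auto
  ultimately show "\<forall>\<^sub>F X in finite_subsets_at_top I.
      dist (\<Sum>i\<in>X. \<integral>w. indicator P w *\<^sub>R f i w \<partial>lborel) (\<integral>w. indicator P w *\<^sub>R F w \<partial>lborel) < e"
  proof eventually_elim
    case (elim X)
    have fX: "i \<in> X \<Longrightarrow> continuous_on UNIV (f i)" for i using elim f by blast
    have c: "continuous_on UNIV (\<lambda>w. \<Sum>i\<in>X. f i w)" using fX by (intro continuous_intros)
    have "(\<Sum>i\<in>X. \<integral>w. indicator P w *\<^sub>R f i w \<partial>lborel) - (\<integral>w. indicator P w *\<^sub>R F w \<partial>lborel)
        = (\<integral>w. indicator P w *\<^sub>R (\<Sum>i\<in>X. f i w) \<partial>lborel) - (\<integral>w. indicator P w *\<^sub>R F w \<partial>lborel)"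
      using Bochner_Integration.integral_sum[of X lborel "\<lambda>i w. indicator P w *\<^sub>R f i w"] integrable_on_tile[OF fX]
      by (simp add: scaleR_sum_right)
    also have "\<dots> = (\<integral>w. indicator P w *\<^sub>R ((\<Sum>i\<in>X. f i w) - F w) \<partial>lborel)"
      using Bochner_Integration.integral_diff[OF integrable_on_tile[OF c] integrable_on_tile[OF F]]
      by (simp only: scaleR_diff_right)
    finally show ?case
      using norm_tile_integral_le[of "\<lambda>w. (\<Sum>i\<in>X. f i w) - F w" d] c F elim d(2)
      by (force simp: dist_norm intro: continuous_intros)
  qed
qed

end

section \<open>Fourier uniqueness and Poisson summation\<close>

lemma lborel_integral_translate:
  fixes g :: "'a::euclidean_space \<Rightarrow> 'b::euclidean_space"
  assumes [measurable]: "g \<in> borel_measurable borel"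
  shows "(\<integral>w. g (c + w) \<partial>lborel) = (\<integral>v. g v \<partial>lborel)"
proof -
  have "(\<integral>v. g v \<partial>lborel) = (\<integral>v. g v \<partial>distr lborel borel ((+) c))"
    by (simp only: lborel_distr_plus)
  also have "\<dots> = (\<integral>w. g (c + w) \<partial>lborel)"
    by (subst integral_distr) auto
  finally show ?thesis by simp
qed

lemma lborel_integrable_translate:
  fixes g :: "'a::euclidean_space \<Rightarrow> 'b::euclidean_space"
  assumes "integrable lborel g"
  shows "integrable lborel (\<lambda>w. g (c + w))"
  using assms by (intro integrable_distr[of "(+) c" lborel borel]) (auto simp: lborel_distr_plus)

text \<open>
  The Weierstrass test, locally on balls.
\<close>

lemma continuous_on_infsum:
  fixes f :: "'i \<Rightarrow> 'a::euclidean_space \<Rightarrow> complex"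
  assumes f: "\<And>i. i \<in> I \<Longrightarrow> continuous_on UNIV (f i)"
    and M: "\<And>R. \<exists>M. M summable_on I \<and> (\<forall>i\<in>I. \<forall>v. norm v \<le> R \<longrightarrow> norm (f i v) \<le> M i)"
  shows "continuous_on UNIV (\<lambda>v. \<Sum>\<^sub>\<infinity>i\<in>I. f i v)"
proof -
  have "isCont (\<lambda>v. \<Sum>\<^sub>\<infinity>i\<in>I. f i v) v" for v
  proof -
    define R where "R = norm v + 1"
    obtain M where M: "M summable_on I" "\<And>i v. i \<in> I \<Longrightarrow> norm v \<le> R \<Longrightarrow> norm (f i v) \<le> M i"
      using M[of R] by blast
    have ul: "uniform_limit (cball 0 R) (\<lambda>X v. \<Sum>i\<in>X. f i v) (\<lambda>v. \<Sum>\<^sub>\<infinity>i\<in>I. f i v) (finite_subsets_at_top I)"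
      by (rule Weierstrass_m_test_general[OF _ M(1)]) (use M(2) in auto)
    have "continuous_on (cball 0 R) (\<lambda>v. \<Sum>\<^sub>\<infinity>i\<in>I. f i v)"
    proof (rule uniform_limit_theorem[OF _ ul])
      show "\<forall>\<^sub>F X in finite_subsets_at_top I. continuous_on (cball 0 R) (\<lambda>v. \<Sum>i\<in>X. f i v)"
        by (rule eventually_finite_subsets_at_top_weakI)
          (auto intro!: continuous_intros intro: continuous_on_subset[OF f])
    qed simp
    thus ?thesis
      by (rule continuous_on_interior) (simp add: R_def)
  qed
  thus ?thesis by (simp add: continuous_on_eq_continuous_at)
qed

text \<open>
  The character \<open>v \<mapsto> exp(2\<pi>i y\<bullet>v)\<close>.
\<close>

definition wave :: "'a::euclidean_space \<Rightarrow> 'a \<Rightarrow> complex" where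
  "wave y v = cis (2 * pi * (y \<bullet> v))"

lemma wave_add_left: "wave (y + z) v = wave y v * wave z v"
  by (simp add: wave_def cis_mult inner_add_left algebra_simps)

lemma wave_add_right: "wave y (v + w) = wave y v * wave y w"
  by (simp add: wave_def cis_mult inner_add_right algebra_simps)

lemma norm_wave [simp]: "norm (wave y v) = 1"
  by (simp add: wave_def)

lemma wave_0 [simp]: "wave 0 v = 1" "wave y 0 = 1"
  by (simp_all add: wave_def)

lemma continuous_wave [continuous_intros]:
  "continuous_on A f \<Longrightarrow> continuous_on A (\<lambda>x. wave y (f x))"
  unfolding wave_def cis_conv_exp by (intro continuous_intros)

lemma wave_measurable [measurable]: "wave y \<in> borel_measurable borel"
  by (intro borel_measurable_continuous_onI continuous_intros)

lemma wave_integer: "y \<bullet> v \<in> \<int> \<Longrightarrow> wave y v = 1"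
  using cis_multiple_2pi[of "y \<bullet> v"] by (simp add: wave_def mult_ac)

context lattice_tiling begin

definition dual :: "'a set" where
  "dual = {y. \<forall>x\<in>L. y \<bullet> x \<in> \<int>}"

lemma dual_0: "0 \<in> dual" and dual_add: "y \<in> dual \<Longrightarrow> z \<in> dual \<Longrightarrow> y + z \<in> dual"
  and dual_minus: "y \<in> dual \<Longrightarrow> - y \<in> dual"
  by (auto simp: dual_def inner_add_left)

lemma wave_periodic: "y \<in> dual \<Longrightarrow> x \<in> L \<Longrightarrow> wave y (x + v) = wave y v"
  by (simp add: wave_add_right wave_integer dual_def)

text \<open>
  Translation by a point \<open>a\<close> with \<open>y\<bullet>a = 1/2\<close> changes the sign
  of the wave. The integral over the tile does not change under translation: unfolding both
  integrals along the tiling expresses them by the same summands, numbered by \<open>x\<close> and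
  by \<open>-x\<close>.
\<close>

lemma tile_integral_wave:
  assumes y: "y \<in> dual" "y \<noteq> 0"
  shows "(\<integral>w. indicator P w *\<^sub>R wave y w \<partial>lborel) = 0"
proof -
  define a where "a = (1 / (2 * (y \<bullet> y))) *\<^sub>R y"
  have a: "wave y a = -1" using y by (simp add: wave_def a_def)
  define g where "g w = indicator P w *\<^sub>R wave y w" for w
  have g_int: "integrable lborel g"
    unfolding g_def by (intro integrable_on_tile continuous_intros)
  have [measurable]: "g \<in> borel_measurable borel"
    unfolding g_def by measurable
  define h where "h v = - g (- a + v)" for v
  define k where "k v = g (a + v)" for v
  define A where "A x = (\<integral>w. indicator P w *\<^sub>R h (x + w) \<partial>lborel)" for x
  define B where "B x = (\<integral>w. indicator P w *\<^sub>R k (x + w) \<partial>lborel)" for x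
  have "integrable lborel h"
    unfolding h_def by (intro Bochner_Integration.integrable_minus lborel_integrable_translate g_int)
  hence "(A has_sum (\<integral>v. h v \<partial>lborel)) L" unfolding A_def by (rule unfold)
  also have "(\<integral>v. h v \<partial>lborel) = - (\<integral>v. g v \<partial>lborel)"
    unfolding h_def using lborel_integral_translate[of g "- a"]
    by (subst Bochner_Integration.integral_minus) simp
  finally have A: "(A has_sum - (\<integral>v. g v \<partial>lborel)) L" .
  have "integrable lborel k"
    unfolding k_def by (intro lborel_integrable_translate g_int)
  hence "(B has_sum (\<integral>v. k v \<partial>lborel)) L" unfolding B_def by (rule unfold)
  hence B: "(B has_sum (\<integral>v. g v \<partial>lborel)) L"
    by (simp add: k_def lborel_integral_translate)
  have AB: "A x = B (- x)" if x: "x \<in> L" for x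
  proof -
    let ?f = "\<lambda>w. indicator P w *\<^sub>R k (- x + w)"
    have [measurable]: "k \<in> borel_measurable borel" unfolding k_def by measurable
    have "B (- x) = (\<integral>w. ?f ((x - a) + w) \<partial>lborel)"
      unfolding B_def by (rule lborel_integral_translate[symmetric]) measurable
    also have "(\<lambda>w. ?f ((x - a) + w)) = (\<lambda>w. indicator P w *\<^sub>R h (x + w))"
    proof
      fix w
      have "wave y (- a + (x + w)) = - wave y w"
      proof -
        have "wave y (- a) = -1" using a by (simp add: wave_def cis_cnj[symmetric])
        thus ?thesis using wave_periodic[OF y(1) x, of w] wave_add_right[of y "- a" "x + w"] by simp
      qed
      thus "?f ((x - a) + w) = indicator P w *\<^sub>R h (x + w)"
        by (auto simp: k_def h_def g_def indicator_def algebra_simps)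
    qed
    finally show ?thesis by (simp add: A_def)
  qed
  have "bij_betw uminus L L"
    by (rule bij_betwI[of _ _ _ uminus]) (auto simp: minus_L)
  hence "((\<lambda>x. B (- x)) has_sum (\<integral>v. g v \<partial>lborel)) L"
    using has_sum_reindex_bij_betw B by blast
  hence "(A has_sum (\<integral>v. g v \<partial>lborel)) L"
    using AB by (simp cong: has_sum_cong)
  with A have "- (\<integral>v. g v \<partial>lborel) = (\<integral>v. g v \<partial>lborel)" by (rule has_sum_unique)
  thus ?thesis by (simp add: g_def)
qed

text \<open>
  Suppose \<open>F(v\<^sub>0) \<noteq> 0\<close>. The kernel \<open>K(w) = \<Prod>\<^sub>y (1 +
  cos 2\<pi>y\<bullet>(w-v\<^sub>0))/2\<close> is a trigonometric polynomial with values in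
  \<open>[0,1]\<close> that equals 1 only on \<open>v\<^sub>0 + L\<close>. So \<open>F
  K\<^sup>N\<close> has integral 0 for every \<open>N\<close>, while for large \<open>N\<close>
  the integral is dominated by the points near \<open>v\<^sub>0\<close>, where the real part of
  \<open>F/F(v\<^sub>0)\<close> exceeds 1/2.
\<close>

lemma fourier_unique:
  fixes F :: "'a \<Rightarrow> complex"
  assumes F: "continuous_on UNIV F" and per: "\<And>x v. x \<in> L \<Longrightarrow> F (x + v) = F v"
    and zero: "\<And>y. y \<in> dual \<Longrightarrow> (\<integral>w. indicator P w *\<^sub>R (F w * wave y w) \<partial>lborel) = 0"
    and Y: "finite Y" "Y \<subseteq> dual" "\<And>v. (\<And>y. y \<in> Y \<Longrightarrow> y \<bullet> v \<in> \<int>) \<Longrightarrow> v \<in> L"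
  shows "F v0 = 0"
proof (rule ccontr)
  assume nz: "F v0 \<noteq> 0"
  define k where "k y w = (1 + cos (2 * pi * (y \<bullet> (w - v0)))) / 2" for y w
  define K where "K w = (\<Prod>y\<in>Y. k y w)" for w
  have cos01: "0 \<le> (1 + cos x) / 2" "(1 + cos x) / 2 \<le> 1" for x :: real
  proof -
    have "0 \<le> 1 + cos x" using cos_ge_minus_one[of x] by linarith
    thus "0 \<le> (1 + cos x) / 2" by simp
    show "(1 + cos x) / 2 \<le> 1" by simp
  qed
  have k01: "0 \<le> k y w" "k y w \<le> 1" for y w
    unfolding k_def by (rule cos01)+
  have K01: "0 \<le> K w" "K w \<le> 1" for w
    using k01 by (auto simp: K_def intro: prod_nonneg prod_le_1)
  have k_cont: "continuous_on UNIV (k y)" for y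
    unfolding k_def by (intro continuous_intros) auto
  have K_cont: "continuous_on UNIV K"
    unfolding K_def by (intro continuous_intros continuous_on_prod k_cont)
  \<comment> \<open>\<open>ann q\<close>: the product \<open>F q\<close> is orthogonal to all waves. Multiplication by a factor \<open>k z\<close> preserves this,
    because that factor is a combination of three waves.\<close>
  define ann where "ann q \<longleftrightarrow> continuous_on UNIV q \<and>
    (\<forall>y\<in>dual. (\<integral>w. indicator P w *\<^sub>R (F w * q w * wave y w) \<partial>lborel) = 0)" for q :: "'a \<Rightarrow> complex"
  have ann_k: "ann (\<lambda>w. q w * of_real (k z w))" if q: "ann q" and z: "z \<in> dual" for q z
    unfolding ann_def
  proof (intro conjI ballI)
    have qc: "continuous_on UNIV q" using q by (simp add: ann_def)
    show "continuous_on UNIV (\<lambda>w. q w * of_real (k z w))"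
      by (intro continuous_intros qc k_cont)
    fix y assume y: "y \<in> dual"
    define al where "al = wave z (- v0) / 4"
    define be where "be = wave (- z) (- v0) / 4"
    have k_eq: "of_real (k z w) = 1 / 2 + al * wave z w + be * wave (- z) w" for w
    proof -
      have "al * wave z w + be * wave (- z) w = (wave z (w - v0) + wave (- z) (w - v0)) / 4"
        using wave_add_right[of z w "- v0"] wave_add_right[of "- z" w "- v0"]
        by (simp add: al_def be_def)
      also have "\<dots> = of_real (cos (2 * pi * (z \<bullet> (w - v0))) / 2)"
        by (simp add: wave_def complex_eq_iff)
      finally show ?thesis by (simp add: k_def add_divide_distrib)
    qed
    let ?J = "\<lambda>y w. indicator P w *\<^sub>R (F w * q w * wave y w)"
    have J: "integrable lborel (?J y)" for y
      by (intro integrable_on_tile continuous_intros F qc)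
    have J0: "y \<in> dual \<Longrightarrow> (\<integral>w. ?J y w \<partial>lborel) = 0" for y
      using q by (simp add: ann_def)
    have "(\<lambda>w. indicator P w *\<^sub>R (F w * (q w * of_real (k z w)) * wave y w))
        = (\<lambda>w. (1 / 2) * ?J y w + al * ?J (y + z) w + be * ?J (y + - z) w)"
      unfolding k_eq wave_add_left by (auto simp: fun_eq_iff algebra_simps scaleR_conv_of_real)
    thus "(\<integral>w. indicator P w *\<^sub>R (F w * (q w * of_real (k z w)) * wave y w) \<partial>lborel) = 0"
      by (simp only: Bochner_Integration.integral_add Bochner_Integration.integrable_add J
          integrable_mult_right integral_mult_right_zero J0 y z dual_add dual_minus mult_zero_right add_0)
  qed
  have ann_prod: "ann (\<lambda>w. q w * of_real (\<Prod>y\<in>Z. k y w))" if "ann q" "finite Z" "Z \<subseteq> dual" for q Z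
    using that(2,3,1)
  proof (induction Z arbitrary: q rule: finite_induct)
    case (insert z Z)
    have "ann (\<lambda>w. q w * of_real (k z w) * of_real (\<Prod>y\<in>Z. k y w))"
      using insert by (intro insert.IH ann_k) auto
    thus ?case using insert by (simp add: mult.assoc)
  qed simp
  have ann_K: "ann (\<lambda>w. of_real (K w ^ N))" for N
  proof (induction N)
    case 0
    thus ?case using zero by (simp add: ann_def)
  next
    case (Suc N)
    from ann_prod[OF this Y(1,2)] show ?case by (simp add: K_def mult.commute)
  qed
  define G where "G w = Re (F w / F v0)" for w
  have G_cont: "continuous_on UNIV G"
    unfolding G_def using nz by (intro continuous_intros F) auto
  have G_per: "x \<in> L \<Longrightarrow> G (x + v) = G v" for x v by (simp add: G_def per)
  have intP: "integrable lborel (\<lambda>w. indicator P w * g w :: real)" if "continuous_on UNIV g" for g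
  proof -
    have "integrable lborel (\<lambda>w. indicator P w *\<^sub>R complex_of_real (g w))"
      using that by (intro integrable_on_tile continuous_intros)
    hence "integrable lborel (\<lambda>w. complex_of_real (indicator P w * g w))"
      by (simp add: scaleR_conv_of_real)
    thus ?thesis by (simp only: complex_of_real_integrable_eq)
  qed
  have Re_scale: "Re (of_real r * z) = r * Re z" for r z by simp
  have G_zero: "(\<integral>w. indicator P w * (G w * K w ^ N) \<partial>lborel) = 0" for N
  proof -
    have c: "continuous_on UNIV (\<lambda>w. F w * of_real (K w ^ N))" by (intro continuous_intros F K_cont)
    have "(\<integral>w. indicator P w *\<^sub>R (F w * of_real (K w ^ N)) \<partial>lborel) = 0"
      using ann_K[of N] dual_0 by (auto simp: ann_def)
    hence "(\<integral>w. (1 / F v0) * (indicator P w *\<^sub>R (F w * of_real (K w ^ N))) \<partial>lborel) = 0"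
      by (simp only: integral_mult_right_zero mult_zero_right)
    hence "Re (\<integral>w. (1 / F v0) * (indicator P w *\<^sub>R (F w * of_real (K w ^ N))) \<partial>lborel) = 0" by simp
    also have "Re (\<integral>w. (1 / F v0) * (indicator P w *\<^sub>R (F w * of_real (K w ^ N))) \<partial>lborel)
       = (\<integral>w. Re ((1 / F v0) * (indicator P w *\<^sub>R (F w * of_real (K w ^ N)))) \<partial>lborel)"
      by (intro integral_Re[symmetric] integrable_mult_right integrable_on_tile c)
    also have "(\<lambda>w. Re ((1 / F v0) * (indicator P w *\<^sub>R (F w * of_real (K w ^ N)))))
       = (\<lambda>w. indicator P w * (G w * K w ^ N))"
    proof
      fix w
      have "(1 / F v0) * (indicator P w *\<^sub>R (F w * of_real (K w ^ N)))
          = of_real (indicator P w * K w ^ N) * (F w / F v0)"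
        by (simp add: scaleR_conv_of_real)
      thus "Re ((1 / F v0) * (indicator P w *\<^sub>R (F w * of_real (K w ^ N)))) = indicator P w * (G w * K w ^ N)"
        by (simp only: G_def Re_scale mult.assoc mult.commute[of "K w ^ N"])
    qed
    finally show ?thesis .
  qed
  have "G v0 = 1" using nz by (simp add: G_def)
  obtain \<delta> where \<delta>: "\<delta> > 0" "\<And>w. dist w v0 < \<delta> \<Longrightarrow> G w > 1 / 2"
  proof -
    have "isCont G v0" using G_cont by (simp add: continuous_on_eq_continuous_at)
    then obtain d where d: "d > 0" "\<And>w. dist w v0 < d \<Longrightarrow> dist (G w) (G v0) < 1 / 2"
      unfolding continuous_at_eps_delta by (metis half_gt_zero zero_less_one)
    show ?thesis
    proof (rule that[OF \<open>d > 0\<close>])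
      fix w assume "dist w v0 < d"
      hence "\<bar>G w - 1\<bar> < 1 / 2" using d(2)[of w] \<open>G v0 = 1\<close> by (simp add: dist_real_def)
      thus "1 / 2 < G w" by arith
    qed
  qed
  define U where "U = (\<Union>x\<in>L. ball (x + v0) \<delta>)"
  have U: "G w > 1 / 2" if "w \<in> U" for w
  proof -
    from that obtain x where x: "x \<in> L" "dist (x + v0) w < \<delta>" by (auto simp: U_def)
    hence "G (- x + w) > 1 / 2"
      by (intro \<delta>) (simp add: dist_norm norm_minus_commute algebra_simps)
    thus ?thesis using G_per[OF minus_L[OF x(1)]] by simp
  qed
  have K1: "w \<in> U" if "K w = 1" for w
  proof -
    have "k y w = 1" if "y \<in> Y" for y
    proof (rule ccontr)
      assume "k y w \<noteq> 1"
      hence "k y w < 1" using k01[of y w] by simp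
      moreover have "K w \<le> k y w * 1"
        unfolding K_def prod.remove[OF Y(1) \<open>y \<in> Y\<close>] using k01
        by (intro mult_left_mono prod_le_1) auto
      ultimately show False using \<open>K w = 1\<close> by simp
    qed
    hence "y \<bullet> (w - v0) \<in> \<int>" if "y \<in> Y" for y
      using that cos_one_2pi_int[of "2 * pi * (y \<bullet> (w - v0))"] by (force simp: k_def)
    hence "w - v0 \<in> L" by (rule Y(3))
    thus ?thesis unfolding U_def using \<delta>(1) by (intro UN_I[of "w - v0"]) auto
  qed
  define C where "C = closure P - U"
  have "open U" unfolding U_def by auto
  hence "compact C"
    unfolding C_def using bounded_P by (intro compact_diff) (auto simp: compact_closure)
  have "\<exists>\<kappa>. 0 \<le> \<kappa> \<and> \<kappa> < 1 \<and> (\<forall>w\<in>C. K w \<le> \<kappa>)"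
  proof (cases "C = {}")
    case False
    then obtain w where w: "w \<in> C" "\<And>v. v \<in> C \<Longrightarrow> K v \<le> K w"
      using continuous_attains_sup[OF \<open>compact C\<close> False] K_cont continuous_on_subset by (metis subset_UNIV)
    have "K w \<noteq> 1" using K1[of w] w(1) by (auto simp: C_def)
    thus ?thesis using K01[of w] w by (intro exI[of _ "K w"]) auto
  qed (auto intro: exI[of _ 0])
  then obtain \<kappa> where \<kappa>: "0 \<le> \<kappa>" "\<kappa> < 1" "\<And>w. w \<in> C \<Longrightarrow> K w \<le> \<kappa>" by blast
  define \<kappa>' where "\<kappa>' = (1 + \<kappa>) / 2"
  have \<kappa>': "\<kappa> < \<kappa>'" "\<kappa>' < 1" "0 < \<kappa>'" using \<kappa> by (auto simp: \<kappa>'_def)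
  define Q where "Q = {w. K w > \<kappa>'}"
  have "open Q" unfolding Q_def using K_cont by (intro open_Collect_less) auto
  hence [measurable]: "Q \<in> sets borel" by simp
  have "v0 \<in> Q" using \<kappa>' by (simp add: Q_def K_def k_def)
  have K_per: "x \<in> L \<Longrightarrow> K (x + w) = K w" for x w
  proof -
    assume x: "x \<in> L"
    have "k y (x + w) = k y w" if "y \<in> Y" for y
    proof -
      have "k y w = (1 + Re (wave y (w - v0))) / 2" for w
        by (simp add: k_def wave_def)
      moreover have "wave y (x + w - v0) = wave y (w - v0)"
        using wave_periodic[of y x "w - v0"] that Y(2) x by (auto simp: add_diff_eq)
      ultimately show ?thesis by (simp only:)
    qed
    thus ?thesis unfolding K_def by (intro prod.cong refl)
  qed
  have pos: "measure lborel (P \<inter> Q) > 0"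
  proof (rule ccontr)
    assume "\<not> measure lborel (P \<inter> Q) > 0"
    hence "measure lborel (P \<inter> Q) = 0" using measure_nonneg[of lborel "P \<inter> Q"] by linarith
    moreover have "emeasure lborel (P \<inter> Q) < \<infinity>"
      using bounded_P by (intro emeasure_bounded_finite) auto
    ultimately have "emeasure lborel (P \<inter> Q) = 0"
      by (simp add: emeasure_eq_ennreal_measure top.not_eq_extremum)
    hence null: "AE w in lborel. w \<notin> P \<inter> Q" by (intro AE_not_in) auto
    obtain r where r: "r > 0" "ball v0 r \<subseteq> Q"
      using \<open>open Q\<close> \<open>v0 \<in> Q\<close> open_contains_ball by blast
    define h :: "'a \<Rightarrow> real" where "h = indicator (ball v0 r)"
    have "integrable lborel h"
      unfolding h_def using emeasure_bounded_finite[of "ball v0 r"]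
      by (intro integrable_real_indicator) auto
    hence "((\<lambda>x. \<integral>w. indicator P w *\<^sub>R h (x + w) \<partial>lborel) has_sum (\<integral>v. h v \<partial>lborel)) L" by (rule unfold)
    moreover have "(\<integral>w. indicator P w *\<^sub>R h (x + w) \<partial>lborel) = 0" if "x \<in> L" for x
    proof (rule integral_eq_zero_AE, use null in eventually_elim)
      fix w assume "w \<notin> P \<inter> Q"
      moreover have "w \<in> Q" if "x + w \<in> ball v0 r"
        using r(2) that K_per[OF \<open>x \<in> L\<close>, of w] by (auto simp: Q_def)
      ultimately show "indicator P w *\<^sub>R h (x + w) = 0" by (auto simp: h_def indicator_def)
    qed
    ultimately have "((\<lambda>x. 0) has_sum (\<integral>v. h v \<partial>lborel)) L"
      by (simp cong: has_sum_cong)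
    hence "(\<integral>v. h v \<partial>lborel) = 0"
      using has_sum_unique[OF _ has_sum_0[of L "\<lambda>_. 0::real"]] by blast
    moreover have "(\<integral>v. h v \<partial>lborel) = measure lborel (ball v0 r)" by (simp add: h_def)
    moreover have "measure lborel (ball v0 r) > 0"
      using content_ball_pos[OF r(1), of v0] by (simp add: measure_completion)
    ultimately show False by simp
  qed
  have "compact (G ` closure P)"
    using G_cont bounded_P by (intro compact_continuous_image) (auto intro: continuous_on_subset simp: compact_closure)
  then obtain B where B: "B > 0" "\<And>w. w \<in> closure P \<Longrightarrow> \<bar>G w\<bar> \<le> B"
    using compact_imp_bounded bounded_pos by (metis image_eqI real_norm_def)
  have lower: "1 / 2 * \<kappa>' ^ N * indicator Q w - B * \<kappa> ^ N \<le> G w * K w ^ N" if w: "w \<in> P" for w N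
  proof (cases "w \<in> U")
    case True
    have "1 / 2 * \<kappa>' ^ N * indicator Q w - B * \<kappa> ^ N \<le> 1 / 2 * \<kappa>' ^ N * indicator Q w" using B \<kappa> by simp
    also have "\<dots> \<le> 1 / 2 * K w ^ N"
      using \<kappa>' K01[of w] by (auto simp: indicator_def Q_def intro: power_mono)
    also have "\<dots> \<le> G w * K w ^ N"
      using U[OF True] K01[of w] by (intro mult_right_mono) auto
    finally show ?thesis .
  next
    case False
    hence wC: "w \<in> C" using w closure_subset by (auto simp: C_def)
    hence "w \<notin> Q" using \<kappa>(3) \<kappa>' by (force simp: Q_def)
    have "\<bar>G w * K w ^ N\<bar> \<le> B * \<kappa> ^ N"
      unfolding abs_mult power_abs
      using B(2)[of w] \<kappa>(3)[OF wC] K01[of w] w closure_subset B(1)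
      by (intro mult_mono power_mono) auto
    thus ?thesis using \<open>w \<notin> Q\<close> by simp
  qed
  have ineq: "measure lborel (P \<inter> Q) \<le> 2 * B * measure lborel P * (\<kappa> / \<kappa>') ^ N" for N
  proof -
    have i1: "integrable lborel (\<lambda>w. indicator (P \<inter> Q) w :: real)"
      using bounded_P by (intro integrable_real_indicator emeasure_bounded_finite) auto
    have i2: "integrable lborel (\<lambda>w. indicator P w :: real)"
      using emeasure_P_finite by (intro integrable_real_indicator) auto
    have "1 / 2 * \<kappa>' ^ N * measure lborel (P \<inter> Q) - B * \<kappa> ^ N * measure lborel P
       = (\<integral>w. 1 / 2 * \<kappa>' ^ N * indicator (P \<inter> Q) w - B * \<kappa> ^ N * indicator P w \<partial>lborel)"
      using i1 i2 by (subst Bochner_Integration.integral_diff) auto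
    also have "\<dots> \<le> (\<integral>w. indicator P w * (G w * K w ^ N) \<partial>lborel)"
    proof (rule integral_mono)
      show "integrable lborel (\<lambda>w. 1 / 2 * \<kappa>' ^ N * indicator (P \<inter> Q) w - B * \<kappa> ^ N * indicator P w)"
        using i1 i2 by (intro Bochner_Integration.integrable_diff integrable_mult_right)
      show "integrable lborel (\<lambda>w. indicator P w * (G w * K w ^ N))"
        by (intro intP continuous_intros G_cont K_cont)
      show "1 / 2 * \<kappa>' ^ N * indicator (P \<inter> Q) w - B * \<kappa> ^ N * indicator P w \<le> indicator P w * (G w * K w ^ N)" for w
        using lower[of w N] by (cases "w \<in> P") (auto simp: indicator_def)
    qed
    also have "\<dots> = 0" by (rule G_zero)
    finally show ?thesis using \<kappa>' by (simp add: field_simps)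
  qed
  have "(\<lambda>N. 2 * B * measure lborel P * (\<kappa> / \<kappa>') ^ N) \<longlonglongrightarrow> 2 * B * measure lborel P * 0"
    using \<kappa> \<kappa>' by (intro tendsto_intros LIMSEQ_realpow_zero) auto
  hence "measure lborel (P \<inter> Q) \<le> 2 * B * measure lborel P * 0"
    by (rule LIMSEQ_le_const) (use ineq in auto)
  thus False using pos by simp
qed

end

lemma gauss_decay_shift_bound:
  assumes "gauss_decay h"
  obtains C a where "a > 0" "\<And>r x v. norm v \<le> r \<Longrightarrow> norm (h (x + v)) \<le> C * exp (a * r\<^sup>2) * exp (- (a / 2) * (norm x)\<^sup>2)"
proof -
  obtain C a where a: "a > 0" "\<And>v. norm (h v) \<le> C * exp (- a * (norm v)\<^sup>2)"
    using assms by (auto simp: gauss_decay_def)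
  have "0 \<le> C * exp (- a * (norm (0::'a))\<^sup>2)" using a(2)[of 0] norm_ge_zero order_trans by blast
  hence C: "C \<ge> 0" by simp
  show ?thesis
  proof (rule that[OF a(1)])
    fix r x v assume v: "norm (v::'a) \<le> r"
    have "(norm v)\<^sup>2 \<le> r\<^sup>2" using v by (simp add: power_mono)
    hence "(norm x)\<^sup>2 \<le> 2 * (norm (x + v))\<^sup>2 + 2 * r\<^sup>2"
      using norm_add_sq_le[of "x + v" "- v"] by simp
    hence "a * (norm x)\<^sup>2 \<le> a * (2 * (norm (x + v))\<^sup>2 + 2 * r\<^sup>2)" using a(1) by simp
    hence "exp (- a * (norm (x + v))\<^sup>2) \<le> exp (a * r\<^sup>2) * exp (- (a / 2) * (norm x)\<^sup>2)"
      by (simp add: exp_add[symmetric] algebra_simps)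
    hence "C * exp (- a * (norm (x + v))\<^sup>2) \<le> C * (exp (a * r\<^sup>2) * exp (- (a / 2) * (norm x)\<^sup>2))"
      using C by (rule mult_left_mono)
    thus "norm (h (x + v)) \<le> C * exp (a * r\<^sup>2) * exp (- (a / 2) * (norm x)\<^sup>2)"
      using a(2)[of "x + v"] by (simp add: mult.assoc)
  qed
qed

lemma gauss_decay_mult_wave: "gauss_decay h \<Longrightarrow> gauss_decay (\<lambda>v. h v * wave y v)"
  by (auto simp: gauss_decay_def norm_mult intro!: continuous_intros)

context lattice_tiling begin

lemma gauss_decay_translates_bound:
  assumes "gauss_decay h"
  shows "\<exists>M. M summable_on L \<and> (\<forall>x\<in>L. \<forall>v. norm v \<le> r \<longrightarrow> norm (h (x + v)) \<le> M x)"
proof -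
  obtain C a where a: "a > 0"
    "\<And>r x v. norm v \<le> r \<Longrightarrow> norm (h (x + v)) \<le> C * exp (a * r\<^sup>2) * exp (- (a / 2) * (norm x)\<^sup>2)"
    using gauss_decay_shift_bound[OF assms] by metis
  have "(\<lambda>x. C * exp (a * r\<^sup>2) * exp (- (a / 2) * (norm x)\<^sup>2)) summable_on L"
    using a(1) by (intro summable_on_cmult_right gaussian_summable) auto
  thus ?thesis using a(2) by blast
qed

lemma gauss_decay_abs_summable:
  assumes "gauss_decay h"
  shows "(\<lambda>x. norm (h (x + v))) summable_on L"
proof -
  obtain M where M: "M summable_on L" "\<forall>x\<in>L. \<forall>v'. norm v' \<le> norm v \<longrightarrow> norm (h (x + v')) \<le> M x"
    using gauss_decay_translates_bound[OF assms] by blast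
  show ?thesis by (rule summable_on_comparison_test[OF M(1)]) (use M(2) in auto)
qed

text \<open>
  Both sides are continuous periodic functions of \<open>v\<close> with the same Fourier
  coefficients.
\<close>

theorem poisson_summation:
  fixes h :: "'a \<Rightarrow> complex"
  defines "c \<equiv> \<lambda>y. \<integral>v. h v * wave (- y) v \<partial>lborel"
  assumes h: "gauss_decay h"
    and Y: "finite Y" "Y \<subseteq> dual" "\<And>v. (\<And>y. y \<in> Y \<Longrightarrow> y \<bullet> v \<in> \<int>) \<Longrightarrow> v \<in> L"
    and c: "(\<lambda>y. norm (c y)) summable_on dual"
  shows "(\<Sum>\<^sub>\<infinity>x\<in>L. h (x + v)) = (\<Sum>\<^sub>\<infinity>y\<in>dual. c y * wave y v) / of_real (measure lborel P)"
proof -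
  define F1 where "F1 v = (\<Sum>\<^sub>\<infinity>x\<in>L. h (x + v))" for v
  define F2 where "F2 v = (\<Sum>\<^sub>\<infinity>y\<in>dual. c y * wave y v)" for v
  have h_cont: "continuous_on UNIV h" using h by (simp add: gauss_decay_def)
  have h_shift: "continuous_on UNIV (\<lambda>v. h (x + v))" for x
    by (rule continuous_on_compose2[OF h_cont]) (auto intro: continuous_intros)
  have F1_sum: "((\<lambda>x. h (x + v)) has_sum F1 v) L" for v
    unfolding F1_def by (rule has_sum_infsum[OF abs_summable_summable[OF gauss_decay_abs_summable[OF h]]])
  have c_sum: "(\<lambda>y. norm (c y * wave y v)) summable_on dual" for v
    using c by (simp add: norm_mult)
  have F2_sum: "((\<lambda>y. c y * wave y v) has_sum F2 v) dual" for v
    unfolding F2_def by (rule has_sum_infsum[OF abs_summable_summable[OF c_sum]])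
  have F1_cont: "continuous_on UNIV F1"
    unfolding F1_def
    by (rule continuous_on_infsum[OF h_shift]) (rule gauss_decay_translates_bound[OF h])
  have F2_cont: "continuous_on UNIV F2"
    unfolding F2_def
    by (rule continuous_on_infsum) (use c in \<open>auto simp: norm_mult intro!: continuous_intros\<close>)
  have F1_per: "F1 (z + v) = F1 v" if z: "z \<in> L" for z v
  proof -
    have "bij_betw ((+) z) L L"
      by (rule bij_betwI[of _ _ _ "\<lambda>x. x - z"]) (auto simp: add_L diff_L z)
    from has_sum_reindex_bij_betw[OF this, of "\<lambda>x. h (x + v)" "F1 v"] F1_sum[of v]
    have "((\<lambda>x. h (x + (z + v))) has_sum F1 v) L" by (simp add: add_ac)
    with F1_sum[of "z + v"] show ?thesis by (rule has_sum_unique)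
  qed
  have F2_per: "F2 (z + v) = F2 v" if z: "z \<in> L" for z v
    unfolding F2_def using z by (intro infsum_cong) (simp add: wave_periodic)
  have coef1: "(\<integral>w. indicator P w *\<^sub>R (F1 w * wave z w) \<partial>lborel) = c (- z)" if z: "z \<in> dual" for z
  proof -
    obtain R where R: "R > 0" "\<And>w. w \<in> P \<Longrightarrow> norm w \<le> R" using P_radius by blast
    obtain M where M: "M summable_on L" "\<And>x v. x \<in> L \<Longrightarrow> norm v \<le> R \<Longrightarrow> norm (h (x + v)) \<le> M x"
      using gauss_decay_translates_bound[OF h, of R] by blast
    have "((\<lambda>x. \<integral>w. indicator P w *\<^sub>R (h (x + w) * wave z (x + w)) \<partial>lborel) has_sum (\<integral>v. h v * wave z v \<partial>lborel)) L"
      by (intro unfold gauss_decay_integrable gauss_decay_mult_wave h)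
    moreover have "wave z (x + w) = wave z w" if "x \<in> L" for x w
      using wave_periodic z that by blast
    ultimately have a1: "((\<lambda>x. \<integral>w. indicator P w *\<^sub>R (h (x + w) * wave z w) \<partial>lborel) has_sum (\<integral>v. h v * wave z v \<partial>lborel)) L"
      by (simp cong: has_sum_cong)
    have a2: "(\<integral>v. h v * wave z v \<partial>lborel) = c (- z)" by (simp add: c_def)
    have a3: "((\<lambda>x. \<integral>w. indicator P w *\<^sub>R (h (x + w) * wave z w) \<partial>lborel) has_sum
        (\<integral>w. indicator P w *\<^sub>R (F1 w * wave z w) \<partial>lborel)) L"
    proof (rule tile_integral_infsum)
      show "norm (h (x + w) * wave z w) \<le> M x" if "x \<in> L" "w \<in> P" for x w
        using M(2)[of x w] R(2) that by (simp add: norm_mult)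
      show "((\<lambda>x. h (x + w) * wave z w) has_sum F1 w * wave z w) L" for w
        by (rule has_sum_cmult_left[OF F1_sum])
    qed (use M(1) in \<open>(intro continuous_intros h_shift F1_cont | assumption)+\<close>)
    show ?thesis using has_sum_unique[OF a3 a1] a2 by (rule trans)
  qed
  have coef2: "(\<integral>w. indicator P w *\<^sub>R (F2 w * wave z w) \<partial>lborel) = of_real (measure lborel P) * c (- z)"
    if z: "z \<in> dual" for z
  proof -
    have "((\<lambda>y. \<integral>w. indicator P w *\<^sub>R (c y * wave y w * wave z w) \<partial>lborel) has_sum
        (\<integral>w. indicator P w *\<^sub>R (F2 w * wave z w) \<partial>lborel)) dual"
    proof (rule tile_integral_infsum)
      show "norm (c y * wave y w * wave z w) \<le> norm (c y)" for y w
        by (simp add: norm_mult)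
      show "((\<lambda>y. c y * wave y w * wave z w) has_sum F2 w * wave z w) dual" for w
        by (rule has_sum_cmult_left[OF F2_sum])
    qed (use c in \<open>(intro continuous_intros F2_cont | assumption)+\<close>)
    moreover have "(\<integral>w. indicator P w *\<^sub>R (c y * wave y w * wave z w) \<partial>lborel)
        = (if y = - z then of_real (measure lborel P) * c (- z) else 0)" if y: "y \<in> dual" for y
    proof -
      have "(\<integral>w. indicator P w *\<^sub>R (c y * wave y w * wave z w) \<partial>lborel)
         = (\<integral>w. c y * (indicator P w *\<^sub>R wave (y + z) w) \<partial>lborel)"
        by (intro Bochner_Integration.integral_cong) (auto simp: wave_add_left)
      also have "\<dots> = c y * (\<integral>w. indicator P w *\<^sub>R wave (y + z) w \<partial>lborel)"
        by (rule integral_mult_right_zero)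
      finally have eq: "(\<integral>w. indicator P w *\<^sub>R (c y * wave y w * wave z w) \<partial>lborel)
         = c y * (\<integral>w. indicator P w *\<^sub>R wave (y + z) w \<partial>lborel)" .
      show ?thesis
      proof (cases "y = - z")
        case True
        thus ?thesis using eq by (simp add: scaleR_conv_of_real)
      next
        case False
        hence "y + z \<noteq> 0" by (simp add: eq_neg_iff_add_eq_0)
        from tile_integral_wave[OF dual_add[OF y z] this] show ?thesis
          using eq False by simp
      qed
    qed
    ultimately have "((\<lambda>y. if y = - z then of_real (measure lborel P) * c (- z) else 0) has_sum
        (\<integral>w. indicator P w *\<^sub>R (F2 w * wave z w) \<partial>lborel)) dual"
      by (simp cong: has_sum_cong)
    moreover have "((\<lambda>y. if y = - z then of_real (measure lborel P) * c (- z) else 0) has_sum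
       of_real (measure lborel P) * c (- z)) dual"
      by (rule has_sum_finite_neutralI[of "{- z}"]) (use dual_minus[OF z] in auto)
    ultimately show ?thesis by (rule has_sum_unique)
  qed
  define V where "V = complex_of_real (measure lborel P)"
  have V: "V \<noteq> 0" using measure_P_pos by (simp add: V_def)
  have "F1 v - F2 v / V = 0"
  proof (rule fourier_unique[where F = "\<lambda>v. F1 v - F2 v / V", OF _ _ _ Y])
    show "continuous_on UNIV (\<lambda>v. F1 v - F2 v / V)"
      using V by (intro continuous_intros F1_cont F2_cont) auto
    show "F1 (x + v) - F2 (x + v) / V = F1 v - F2 v / V" if "x \<in> L" for x v
      using F1_per F2_per that by simp
    fix z assume z: "z \<in> dual"
    have i1: "integrable lborel (\<lambda>w. indicator P w *\<^sub>R (F1 w * wave z w))"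
      by (intro integrable_on_tile continuous_intros F1_cont)
    have i2: "integrable lborel (\<lambda>w. indicator P w *\<^sub>R (F2 w * wave z w))"
      by (intro integrable_on_tile continuous_intros F2_cont)
    have "(\<lambda>w. indicator P w *\<^sub>R ((F1 w - F2 w / V) * wave z w))
       = (\<lambda>w. indicator P w *\<^sub>R (F1 w * wave z w) - (1 / V) * (indicator P w *\<^sub>R (F2 w * wave z w)))"
      by (auto simp: fun_eq_iff algebra_simps scaleR_conv_of_real)
    hence "(\<integral>w. indicator P w *\<^sub>R ((F1 w - F2 w / V) * wave z w) \<partial>lborel)
       = (\<integral>w. indicator P w *\<^sub>R (F1 w * wave z w) - (1 / V) * (indicator P w *\<^sub>R (F2 w * wave z w)) \<partial>lborel)"
      by (simp only:)
    also have "\<dots> = c (- z) - (1 / V) * (V * c (- z))"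
      by (simp only: Bochner_Integration.integral_diff i1 i2 integrable_mult_right integral_mult_right_zero
          coef1[OF z] coef2[OF z] V_def)
    also have "\<dots> = 0" using V by simp
    finally show "(\<integral>w. indicator P w *\<^sub>R ((F1 w - F2 w / V) * wave z w) \<partial>lborel) = 0" .
  qed
  thus ?thesis by (simp only: F1_def F2_def V_def right_minus_eq)
qed

end

section \<open>Self-dual lattices and their theta transformation\<close>

text \<open>
  The vectors \<open>d b\<close> form the basis dual to \<open>B\<close>. For a basis of a lattice they generate
  the dual lattice.
\<close>

lemma coordinate_functionals:
  fixes B :: "'a::euclidean_space set"
  assumes B: "independent B" "span B = UNIV"
  obtains d where "\<And>v. v = (\<Sum>b\<in>B. (d b \<bullet> v) *\<^sub>R b)"
    "\<And>b b'. b \<in> B \<Longrightarrow> b' \<in> B \<Longrightarrow> d b \<bullet> b' = (if b' = b then 1 else 0)"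
proof -
  have fin: "finite B" using B(1) by (rule independent_imp_finite)
  have lin: "linear (\<lambda>v. representation B v b)" for b
    using B by (intro linearI) (simp_all add: representation_add representation_scale)
  define d where "d b = adjoint (\<lambda>v. representation B v b) 1" for b
  have d: "d b \<bullet> v = representation B v b" for b v
    using adjoint_works[OF lin[of b], of v 1] by (simp add: d_def inner_commute)
  show ?thesis
  proof (rule that)
    show "v = (\<Sum>b\<in>B. (d b \<bullet> v) *\<^sub>R b)" for v
      using sum_representation_eq[OF B(1), of v B] B(2) fin by (simp add: d)
    show "d b \<bullet> b' = (if b' = b then 1 else 0)" if "b \<in> B" "b' \<in> B" for b b'
      using that representation_basis[OF B(1) that(2)] by (auto simp: d)
  qed
qed

definition int_span :: "'a::euclidean_space set \<Rightarrow> 'a set" where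
  "int_span B = range (\<lambda>c :: 'a \<Rightarrow> int. \<Sum>b\<in>B. of_int (c b) *\<^sub>R b)"

text \<open>
  The half-open fundamental parallelepiped tiles, by taking integer parts of the coordinates. The
  dual basis \<open>Y\<close> recognizes the lattice, as needed for \<open>fourier_unique\<close>.
\<close>

lemma lattice_tiling_of_basis:
  fixes B :: "'a::euclidean_space set"
  assumes B: "independent B" "span B = UNIV"
  obtains P Y where "lattice_tiling (int_span B) P" "finite Y"
    "\<And>y x. y \<in> Y \<Longrightarrow> x \<in> int_span B \<Longrightarrow> y \<bullet> x \<in> \<int>"
    "\<And>v. (\<And>y. y \<in> Y \<Longrightarrow> y \<bullet> v \<in> \<int>) \<Longrightarrow> v \<in> int_span B"
proof -
  have fin: "finite B" using B(1) by (rule independent_imp_finite)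
  obtain d where d: "\<And>v. v = (\<Sum>b\<in>B. (d b \<bullet> v) *\<^sub>R b)"
    "\<And>b b'. b \<in> B \<Longrightarrow> b' \<in> B \<Longrightarrow> d b \<bullet> b' = (if b' = b then 1 else 0)"
    using coordinate_functionals[OF B] by metis
  define L where "L = int_span B"
  have d_comb: "d b \<bullet> (\<Sum>b'\<in>B. c b' *\<^sub>R b') = c b" if "b \<in> B" for b c
  proof -
    have "d b \<bullet> (\<Sum>b'\<in>B. c b' *\<^sub>R b') = (\<Sum>b'\<in>B. if b' = b then c b' else 0)"
      unfolding inner_sum_right using d(2)[OF that] by (intro sum.cong refl) auto
    thus ?thesis using fin that by simp
  qed
  have mem: "v \<in> L \<longleftrightarrow> (\<forall>b\<in>B. d b \<bullet> v \<in> \<int>)" for v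
  proof
    assume "v \<in> L"
    thus "\<forall>b\<in>B. d b \<bullet> v \<in> \<int>" by (auto simp: L_def int_span_def d_comb)
  next
    assume *: "\<forall>b\<in>B. d b \<bullet> v \<in> \<int>"
    have "v = (\<Sum>b\<in>B. (d b \<bullet> v) *\<^sub>R b)" by (rule d(1))
    also have "\<dots> = (\<Sum>b\<in>B. of_int \<lfloor>d b \<bullet> v\<rfloor> *\<^sub>R b)"
      using * by (intro sum.cong refl) (metis Ints_cases floor_of_int)
    finally show "v \<in> L" unfolding L_def int_span_def by (rule range_eqI[of _ _ "\<lambda>b. \<lfloor>d b \<bullet> v\<rfloor>"])
  qed
  define P where "P = {v. \<forall>b\<in>B. 0 \<le> d b \<bullet> v \<and> d b \<bullet> v < 1}"
  have "lattice_tiling L P"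
  proof
    show "0 \<in> L" "\<And>x y. x \<in> L \<Longrightarrow> y \<in> L \<Longrightarrow> x + y \<in> L" "\<And>x. x \<in> L \<Longrightarrow> - x \<in> L"
      by (auto simp: mem inner_simps)
    show "countable L"
    proof -
      have "L \<subseteq> (\<lambda>c. \<Sum>b\<in>B. of_int (c b) *\<^sub>R b) ` (PiE B (\<lambda>_. UNIV :: int set))"
      proof
        fix v assume "v \<in> L"
        then obtain c :: "'a \<Rightarrow> int" where "v = (\<Sum>b\<in>B. of_int (c b) *\<^sub>R b)" by (auto simp: L_def int_span_def)
        hence "v = (\<Sum>b\<in>B. of_int (restrict c B b) *\<^sub>R b)" by simp
        thus "v \<in> (\<lambda>c. \<Sum>b\<in>B. of_int (c b) *\<^sub>R b) ` (PiE B (\<lambda>_. UNIV :: int set))"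
          by (intro image_eqI[of _ _ "restrict c B"]) auto
      qed
      thus ?thesis using fin by (meson countable_PiE countable_image countable_subset countableI_type)
    qed
    have "P = (\<Inter>b\<in>B. {v. 0 \<le> d b \<bullet> v} \<inter> {v. d b \<bullet> v < 1}) \<inter> UNIV" by (auto simp: P_def)
    also have "\<dots> \<in> sets borel"
      using fin by (cases "B = {}") (auto intro!: sets.finite_INT)
    finally show "P \<in> sets borel" .
    show "bounded P"
    proof (rule boundedI)
      fix v assume v: "v \<in> P"
      have "norm v \<le> (\<Sum>b\<in>B. norm ((d b \<bullet> v) *\<^sub>R b))"
        by (subst d(1)[of v]) (rule norm_sum)
      also have "\<dots> \<le> (\<Sum>b\<in>B. norm b)"
        using v by (intro sum_mono) (auto simp: P_def abs_le_iff intro!: mult_left_le_one_le)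
      finally show "norm v \<le> (\<Sum>b\<in>B. norm b)" .
    qed
    fix v
    show "\<exists>!x. x \<in> L \<and> v - x \<in> P"
    proof (rule ex1I)
      let ?x = "\<Sum>b\<in>B. of_int \<lfloor>d b \<bullet> v\<rfloor> *\<^sub>R b"
      have x: "b \<in> B \<Longrightarrow> d b \<bullet> ?x = of_int \<lfloor>d b \<bullet> v\<rfloor>" for b by (rule d_comb)
      show "?x \<in> L \<and> v - ?x \<in> P"
        using x by (auto simp: mem P_def inner_diff_right) linarith+
      fix z assume z: "z \<in> L \<and> v - z \<in> P"
      have "d b \<bullet> z = of_int \<lfloor>d b \<bullet> v\<rfloor>" if b: "b \<in> B" for b
      proof -
        obtain n where n: "d b \<bullet> z = of_int n" using z b by (auto simp: mem elim: Ints_cases)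
        have "0 \<le> d b \<bullet> v - d b \<bullet> z" "d b \<bullet> v - d b \<bullet> z < 1"
          using z b by (auto simp: P_def inner_diff_right)
        hence "\<lfloor>d b \<bullet> v\<rfloor> = n" using n by linarith
        thus ?thesis using n by simp
      qed
      thus "z = ?x" by (subst d(1)[of z]) simp
    qed
  qed
  moreover have "finite (d ` B)" using fin by simp
  ultimately show ?thesis
    by (intro that[of P "d ` B"]) (auto simp: L_def[symmetric] mem)
qed


text \<open>
  The quotient of the \<open>k\<close>-th and the zeroth moment, for \<open>k \<le> 2\<close>.
\<close>

definition moment_factor :: "nat \<Rightarrow> real \<Rightarrow> real \<Rightarrow> complex" where
  "moment_factor k t y =
     (if k = 0 then 1 else if k = 1 then - \<i> * of_real (y / t) else of_real (1 / (2 * pi * t) - y\<^sup>2 / t\<^sup>2))"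

lemma gauss_wave_moment:
  assumes "t > 0" "k \<le> 2"
  shows "(\<integral>x. of_real (x ^ k) * gauss_wave t y x \<partial>lborel)
     = moment_factor k t y * of_real (exp (- pi * y\<^sup>2 / t) / sqrt t)"
proof -
  consider "k = 0" | "k = 1" | "k = 2" using assms(2) by linarith
  thus ?thesis
    by cases (use gauss_wave_moment_0[OF assms(1)] gauss_wave_moment_1[OF assms(1)] gauss_wave_moment_2[OF assms(1)]
        in \<open>simp_all add: moment_factor_def\<close>)
qed

lemma fourier_gauss_monomial:
  fixes y :: "'a::euclidean_space" and p :: "'a \<Rightarrow> nat"
  assumes t: "t > 0" and p: "\<And>b. b \<in> Basis \<Longrightarrow> p b \<le> 2"
  defines "h \<equiv> \<lambda>v::'a. of_real ((\<Prod>b\<in>Basis. (v \<bullet> b) ^ p b) * exp (- pi * t * (norm v)\<^sup>2)) * wave (- y) v"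
  shows "integrable lborel h"
    and "(\<integral>v. h v \<partial>lborel) = (\<Prod>b\<in>Basis. moment_factor (p b) t (y \<bullet> b))
           * of_real (exp (- pi * (norm y)\<^sup>2 / t) / sqrt t ^ DIM('a))"
proof -
  let ?f = "\<lambda>b x. of_real (x ^ p b) * gauss_wave t (y \<bullet> b) x"
  have nsq: "(norm v)\<^sup>2 = (\<Sum>b\<in>Basis. (v \<bullet> b)\<^sup>2)" for v :: 'a
    unfolding power2_norm_eq_inner euclidean_inner[of v v] by (simp add: power2_eq_square)
  have h_eq: "h v = (\<Prod>b\<in>Basis. ?f b (v \<bullet> b))" for v
  proof -
    have "(\<Prod>b\<in>Basis. ?f b (v \<bullet> b)) = of_real (\<Prod>b\<in>Basis. (v \<bullet> b) ^ p b)
        * ((\<Prod>b\<in>Basis. exp (- of_real (pi * t * (v \<bullet> b)\<^sup>2))) * (\<Prod>b\<in>Basis. cis (- 2 * pi * (v \<bullet> b * (y \<bullet> b)))))"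
      by (simp add: gauss_wave_def prod.distrib)
    also have "(\<Prod>b\<in>Basis. exp (- of_real (pi * t * (v \<bullet> b)\<^sup>2))) = complex_of_real (exp (- pi * t * (norm v)\<^sup>2))"
      by (simp add: exp_sum[symmetric] nsq sum_distrib_left exp_of_real sum_negf flip: exp_of_real)
    also have "(\<Prod>b\<in>Basis. cis (- 2 * pi * (v \<bullet> b * (y \<bullet> b)))) = wave (- y) v"
    proof -
      have "(\<Prod>b\<in>Basis. cis (- 2 * pi * (v \<bullet> b * (y \<bullet> b)))) = cis (\<Sum>b\<in>Basis. - 2 * pi * (v \<bullet> b * (y \<bullet> b)))"
        by (simp add: cis_conv_exp exp_sum sum_distrib_left del: mult_minus_left)
      also have "(\<Sum>b\<in>Basis. - 2 * pi * (v \<bullet> b * (y \<bullet> b))) = 2 * pi * (- y \<bullet> v)"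
        unfolding euclidean_inner[of "- y" v] sum_distrib_left by (intro sum.cong refl) simp
      finally show ?thesis by (simp add: wave_def)
    qed
    finally show ?thesis by (simp add: h_def)
  qed
  show "integrable lborel h"
    unfolding h_eq[abs_def] by (intro lborel_prod_coords(1) gauss_wave_moment_integrable t)
  have "(\<integral>v. h v \<partial>lborel) = (\<Prod>b\<in>Basis. \<integral>x. ?f b x \<partial>lborel)"
    unfolding h_eq by (intro lborel_prod_coords(2) gauss_wave_moment_integrable t)
  also have "\<dots> = (\<Prod>b\<in>Basis. moment_factor (p b) t (y \<bullet> b) * of_real (exp (- pi * (y \<bullet> b)\<^sup>2 / t) / sqrt t))"
    using t p by (intro prod.cong refl gauss_wave_moment)
  also have "\<dots> = (\<Prod>b\<in>Basis. moment_factor (p b) t (y \<bullet> b)) * of_real (\<Prod>b\<in>Basis. exp (- pi * (y \<bullet> b)\<^sup>2 / t) / sqrt t)"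
    by (simp only: prod.distrib of_real_prod)
  also have "(\<Prod>b\<in>Basis. exp (- pi * (y \<bullet> b)\<^sup>2 / t) / sqrt t) = exp (- pi * (norm y)\<^sup>2 / t) / sqrt t ^ DIM('a)"
    by (simp add: prod_dividef exp_sum[symmetric] nsq sum_distrib_left sum_divide_distrib sum_negf)
  finally show "(\<integral>v. h v \<partial>lborel) = (\<Prod>b\<in>Basis. moment_factor (p b) t (y \<bullet> b))
           * of_real (exp (- pi * (norm y)\<^sup>2 / t) / sqrt t ^ DIM('a))" .
qed

text \<open>
  Unimodularity in an arbitrary Euclidean space, so that the integers in the real line are an
  instance as well.
\<close>

definition self_dual_lattice :: "'a::euclidean_space set \<Rightarrow> bool" where
  "self_dual_lattice L \<longleftrightarrow> (\<exists>B. independent B \<and> span B = UNIV \<and> L = int_span B) \<and>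
     L = {y. \<forall>x\<in>L. y \<bullet> x \<in> \<int>}"

lemma self_dual_lattice_tiling:
  assumes "self_dual_lattice L"
  obtains P Y where "lattice_tiling L P" "lattice_tiling.dual L = L" "finite Y" "Y \<subseteq> L"
    "\<And>v. (\<And>y. y \<in> Y \<Longrightarrow> y \<bullet> v \<in> \<int>) \<Longrightarrow> v \<in> L"
proof -
  obtain B where B: "independent B" "span B = UNIV" "L = int_span B"
    and L: "L = {y. \<forall>x\<in>L. y \<bullet> x \<in> \<int>}"
    using assms by (auto simp: self_dual_lattice_def)
  obtain P Y where PY: "lattice_tiling L P" "finite Y"
    "\<And>y x. y \<in> Y \<Longrightarrow> x \<in> L \<Longrightarrow> y \<bullet> x \<in> \<int>"
    "\<And>v. (\<And>y. y \<in> Y \<Longrightarrow> y \<bullet> v \<in> \<int>) \<Longrightarrow> v \<in> L"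
    using lattice_tiling_of_basis[OF B(1,2)] unfolding B(3) by metis
  show ?thesis
  proof (rule that[OF PY(1) _ PY(2) _ PY(4)])
    show "lattice_tiling.dual L = L" using L lattice_tiling.dual_def[OF PY(1)] by simp
    show "Y \<subseteq> L" using L PY(3) by blast
  qed
qed

lemma self_dual_gaussian_summable:
  assumes "self_dual_lattice L" "a > 0"
  shows "(\<lambda>x. exp (- a * (norm x)\<^sup>2)) summable_on L"
  using self_dual_lattice_tiling[OF assms(1)] lattice_tiling.gaussian_summable[OF _ assms(2)] by metis

lemma self_dual_gauss_decay_summable:
  assumes "self_dual_lattice L" "gauss_decay h"
  shows "(\<lambda>x. norm (h x)) summable_on L"
  using self_dual_lattice_tiling[OF assms(1)] lattice_tiling.gauss_decay_abs_summable[OF _ assms(2), of L _ 0]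
  by (metis (no_types, lifting) add.right_neutral summable_on_cong)

lemma infsum_complex_of_real:
  assumes "(\<lambda>x. norm (f x :: real)) summable_on A"
  shows "(\<Sum>\<^sub>\<infinity>x\<in>A. complex_of_real (f x)) = of_real (infsum f A)"
  by (rule infsumI[OF has_sum_of_real[OF has_sum_infsum[OF abs_summable_summable[OF assms]]]])

lemma exp_poly_bound:
  fixes s a :: real
  assumes "s \<ge> 0" "a > 0"
  shows "(1 + s) * exp (- a * s) \<le> (1 + 2 / a) * exp (- (a / 2) * s)"
proof -
  have "a * s / 2 \<le> exp (a * s / 2)" using exp_ge_add_one_self[of "a * s / 2"] by linarith
  hence "s \<le> 2 / a * exp (a * s / 2)" using assms(2) by (simp add: field_simps)
  moreover have "1 \<le> exp (a * s / 2)" using assms by simp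
  ultimately have "1 + s \<le> (1 + 2 / a) * exp (a * s / 2)"
    unfolding distrib_right mult_1_left by linarith
  hence "(1 + s) * exp (- a * s) \<le> (1 + 2 / a) * exp (a * s / 2) * exp (- a * s)"
    by (rule mult_right_mono) simp
  also have "\<dots> = (1 + 2 / a) * exp (- (a / 2) * s)"
    by (simp add: mult.assoc exp_add[symmetric])
  finally show ?thesis .
qed

lemma gauss_decay_quadratic:
  assumes q: "continuous_on UNIV q" "\<And>v::'a::euclidean_space. \<bar>q v\<bar> \<le> K * (1 + (norm v)\<^sup>2)" and a: "a > 0"
  shows "gauss_decay (\<lambda>v. of_real (q v * exp (- a * (norm v)\<^sup>2)))"
  unfolding gauss_decay_def
proof (intro conjI exI allI)
  show "continuous_on UNIV (\<lambda>v. complex_of_real (q v * exp (- a * (norm v)\<^sup>2)))"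
    by (intro continuous_intros q)
  show "a / 2 > 0" using a by simp
  fix v :: 'a
  have "0 \<le> K * (1 + (norm v)\<^sup>2)" using q(2)[of v] abs_ge_zero order_trans by blast
  hence K: "K \<ge> 0" by (simp add: zero_le_mult_iff add_pos_nonneg) (smt (verit) zero_le_power2)
  have "norm (complex_of_real (q v * exp (- a * (norm v)\<^sup>2))) = \<bar>q v\<bar> * exp (- a * (norm v)\<^sup>2)"
    by (simp add: abs_mult del: of_real_mult)
  also have "\<dots> \<le> K * (1 + (norm v)\<^sup>2) * exp (- a * (norm v)\<^sup>2)"
    using q(2) by (rule mult_right_mono) simp
  also have "\<dots> \<le> K * ((1 + 2 / a) * exp (- (a / 2) * (norm v)\<^sup>2))"
    using mult_left_mono[OF exp_poly_bound[of "(norm v)\<^sup>2" a] K] a by (simp add: mult.assoc)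
  finally show "norm (complex_of_real (q v * exp (- a * (norm v)\<^sup>2))) \<le> K * (1 + 2 / a) * exp (- (a / 2) * (norm v)\<^sup>2)"
    by (simp add: mult.assoc)
qed

lemma gauss_decay_gaussian:
  "a > 0 \<Longrightarrow> gauss_decay (\<lambda>v::'a::euclidean_space. of_real (exp (- a * (norm v)\<^sup>2)))"
  using gauss_decay_quadratic[of "\<lambda>_. 1" 1 a] by (simp add: continuous_on_const)

lemma fourier_gaussian:
  fixes y :: "'a::euclidean_space"
  assumes t: "t > 0"
  shows "(\<integral>v. of_real (exp (- pi * t * (norm v)\<^sup>2)) * wave (- y) v \<partial>lborel)
     = of_real (exp (- pi * (norm y)\<^sup>2 / t) / sqrt t ^ DIM('a))"
  using fourier_gauss_monomial(2)[OF t, of "\<lambda>_. 0" y] by (simp add: moment_factor_def)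

text \<open>
  The volume of the tile is 1: Poisson summation for \<open>exp(-\<pi>|v|\<^sup>2)\<close>, which
  is its own Fourier transform, says that a positive sum equals itself divided by the volume.
\<close>

theorem self_dual_poisson:
  fixes h :: "'a::euclidean_space \<Rightarrow> complex"
  assumes L: "self_dual_lattice L" and h: "gauss_decay h"
    and c: "(\<lambda>y. norm (\<integral>v. h v * wave (- y) v \<partial>lborel)) summable_on L"
  shows "(\<Sum>\<^sub>\<infinity>x\<in>L. h (x + v)) = (\<Sum>\<^sub>\<infinity>y\<in>L. (\<integral>v. h v * wave (- y) v \<partial>lborel) * wave y v)"
proof -
  obtain P Y where P: "lattice_tiling L P" and dual: "lattice_tiling.dual L = L"
    and Y: "finite Y" "Y \<subseteq> L" "\<And>v. (\<And>y. y \<in> Y \<Longrightarrow> y \<bullet> v \<in> \<int>) \<Longrightarrow> v \<in> L"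
    using self_dual_lattice_tiling[OF L] by metis
  define V where "V = complex_of_real (measure lborel P)"
  have ps: "(\<Sum>\<^sub>\<infinity>x\<in>L. f (x + w)) = (\<Sum>\<^sub>\<infinity>y\<in>L. (\<integral>v. f v * wave (- y) v \<partial>lborel) * wave y w) / V"
    if "gauss_decay f" "(\<lambda>y. norm (\<integral>v. f v * wave (- y) v \<partial>lborel)) summable_on L" for f w
    unfolding V_def
    by (rule lattice_tiling.poisson_summation[OF P, where Y = Y, unfolded dual]) (fact that Y)+
  define g where "g v = complex_of_real (exp (- pi * 1 * (norm v)\<^sup>2))" for v :: 'a
  have g: "gauss_decay g" using gauss_decay_gaussian[OF pi_gt_zero] by (simp add: g_def[abs_def])
  have c_g: "(\<integral>v. g v * wave (- y) v \<partial>lborel) = g y" for y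
    using fourier_gaussian[of 1 y] by (simp add: g_def)
  have "(\<Sum>\<^sub>\<infinity>x\<in>L. g (x + 0)) = (\<Sum>\<^sub>\<infinity>y\<in>L. (\<integral>v. g v * wave (- y) v \<partial>lborel) * wave y 0) / V"
  proof (rule ps[OF g])
    show "(\<lambda>y. norm (\<integral>v. g v * wave (- y) v \<partial>lborel)) summable_on L"
      unfolding c_g by (rule self_dual_gauss_decay_summable[OF L g])
  qed
  hence eq: "infsum g L = infsum g L / V" by (simp add: c_g)
  have "infsum g L = of_real (\<Sum>\<^sub>\<infinity>x\<in>L. exp (- pi * (norm x)\<^sup>2))"
    unfolding g_def mult_1_right
    by (rule infsum_complex_of_real) (use self_dual_gaussian_summable[OF L pi_gt_zero] in simp)
  moreover have "(\<Sum>x\<in>{0::'a}. exp (- pi * (norm x)\<^sup>2)) \<le> (\<Sum>\<^sub>\<infinity>x\<in>L. exp (- pi * (norm x)\<^sup>2))"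
    by (rule finite_sum_le_infsum[OF self_dual_gaussian_summable[OF L pi_gt_zero]])
      (use lattice_tiling.zero_L[OF P] in auto)
  ultimately have "infsum g L \<noteq> 0" by auto
  moreover have "V \<noteq> 0" using lattice_tiling.measure_P_pos[OF P] by (simp add: V_def)
  ultimately have "V = 1" using eq by (simp add: field_simps)
  with ps[OF h c] show ?thesis by simp
qed

text \<open>
  These polynomials span the harmonic quadratic forms.
\<close>

definition harmonic_quadratic :: "('a::euclidean_space \<Rightarrow> real) \<Rightarrow> bool" where
  "harmonic_quadratic P \<longleftrightarrow> (\<exists>i\<in>Basis. \<exists>j\<in>Basis. i \<noteq> j \<and>
     (P = (\<lambda>v. (v \<bullet> i)\<^sup>2 - (v \<bullet> j)\<^sup>2) \<or> P = (\<lambda>v. (v \<bullet> i) * (v \<bullet> j))))"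

lemma harmonic_quadratic_continuous: "harmonic_quadratic P \<Longrightarrow> continuous_on UNIV P"
  by (auto simp: harmonic_quadratic_def intro!: continuous_intros)

lemma harmonic_quadratic_bound:
  assumes "harmonic_quadratic P"
  shows "\<bar>P v\<bar> \<le> 1 * (1 + (norm v)\<^sup>2)"
proof -
  obtain i j where ij: "i \<in> Basis" "j \<in> Basis" "i \<noteq> j"
    "P = (\<lambda>v. (v \<bullet> i)\<^sup>2 - (v \<bullet> j)\<^sup>2) \<or> P = (\<lambda>v. (v \<bullet> i) * (v \<bullet> j))"
    using assms by (auto simp: harmonic_quadratic_def)
  have b: "\<bar>v \<bullet> i\<bar> \<le> norm v" "\<bar>v \<bullet> j\<bar> \<le> norm v" using ij Basis_le_norm by auto
  have sq: "(v \<bullet> i)\<^sup>2 \<le> (norm v)\<^sup>2" "(v \<bullet> j)\<^sup>2 \<le> (norm v)\<^sup>2"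
    using b by (metis abs_ge_zero power2_abs power_mono)+
  have "\<bar>(v \<bullet> i)\<^sup>2 - (v \<bullet> j)\<^sup>2\<bar> \<le> (norm v)\<^sup>2"
    using sq zero_le_power2[of "v \<bullet> i"] zero_le_power2[of "v \<bullet> j"] by linarith
  moreover have "\<bar>(v \<bullet> i) * (v \<bullet> j)\<bar> \<le> (norm v)\<^sup>2"
    unfolding abs_mult power2_eq_square using b by (intro mult_mono) auto
  ultimately show ?thesis using ij(4) by auto
qed

text \<open>
  In \<open>x\<^sub>i\<^sup>2 - x\<^sub>j\<^sup>2\<close> the constant terms
  \<open>1/(2\<pi>t)\<close> of the two second moments cancel, so a harmonic \<open>P\<close> is
  reproduced up to the factor \<open>-1/t\<^sup>2\<close>.
\<close>

lemma fourier_harmonic_quadratic: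
  fixes y :: "'a::euclidean_space"
  assumes t: "t > 0" and P: "harmonic_quadratic P"
  shows "(\<integral>v. of_real (P v * exp (- pi * t * (norm v)\<^sup>2)) * wave (- y) v \<partial>lborel)
     = of_real (- (1 / (t\<^sup>2 * sqrt t ^ DIM('a))) * (P y * exp (- pi * (norm y)\<^sup>2 / t)))"
proof -
  obtain i j where ij: "i \<in> Basis" "j \<in> Basis" "i \<noteq> j"
    and P_eq: "P = (\<lambda>v. (v \<bullet> i)\<^sup>2 - (v \<bullet> j)\<^sup>2) \<or> P = (\<lambda>v. (v \<bullet> i) * (v \<bullet> j))"
    using P by (auto simp: harmonic_quadratic_def)
  define G where "G = complex_of_real (exp (- pi * (norm y)\<^sup>2 / t) / sqrt t ^ DIM('a))"
  define h where "h p v = of_real ((\<Prod>b\<in>Basis. (v \<bullet> b) ^ p b) * exp (- pi * t * (norm v)\<^sup>2)) * wave (- y) v"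
    for p :: "'a \<Rightarrow> nat" and v
  note F = fourier_gauss_monomial[OF t, of _ y, folded h_def G_def]
  from P_eq show ?thesis
  proof
    assume P: "P = (\<lambda>v. (v \<bullet> i)\<^sup>2 - (v \<bullet> j)\<^sup>2)"
    define p where "p k = (\<lambda>b::'a. if b = k then 2 else 0 :: nat)" for k
    have h_p: "h (p k) v = of_real ((v \<bullet> k)\<^sup>2 * exp (- pi * t * (norm v)\<^sup>2)) * wave (- y) v" if "k \<in> Basis" for k v
    proof -
      have "(\<Prod>b\<in>Basis. (v \<bullet> b) ^ p k b) = (\<Prod>b\<in>Basis. if b = k then (v \<bullet> k)\<^sup>2 else 1)"
        by (intro prod.cong) (auto simp: p_def)
      thus ?thesis using that by (simp add: h_def)
    qed
    have int_p: "(\<integral>v. h (p k) v \<partial>lborel) = of_real (1 / (2 * pi * t) - (y \<bullet> k)\<^sup>2 / t\<^sup>2) * G"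
      "integrable lborel (h (p k))" if "k \<in> Basis" for k
    proof -
      have "(\<Prod>b\<in>Basis. moment_factor (p k b) t (y \<bullet> b))
         = (\<Prod>b\<in>Basis. if b = k then of_real (1 / (2 * pi * t) - (y \<bullet> k)\<^sup>2 / t\<^sup>2) else 1)"
        by (intro prod.cong) (auto simp: p_def moment_factor_def)
      thus "(\<integral>v. h (p k) v \<partial>lborel) = of_real (1 / (2 * pi * t) - (y \<bullet> k)\<^sup>2 / t\<^sup>2) * G"
        using that by (subst F(2)) (auto simp: p_def)
      show "integrable lborel (h (p k))" by (rule F(1)) (auto simp: p_def)
    qed
    have "(\<integral>v. of_real (P v * exp (- pi * t * (norm v)\<^sup>2)) * wave (- y) v \<partial>lborel)
       = (\<integral>v. h (p i) v - h (p j) v \<partial>lborel)"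
      using ij by (simp add: h_p P left_diff_distrib)
    also have "\<dots> = of_real (1 / (2 * pi * t) - (y \<bullet> i)\<^sup>2 / t\<^sup>2) * G - of_real (1 / (2 * pi * t) - (y \<bullet> j)\<^sup>2 / t\<^sup>2) * G"
      using ij by (simp add: int_p)
    also have "\<dots> = of_real (- (P y / t\<^sup>2)) * G"
      by (simp add: P left_diff_distrib[symmetric] diff_divide_distrib)
    finally show ?thesis using t by (simp add: G_def)
  next
    assume P: "P = (\<lambda>v. (v \<bullet> i) * (v \<bullet> j))"
    define p where "p = (\<lambda>b::'a. if b = i \<or> b = j then 1 else 0 :: nat)"
    have sub: "{i, j} \<subseteq> Basis" using ij by auto
    have pr: "(\<Prod>b\<in>Basis. if b = i \<or> b = j then f b else 1) = f i * f j" for f :: "'a \<Rightarrow> 'b::comm_monoid_mult"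
    proof -
      have "(\<Prod>b\<in>Basis. if b = i \<or> b = j then f b else 1) = (\<Prod>b\<in>{i, j}. if b = i \<or> b = j then f b else 1)"
        by (rule prod.mono_neutral_right) (use sub in auto)
      thus ?thesis using ij by simp
    qed
    have "(\<Prod>b\<in>Basis. (v \<bullet> b) ^ p b) = P v" for v
      using pr[of "\<lambda>b. v \<bullet> b"] by (simp add: p_def P if_distrib cong: if_cong)
    hence h_p: "h p v = of_real (P v * exp (- pi * t * (norm v)\<^sup>2)) * wave (- y) v" for v
      by (simp add: h_def)
    have "(\<Prod>b\<in>Basis. moment_factor (p b) t (y \<bullet> b))
        = (\<Prod>b\<in>Basis. if b = i \<or> b = j then - \<i> * of_real (y \<bullet> b / t) else 1)"
      by (intro prod.cong) (auto simp: p_def moment_factor_def)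
    also have "\<dots> = of_real (- (P y / t\<^sup>2))"
      using pr[of "\<lambda>b. - \<i> * of_real (y \<bullet> b / t)"] by (simp add: P power2_eq_square mult_ac)
    finally have "(\<integral>v. h p v \<partial>lborel) = of_real (- (P y / t\<^sup>2)) * G"
      by (subst F(2)) (auto simp: p_def)
    thus ?thesis using t unfolding h_p[symmetric] by (simp add: G_def)
  qed
qed

text \<open>
  The theta inversion formula with a harmonic coefficient, on the imaginary axis.
\<close>

theorem theta_transform_harmonic:
  fixes L :: "'a::euclidean_space set"
  assumes L: "self_dual_lattice L" and P: "harmonic_quadratic P" and t: "t > 0"
  shows "(\<Sum>\<^sub>\<infinity>x\<in>L. P x * exp (- pi * t * (norm x)\<^sup>2))
       = - (1 / (t\<^sup>2 * sqrt t ^ DIM('a))) * (\<Sum>\<^sub>\<infinity>x\<in>L. P x * exp (- pi * (1 / t) * (norm x)\<^sup>2))"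
proof -
  define h where "h t v = complex_of_real (P v * exp (- (pi * t) * (norm v)\<^sup>2))" for t and v :: 'a
  define k where "k = - (1 / (t\<^sup>2 * sqrt t ^ DIM('a)))"
  have h: "gauss_decay (h t)" if "t > 0" for t
    unfolding h_def[abs_def]
    by (rule gauss_decay_quadratic[OF harmonic_quadratic_continuous[OF P] harmonic_quadratic_bound[OF P]])
      (use that in simp)
  have c: "(\<integral>v. h t v * wave (- y) v \<partial>lborel) = of_real k * h (1 / t) y" for y
    using fourier_harmonic_quadratic[OF t P, of y] by (simp add: h_def k_def)
  have "(\<lambda>y. norm (of_real k * h (1 / t) y)) summable_on L"
    using self_dual_gauss_decay_summable[OF L h[of "1 / t"]] t
    unfolding norm_mult by (intro summable_on_cmult_right) auto
  hence "(\<Sum>\<^sub>\<infinity>x\<in>L. h t (x + 0)) = (\<Sum>\<^sub>\<infinity>y\<in>L. (\<integral>v. h t v * wave (- y) v \<partial>lborel) * wave y 0)"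
    by (intro self_dual_poisson[OF L h[OF t]]) (simp only: c)
  hence eq: "infsum (h t) L = of_real k * infsum (h (1 / t)) L"
    by (simp add: c infsum_cmult_right')
  have s: "(\<lambda>x. norm (P x * exp (- (pi * t) * (norm x)\<^sup>2))) summable_on L" if "t > 0" for t
    using self_dual_gauss_decay_summable[OF L h[OF that]] by (simp add: h_def del: of_real_mult)
  have t': "1 / t > 0" using t by simp
  from eq have "complex_of_real (\<Sum>\<^sub>\<infinity>x\<in>L. P x * exp (- (pi * t) * (norm x)\<^sup>2))
    = of_real (k * (\<Sum>\<^sub>\<infinity>x\<in>L. P x * exp (- (pi * (1 / t)) * (norm x)\<^sup>2)))"
    unfolding h_def infsum_complex_of_real[OF s[OF t]] infsum_complex_of_real[OF s[OF t']] by simp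
  thus ?thesis unfolding of_real_eq_iff by (simp add: k_def)
qed

lemma self_dual_Ints: "self_dual_lattice (\<int> :: real set)"
  unfolding self_dual_lattice_def
proof (intro conjI exI)
  show "independent {1::real}" by simp
  show "span {1::real} = UNIV" by (metis Basis_real_def span_Basis)
  show "(\<int> :: real set) = int_span {1}"
  proof -
    have "(\<int> :: real set) = range of_int" by (rule Ints_def)
    also have "\<dots> = range (\<lambda>c :: real \<Rightarrow> int. of_int (c 1) *\<^sub>R (1::real))"
    proof safe
      fix n :: int
      show "of_int n \<in> range (\<lambda>c :: real \<Rightarrow> int. of_int (c 1) *\<^sub>R (1::real))"
        by (intro range_eqI[of _ _ "\<lambda>_. n"]) simp
    qed auto
    finally show ?thesis by (simp add: int_span_def)
  qed
  show "(\<int> :: real set) = {y. \<forall>x\<in>\<int>. y \<bullet> x \<in> \<int>}"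
    by (auto dest: bspec[of _ _ 1])
qed

lemma infsum_Ints: "infsum f (\<int> :: real set) = (\<Sum>\<^sub>\<infinity>n::int. f (of_int n))"
  using infsum_reindex[of "of_int :: int \<Rightarrow> real" UNIV f] by (simp add: Ints_def inj_on_def o_def)

lemma summable_on_Ints: "f summable_on (\<int> :: real set) \<longleftrightarrow> (\<lambda>n::int. f (of_int n)) summable_on UNIV"
  using summable_on_reindex[of "of_int :: int \<Rightarrow> real" UNIV f] by (simp add: Ints_def inj_on_def o_def)

lemma int_gaussian_summable: "a > 0 \<Longrightarrow> (\<lambda>n::int. exp (- a * (of_int n)\<^sup>2) :: real) summable_on UNIV"
  using self_dual_gaussian_summable[OF self_dual_Ints, of a] by (simp add: summable_on_Ints)

text \<open>
  The case of the integers, with a shift \<open>v\<close>; it gives the transformations of all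
  theta constants, for \<open>v = 0\<close> and \<open>v = 1/2\<close>.
\<close>

theorem theta_transform_real:
  assumes t: "t > 0"
  shows "(\<Sum>\<^sub>\<infinity>n::int. complex_of_real (exp (- pi * t * (of_int n + v)\<^sup>2)))
     = of_real (1 / sqrt t) * (\<Sum>\<^sub>\<infinity>n::int. of_real (exp (- pi * (1 / t) * (of_int n)\<^sup>2)) * cis (2 * pi * (of_int n * v)))"
proof -
  define h where "h t v = complex_of_real (exp (- (pi * t) * (norm v)\<^sup>2))" for t and v :: real
  have h: "gauss_decay (h t)" if "t > 0" for t
    unfolding h_def[abs_def] using that by (intro gauss_decay_gaussian) auto
  have c: "(\<integral>v. h t v * wave (- y) v \<partial>lborel) = of_real (1 / sqrt t) * h (1 / t) y" for y
    using fourier_gaussian[OF t, of y] by (simp add: h_def)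
  have "(\<lambda>y. norm (of_real (1 / sqrt t) * h (1 / t) y)) summable_on \<int>"
    using self_dual_gauss_decay_summable[OF self_dual_Ints h[of "1 / t"]] t
    unfolding norm_mult by (intro summable_on_cmult_right) auto
  hence "(\<Sum>\<^sub>\<infinity>x\<in>\<int>. h t (x + v)) = (\<Sum>\<^sub>\<infinity>y\<in>\<int>. (\<integral>v. h t v * wave (- y) v \<partial>lborel) * wave y v)"
    by (intro self_dual_poisson[OF self_dual_Ints h[OF t]]) (simp only: c)
  thus ?thesis
    unfolding c mult.assoc infsum_cmult_right' infsum_Ints by (simp add: h_def wave_def mult.assoc)
qed

section \<open>Vanishing of modular forms of weight 12m+2\<close>

definition upper_half :: "complex set" where "upper_half = {z. Im z > 0}"

lemma upper_half: "open upper_half" "convex upper_half" "connected upper_half"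
proof -
  show "open upper_half" unfolding upper_half_def by (rule open_halfspace_Im_gt)
  show "convex upper_half" unfolding upper_half_def by (rule convex_halfspace_Im_gt)
  thus "connected upper_half" by (rule convex_connected)
qed

lemma Im_minus_inverse: "Im (- 1 / z) = Im z / (norm z)\<^sup>2"
  by (simp add: Im_divide cmod_power2)

lemma upper_half_S: "z \<in> upper_half \<Longrightarrow> - 1 / z \<in> upper_half"
  unfolding upper_half_def mem_Collect_eq Im_minus_inverse by (auto intro!: divide_pos_pos)

text \<open>
  The identity theorem extends functional equations from the imaginary axis, where theta inversion
  proves them.
\<close>

lemma upper_half_eq_if_imag_axis_eq:
  assumes "f holomorphic_on upper_half" "g holomorphic_on upper_half"
    and eq: "\<And>t::real. t > 0 \<Longrightarrow> f (\<i> * of_real t) = g (\<i> * of_real t)" and z: "z \<in> upper_half"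
  shows "f z = g z"
proof -
  let ?U = "(\<lambda>t::real. \<i> * of_real t) ` {0<..}"
  have "f z - g z = 0"
  proof (rule analytic_continuation[where U = ?U and \<xi> = "\<i>" and S = upper_half and f = "\<lambda>z. f z - g z"])
    show "(\<lambda>z. f z - g z) holomorphic_on upper_half" using assms by (intro holomorphic_intros)
    show "\<i> islimpt ?U"
      unfolding islimpt_approachable
    proof (intro allI impI)
      fix e :: real assume "e > 0"
      thus "\<exists>x'\<in>?U. x' \<noteq> \<i> \<and> dist x' \<i> < e"
        by (intro bexI[of _ "\<i> * of_real (1 + e / 2)"])
          (auto simp: dist_norm algebra_simps norm_mult norm_divide complex_eq_iff intro!: image_eqI[of _ _ "1 + e / 2"])
    qed
  qed (use upper_half z eq in \<open>auto simp: upper_half_def\<close>)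
  thus ?thesis by simp
qed

lemma exp_series_bound:
  fixes r :: real
  shows "norm (c * exp (\<i> * of_real (pi * r) * z)) = norm c * exp (- pi * Im z * r)"
  by (simp add: norm_mult mult_ac)

lemma exp_series_abs_summable:
  fixes c :: "'i \<Rightarrow> complex" and r :: "'i \<Rightarrow> real"
  assumes "\<And>y. y > 0 \<Longrightarrow> (\<lambda>i. norm (c i) * exp (- pi * y * r i)) summable_on I" "z \<in> upper_half"
  shows "(\<lambda>i. norm (c i * exp (\<i> * of_real (pi * r i) * z))) summable_on I"
  using assms unfolding exp_series_bound by (auto simp: upper_half_def)

lemma exp_series_holomorphic:
  fixes c :: "'i \<Rightarrow> complex" and r :: "'i \<Rightarrow> real"
  assumes s: "\<And>y. y > 0 \<Longrightarrow> (\<lambda>i. norm (c i) * exp (- pi * y * r i)) summable_on I"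
    and r: "\<And>i. i \<in> I \<Longrightarrow> r i \<ge> 0"
  shows "(\<lambda>z. \<Sum>\<^sub>\<infinity>i\<in>I. c i * exp (\<i> * of_real (pi * r i) * z)) holomorphic_on upper_half"
proof -
  let ?f = "\<lambda>X z. \<Sum>i\<in>X. c i * exp (\<i> * of_real (pi * r i) * z)"
  let ?F = "\<lambda>z. \<Sum>\<^sub>\<infinity>i\<in>I. c i * exp (\<i> * of_real (pi * r i) * z)"
  have "?F field_differentiable at z" if z: "z \<in> upper_half" for z
  proof -
    define e where "e = Im z / 2"
    have e: "e > 0" using z by (simp add: e_def upper_half_def)
    have Im_ge: "Im w \<ge> e" if "w \<in> cball z e" for w
      using abs_Im_le_cmod[of "z - w"] that by (simp add: e_def dist_norm)
    have ul: "uniform_limit (cball z e) ?f ?F (finite_subsets_at_top I)"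
    proof (rule Weierstrass_m_test_general[OF _ s[OF e]])
      fix i w assume "i \<in> I" "w \<in> cball z e"
      hence "pi * e * r i \<le> pi * Im w * r i" using Im_ge[of w] r by (intro mult_right_mono mult_left_mono) auto
      thus "norm (c i * exp (\<i> * of_real (pi * r i) * w)) \<le> norm (c i) * exp (- pi * e * r i)"
        unfolding exp_series_bound by (intro mult_left_mono) auto
    qed
    have "?F holomorphic_on ball z e"
    proof (rule holomorphic_uniform_limit[OF _ ul])
      show "\<forall>\<^sub>F X in finite_subsets_at_top I. continuous_on (cball z e) (?f X) \<and> ?f X holomorphic_on ball z e"
        by (intro always_eventually allI conjI continuous_intros holomorphic_intros)
    qed auto
    thus ?thesis using e by (simp add: holomorphic_on_open field_differentiable_def)
  qed
  thus ?thesis by (simp add: holomorphic_on_def field_differentiable_at_within)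
qed

text \<open>
  See the introduction: the quotient \<open>g = f/D\<^sup>m\<close> has weight 2, and its
  primitive \<open>G\<close> is invariant. Since \<open>g\<close> is bounded for \<open>Im \<tau>
  \<ge> 1\<close>, \<open>G\<close> grows at most linearly in \<open>Im \<tau>\<close>, that is
  logarithmically in \<open>q\<close>, and extends over \<open>q = 0\<close>. A point with
  \<open>Im \<tau> = 1/2\<close> and \<open>|Re \<tau>| \<le> 1/2\<close> is mapped by
  \<open>\<tau> \<mapsto> -1/\<tau>\<close> to one with imaginary part at least 1, so on the disc
  \<open>|q| \<le> exp(-\<pi>)\<close> the modulus is maximal inside.
\<close>

theorem modular_vanishing:
  fixes f D :: "complex \<Rightarrow> complex"
  assumes f: "f holomorphic_on upper_half" and D: "D holomorphic_on upper_half"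
    and D_nz: "\<And>z. z \<in> upper_half \<Longrightarrow> D z \<noteq> 0"
    and fT: "\<And>z. z \<in> upper_half \<Longrightarrow> f (z + 1) = f z"
    and DT: "\<And>z. z \<in> upper_half \<Longrightarrow> D (z + 1) = D z"
    and fS: "\<And>z. z \<in> upper_half \<Longrightarrow> f (- 1 / z) = z ^ (12 * m + 2) * f z"
    and DS: "\<And>z. z \<in> upper_half \<Longrightarrow> D (- 1 / z) = z ^ 12 * D z"
    and f_bound: "\<And>z. Im z \<ge> 1 \<Longrightarrow> norm (f z) \<le> A * exp (- 2 * pi * Im z) ^ m"
    and D_bound: "\<And>z. Im z \<ge> 1 \<Longrightarrow> norm (D z) \<ge> B * exp (- 2 * pi * Im z)" and B: "B > 0"
    and z: "z \<in> upper_half"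
  shows "f z = 0"
proof -
  define g where "g z = f z / D z ^ m" for z
  have g: "g holomorphic_on upper_half"
    unfolding g_def using D_nz by (intro holomorphic_intros f D) auto
  have gT: "g (z + 1) = g z" if "z \<in> upper_half" for z
    using fT[OF that] DT[OF that] by (simp add: g_def)
  have gS: "g (- 1 / z) = z\<^sup>2 * g z" if z: "z \<in> upper_half" for z
  proof -
    have "z \<noteq> 0" using z by (auto simp: upper_half_def)
    thus ?thesis using fS[OF z] DS[OF z] D_nz[OF z]
      by (simp add: g_def power_mult_distrib power_mult[symmetric] power_add field_simps power2_eq_square)
  qed
  define K where "K = A / B ^ m"
  have g_bound: "norm (g z) \<le> K" if z: "Im z \<ge> 1" for z
  proof -
    have "norm (g z) = norm (f z) / norm (D z) ^ m" by (simp add: g_def norm_divide norm_power)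
    also have "\<dots> \<le> (A * exp (- 2 * pi * Im z) ^ m) / (B * exp (- 2 * pi * Im z)) ^ m"
      using f_bound[OF z] D_bound[OF z] B order_trans[OF norm_ge_zero f_bound[OF z]]
      by (intro frac_le power_mono) auto
    also have "\<dots> = K" by (simp add: K_def power_mult_distrib)
    finally show ?thesis .
  qed
  obtain G where G: "\<And>z. z \<in> upper_half \<Longrightarrow> (G has_field_derivative g z) (at z)"
    using holomorphic_convex_primitive'[OF upper_half(2,1) g] upper_half(1)
    by (metis at_within_open)
  have shift: "z + 1 \<in> upper_half" if "z \<in> upper_half" for z using that by (simp add: upper_half_def)
  have "\<exists>c. \<forall>z\<in>upper_half. G (z + 1) - G z = c"
  proof (rule has_field_derivative_zero_constant[OF upper_half(2)])
    fix z assume z: "z \<in> upper_half"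
    have "((\<lambda>z. G (z + 1) - G z) has_field_derivative (g (z + 1) * (1 + 0) - g z)) (at z)"
      by (intro derivative_intros DERIV_chain2[where g = "\<lambda>z. z + 1"] G shift z)
    thus "((\<lambda>z. G (z + 1) - G z) has_field_derivative 0) (at z within upper_half)"
      using gT[OF z] by (simp add: has_field_derivative_at_within)
  qed
  then obtain c1 where c1: "\<And>z. z \<in> upper_half \<Longrightarrow> G (z + 1) - G z = c1" by blast
  have "\<exists>c. \<forall>z\<in>upper_half. G (- 1 / z) - G z = c"
  proof (rule has_field_derivative_zero_constant[OF upper_half(2)])
    fix z assume z: "z \<in> upper_half"
    hence z0: "z \<noteq> 0" by (auto simp: upper_half_def)
    have "((\<lambda>z. - 1 / z) has_field_derivative 1 / z\<^sup>2) (at z)"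
      using z0 by (auto intro!: derivative_eq_intros simp: power2_eq_square)
    hence "((\<lambda>z. G (- 1 / z) - G z) has_field_derivative (g (- 1 / z) * (1 / z\<^sup>2) - g z)) (at z)"
      by (intro derivative_intros DERIV_chain2[where g = "\<lambda>z. - 1 / z"] G upper_half_S z)
    thus "((\<lambda>z. G (- 1 / z) - G z) has_field_derivative 0) (at z within upper_half)"
      using gS[OF z] z0 by (simp add: has_field_derivative_at_within)
  qed
  then obtain c2 where c2: "\<And>z. z \<in> upper_half \<Longrightarrow> G (- 1 / z) - G z = c2" by blast
  have "c2 = 0" using c2[of \<i>] by (simp add: upper_half_def)
  hence GS: "G (- 1 / z) = G z" if "z \<in> upper_half" for z using c2[OF that] by simp
  have "c1 = 0"
  proof -
    define \<rho> where "\<rho> = Complex (1 / 2) (sqrt 3 / 2)"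
    have "\<rho> * (\<rho> - 1) = - 1" by (simp add: \<rho>_def complex_eq_iff field_simps)
    moreover have "\<rho> \<noteq> 0" by (simp add: \<rho>_def complex_eq_iff)
    ultimately have "- 1 / \<rho> = \<rho> - 1" by (simp add: field_simps)
    moreover have "\<rho> \<in> upper_half" "\<rho> - 1 \<in> upper_half" by (auto simp: \<rho>_def upper_half_def)
    ultimately show ?thesis using GS[of \<rho>] c1[of "\<rho> - 1"] by simp
  qed
  hence GT: "G (z + 1) = G z" if "z \<in> upper_half" for z using c1[OF that] by simp
  have GTn: "G (z + of_nat n) = G z" if "z \<in> upper_half" for z n
  proof (induction n)
    case (Suc n)
    have "z + of_nat n \<in> upper_half" using that by (simp add: upper_half_def)
    from GT[OF this] Suc show ?case by (simp add: add_ac)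
  qed simp
  have GTi: "G (z + of_int n) = G z" if z: "z \<in> upper_half" for z n
  proof (cases "n \<ge> 0")
    case True
    thus ?thesis using GTn[OF z, of "nat n"] by simp
  next
    case False
    have "z + of_int n \<in> upper_half" using z by (simp add: upper_half_def)
    from GTn[OF this, of "nat (- n)"] False show ?thesis by simp
  qed
  \<comment> \<open>Linear growth of \<open>G\<close> towards infinity, by integrating \<open>g\<close> vertically from height 1.\<close>
  have "continuous_on upper_half G"
    using G by (meson DERIV_isCont continuous_at_imp_continuous_on)
  hence "continuous_on {0..1} (\<lambda>x::real. G (of_real x + \<i>))"
    by (rule continuous_on_compose2) (auto intro!: continuous_intros simp: upper_half_def)
  hence "compact ((\<lambda>x::real. G (of_real x + \<i>)) ` {0..1})"
    by (rule compact_continuous_image) simp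
  then obtain C0 where C0: "\<And>x::real. 0 \<le> x \<Longrightarrow> x \<le> 1 \<Longrightarrow> norm (G (of_real x + \<i>)) \<le> C0"
    using compact_imp_bounded bounded_iff by (metis (mono_tags, lifting) atLeastAtMost_iff image_eqI)
  have growth: "norm (G z) \<le> C0 + K * Im z" if z: "Im z \<ge> 1" for z
  proof -
    define w where "w = z - of_int \<lfloor>Re z\<rfloor>"
    have w: "Im w = Im z" "0 \<le> Re w" "Re w \<le> 1"
      by (auto simp: w_def) linarith+
    have "G w = G z" using GTi[of w "\<lfloor>Re z\<rfloor>"] z w by (simp add: w_def upper_half_def)
    have K: "K \<ge> 0" using order_trans[OF norm_ge_zero g_bound[of \<i>]] by simp
    have "norm (G w - G (of_real (Re w) + \<i>)) \<le> K * norm (w - (of_real (Re w) + \<i>))"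
    proof (rule field_differentiable_bound[of "{z. Im z \<ge> 1}" G g])
      show "convex {z. Im z \<ge> 1}" by (rule convex_halfspace_Im_ge)
      show "(G has_field_derivative g z) (at z within {z. 1 \<le> Im z})" if "z \<in> {z. 1 \<le> Im z}" for z
        by (rule has_field_derivative_at_within[OF G]) (use that in \<open>auto simp: upper_half_def\<close>)
    qed (use w z g_bound in auto)
    also have "w - (of_real (Re w) + \<i>) = \<i> * of_real (Im z - 1)"
      using w by (simp add: complex_eq_iff)
    also have "K * norm \<dots> \<le> K * Im z"
      unfolding norm_mult norm_of_real norm_ii using z K by (intro mult_left_mono) auto
    finally have "norm (G w) \<le> C0 + K * Im z"
      using C0[OF w(2,3)] norm_triangle_ineq2[of "G w" "G (of_real (Re w) + \<i>)"] by linarith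
    thus ?thesis by (simp only: \<open>G w = G z\<close>)
  qed
  \<comment> \<open>\<open>H\<close> is \<open>G\<close> as a function of \<open>q\<close>. The principal logarithm has a cut, but near any \<open>q0\<close> periodicity of
    \<open>G\<close> allows its replacement by a branch that is holomorphic at \<open>q0\<close>.\<close>
  define \<tau> where "\<tau> q = Ln q / (2 * pi * \<i>)" for q
  have Im_\<tau>: "Im (\<tau> q) = - ln (norm q) / (2 * pi)" if "q \<noteq> 0" for q
    using that by (simp add: \<tau>_def Im_divide Re_Ln power2_eq_square)
  have \<tau>_upper: "\<tau> q \<in> upper_half" if "q \<in> ball 0 1 - {0}" for q
    using that by (auto simp: upper_half_def Im_\<tau> divide_neg_pos)
  have exp_\<tau>: "exp (2 * pi * \<i> * \<tau> q) = q" if "q \<noteq> 0" for q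
    using that by (simp add: \<tau>_def)
  have G_eq: "G z = G w" if zw: "exp (2 * pi * \<i> * z) = exp (2 * pi * \<i> * w)" "z \<in> upper_half" "w \<in> upper_half" for z w
  proof -
    obtain n where "2 * pi * \<i> * z = 2 * pi * \<i> * w + (of_int (2 * n) * pi) * \<i>"
      using zw(1) unfolding exp_eq by blast
    hence "(2 * pi * \<i>) * z = (2 * pi * \<i>) * (w + of_int n)" by (simp add: algebra_simps)
    hence "z = w + of_int n" by (subst (asm) mult_left_cancel) auto
    thus ?thesis using GTi zw by simp
  qed
  define H where "H q = G (\<tau> q)" for q
  have "H field_differentiable at q0" if q0: "q0 \<in> ball 0 1 - {0}" for q0
  proof -
    define k where "k q = \<tau> q0 + Ln (q / q0) / (2 * pi * \<i>)" for q
    have kd: "(k has_field_derivative (1 / q0) / (2 * pi * \<i>)) (at q0)"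
      unfolding k_def using q0 by (auto intro!: derivative_eq_intros simp: complex_nonpos_Reals_iff)
    have k0: "k q0 = \<tau> q0" using q0 by (simp add: k_def)
    have kc: "isCont k q0" using kd by (rule DERIV_isCont)
    have "\<forall>\<^sub>F q in nhds q0. k q \<in> upper_half"
    proof (rule topological_tendstoD[OF _ upper_half(1)])
      show "(k \<longlongrightarrow> k q0) (nhds q0)" using kc unfolding isCont_def tendsto_at_iff_tendsto_nhds .
    qed (use k0 \<tau>_upper[OF q0] in simp)
    moreover have "\<forall>\<^sub>F q in nhds q0. q \<in> ball 0 1 - {0}"
      using q0 by (intro eventually_nhds_in_open) auto
    ultimately have ev: "\<forall>\<^sub>F q in nhds q0. H q = G (k q)"
    proof eventually_elim
      case (elim q)
      have "exp (2 * pi * \<i> * k q) = exp (2 * pi * \<i> * \<tau> q0) * exp (Ln (q / q0))"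
        by (simp add: k_def distrib_left exp_add)
      also have "\<dots> = q" using q0 elim exp_\<tau>[of q0] by auto
      also have "\<dots> = exp (2 * pi * \<i> * \<tau> q)" using elim exp_\<tau>[of q] by auto
      finally show ?case unfolding H_def using elim \<tau>_upper by (intro G_eq) auto
    qed
    have "((\<lambda>q. G (k q)) has_field_derivative (g (k q0) * ((1 / q0) / (2 * pi * \<i>)))) (at q0)"
      using G[of "k q0"] kd k0 \<tau>_upper[OF q0] by (intro DERIV_chain2[of G]) auto
    hence "(H has_field_derivative (g (k q0) * ((1 / q0) / (2 * pi * \<i>)))) (at q0)"
      using DERIV_cong_ev[OF refl ev refl] by simp
    thus ?thesis by (auto simp: field_differentiable_def)
  qed
  hence "H holomorphic_on ball 0 1 - {0}"
    by (simp add: holomorphic_on_def field_differentiable_at_within)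
  moreover have "((\<lambda>q. (q - 0) * H q) \<longlongrightarrow> 0) (at 0)"
  proof (rule Lim_null_comparison)
    have "\<forall>\<^sub>F q::complex in at 0. norm q \<le> exp (- 2 * pi) \<and> q \<noteq> 0"
      unfolding eventually_at by (intro exI[of _ "exp (- 2 * pi)"]) auto
    thus "\<forall>\<^sub>F q in at 0. norm ((q - 0) * H q) \<le> C0 * norm q - K / (2 * pi) * (norm q * ln (norm q))"
    proof eventually_elim
      case (elim q)
      hence "ln (norm q) \<le> ln (exp (- 2 * pi))" by (subst ln_le_cancel_iff) auto
      hence "Im (\<tau> q) \<ge> 1" using elim by (simp add: Im_\<tau> field_simps)
      hence "norm (H q) \<le> C0 + K * (- ln (norm q) / (2 * pi))"
        using growth[of "\<tau> q"] elim by (simp add: H_def Im_\<tau>)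
      hence "norm q * norm (H q) \<le> norm q * (C0 + K * (- ln (norm q) / (2 * pi)))"
        by (rule mult_left_mono) simp
      thus ?case by (simp add: norm_mult algebra_simps)
    qed
    have "((\<lambda>x::real. C0 * x - K / (2 * pi) * (x * ln x)) \<longlongrightarrow> C0 * 0 - K / (2 * pi) * 0) (at_right 0)"
    proof (intro tendsto_intros)
      show "((\<lambda>x::real. x * ln x) \<longlongrightarrow> 0) (at_right 0)" by real_asymp
    qed
    moreover have "filterlim (norm :: complex \<Rightarrow> real) (at_right 0) (at 0)"
      by (auto simp: filterlim_at eventually_at_filter intro!: tendsto_norm_zero)
    ultimately show "((\<lambda>q::complex. C0 * norm q - K / (2 * pi) * (norm q * ln (norm q))) \<longlongrightarrow> 0) (at 0)"
      using filterlim_compose[of "\<lambda>x::real. C0 * x - K / (2 * pi) * (x * ln x)" "nhds 0" "at_right 0" norm "at 0"] by simp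
  qed
  ultimately obtain h where h: "h holomorphic_on ball 0 1" and hH: "\<And>q. q \<in> ball 0 1 - {0} \<Longrightarrow> h q = H q"
    using holomorphic_on_extend_lim[of H "ball 0 1" 0] by (auto simp: interior_open)
  have hG: "h (exp (2 * pi * \<i> * z)) = G z" "norm (exp (2 * pi * \<i> * z)) = exp (- 2 * pi * Im z)"
    if "z \<in> upper_half" for z
  proof -
    show n: "norm (exp (2 * pi * \<i> * z)) = exp (- 2 * pi * Im z)" by simp
    have "exp (2 * pi * \<i> * z) \<in> ball 0 1 - {0}" using that n by (simp add: upper_half_def)
    thus "h (exp (2 * pi * \<i> * z)) = G z"
      using hH that exp_\<tau> \<tau>_upper unfolding H_def by (auto intro!: G_eq)
  qed
  define r where "r = exp (- pi)"
  have r: "0 < r" "r < 1" by (auto simp: r_def)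
  have "continuous_on (cball 0 r) (\<lambda>q. norm (h q))"
    using r by (intro continuous_intros holomorphic_on_imp_continuous_on holomorphic_on_subset[OF h]) auto
  moreover have "cball (0::complex) r \<noteq> {}" using r by simp
  ultimately obtain q1 where q1: "q1 \<in> cball 0 r" "\<And>q. q \<in> cball 0 r \<Longrightarrow> norm (h q) \<le> norm (h q1)"
    using continuous_attains_sup[OF compact_cball] by metis
  obtain q2 where q2: "q2 \<in> ball 0 r" "h q2 = h q1"
  proof (cases "norm q1 < r")
    case True
    thus ?thesis by (intro that[of q1]) auto
  next
    case False
    hence n1: "norm q1 = r" using q1(1) by auto
    hence q1': "q1 \<in> ball 0 1 - {0}" using r by auto
    define w where "w = \<tau> q1 - of_int (round (Re (\<tau> q1)))"
    have "Im w = 1 / 2" using Im_\<tau>[of q1] q1' n1 by (simp add: w_def r_def)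
    hence w: "w \<in> upper_half" by (simp add: upper_half_def)
    have "\<bar>Re w\<bar> \<le> 1 / 2" using of_int_round_abs_le[of "Re (\<tau> q1)"] by (simp add: w_def abs_minus_commute)
    hence "(Re w)\<^sup>2 \<le> (1 / 2)\<^sup>2" by (metis abs_ge_zero power2_abs power_mono)
    hence "(norm w)\<^sup>2 \<le> 1 / 2" unfolding cmod_power2 \<open>Im w = 1 / 2\<close> by (simp add: power2_eq_square)
    moreover have "(norm w)\<^sup>2 > 0" using w by (auto simp: upper_half_def)
    ultimately have Im1: "Im (- 1 / w) \<ge> 1" unfolding Im_minus_inverse \<open>Im w = 1 / 2\<close> by (simp add: field_simps)
    have "h q1 = G (\<tau> q1)" using hH[OF q1'] by (simp add: H_def)
    also have "\<dots> = G w" using GTi[OF w, of "round (Re (\<tau> q1))"] by (simp add: w_def)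
    also have "\<dots> = G (- 1 / w)" using GS[OF w] by simp
    also have "\<dots> = h (exp (2 * pi * \<i> * (- 1 / w)))" using hG(1)[OF upper_half_S[OF w]] by simp
    finally have "h (exp (2 * pi * \<i> * (- 1 / w))) = h q1" by simp
    moreover have "norm (exp (2 * pi * \<i> * (- 1 / w))) < r"
    proof -
      have "2 * pi * 1 \<le> 2 * pi * Im (- 1 / w)" using Im1 by (intro mult_left_mono) auto
      hence "- 2 * pi * Im (- 1 / w) < - pi" using pi_gt_zero by linarith
      thus ?thesis unfolding hG(2)[OF upper_half_S[OF w]] r_def by (simp only: exp_less_cancel_iff)
    qed
    ultimately show ?thesis by (intro that[of "exp (2 * pi * \<i> * (- 1 / w))"]) (simp_all only: mem_ball_0)
  qed
  have "h constant_on ball 0 1"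
  proof (rule maximum_modulus_principle[OF h, where U = "ball 0 r" and \<xi> = q2])
    show "norm (h q) \<le> norm (h q2)" if "q \<in> ball 0 r" for q
      using q1(2)[of q] that q2(2) by simp
  qed (use r q2 in auto)
  then obtain c where c: "\<And>q. q \<in> ball 0 1 \<Longrightarrow> h q = c" by (auto simp: constant_on_def)
  have Gc: "G w = c" if "w \<in> upper_half" for w
  proof -
    have "exp (2 * pi * \<i> * w) \<in> ball 0 1" using hG(2)[OF that] that by (simp add: upper_half_def)
    thus ?thesis using hG(1)[OF that] c by simp
  qed
  have "\<forall>\<^sub>F w in nhds z. w \<in> upper_half" using upper_half(1) z by (rule eventually_nhds_in_open)
  hence "\<forall>\<^sub>F w in nhds z. G w = c" by eventually_elim (rule Gc)
  hence "(G has_field_derivative 0) (at z) \<longleftrightarrow> ((\<lambda>_. c) has_field_derivative 0) (at z)"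
    by (intro DERIV_cong_ev) auto
  hence "(G has_field_derivative 0) (at z)" by simp
  hence "g z = 0" using G[OF z] DERIV_unique by blast
  thus ?thesis using D_nz[OF z] by (simp add: g_def)
qed

section \<open>A zero-free modular form of weight 12\<close>

text \<open>
  The product of two absolutely convergent sums as a sum over pairs.
\<close>

lemma infsum_mult_infsum:
  fixes f :: "'i \<Rightarrow> complex" and g :: "'j \<Rightarrow> complex"
  assumes f: "(\<lambda>i. norm (f i)) summable_on A" and g: "(\<lambda>j. norm (g j)) summable_on B"
  shows "((\<lambda>(i, j). f i * g j) has_sum (infsum f A * infsum g B)) (A \<times> B)"
    and "(\<lambda>p. norm ((\<lambda>(i, j). f i * g j) p)) summable_on (A \<times> B)"
proof -
  show s: "(\<lambda>p. norm ((\<lambda>(i, j). f i * g j) p)) summable_on (A \<times> B)"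
  proof (rule Infinite_Sum.abs_summable_on_Sigma_iff[THEN iffD2], intro conjI ballI)
    show "(\<lambda>j. norm ((\<lambda>(i, j). f i * g j) (i, j))) summable_on B" for i
      using g by (simp add: norm_mult summable_on_cmult_right)
    show "(\<lambda>i. norm (\<Sum>\<^sub>\<infinity>j\<in>B. norm ((\<lambda>(i, j). f i * g j) (i, j)))) summable_on A"
      using f by (simp add: norm_mult infsum_cmult_right' summable_on_cmult_left infsum_nonneg abs_mult)
  qed
  have "infsum (\<lambda>(i, j). f i * g j) (A \<times> B) = (\<Sum>\<^sub>\<infinity>i\<in>A. \<Sum>\<^sub>\<infinity>j\<in>B. f i * g j)"
    using infsum_Sigma'_banach[OF abs_summable_summable[OF s]] by simp
  also have "\<dots> = infsum f A * infsum g B"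
    by (simp add: infsum_cmult_right' infsum_cmult_left')
  finally show "((\<lambda>(i, j). f i * g j) has_sum (infsum f A * infsum g B)) (A \<times> B)"
    using has_sum_infsum[OF abs_summable_summable[OF s]] by simp
qed

text \<open>
  \<open>q\<^bsup>r/2\<^esup>\<close> for \<open>q = exp(2\<pi>iz)\<close>, with the branch given
  by \<open>z\<close>.
\<close>

definition qexp :: "real \<Rightarrow> complex \<Rightarrow> complex" where
  "qexp r z = exp (\<i> * of_real (pi * r) * z)"

lemma qexp_add: "qexp (r + s) z = qexp r z * qexp s z"
  by (simp add: qexp_def exp_add[symmetric] algebra_simps)

lemma norm_qexp: "norm (qexp r z) = exp (- pi * Im z * r)"
  using exp_series_bound[of 1 r z] by (simp add: qexp_def)

definition alt_sign :: "int \<Rightarrow> complex" where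
  "alt_sign n = (if even n then 1 else - 1)"

lemma norm_alt_sign [simp]: "norm (alt_sign n) = 1"
  by (simp add: alt_sign_def)

definition theta3 :: "complex \<Rightarrow> complex" where
  "theta3 z = (\<Sum>\<^sub>\<infinity>n::int. 1 * qexp ((of_int n)\<^sup>2) z)"
definition theta4 :: "complex \<Rightarrow> complex" where
  "theta4 z = (\<Sum>\<^sub>\<infinity>n::int. alt_sign n * qexp ((of_int n)\<^sup>2) z)"
definition theta2 :: "complex \<Rightarrow> complex" where
  "theta2 z = (\<Sum>\<^sub>\<infinity>n::int. 1 * qexp ((of_int n + 1 / 2)\<^sup>2) z)"

lemma shifted_gaussian_summable:
  assumes y: "y > 0"
  shows "(\<lambda>n::int. exp (- pi * y * (of_int n + 1 / 2)\<^sup>2) :: real) summable_on UNIV"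
proof -
  have "(\<lambda>n::int. exp (pi * y / 4) * exp (- (pi * y / 2) * (of_int n)\<^sup>2) :: real) summable_on UNIV"
    using y by (intro summable_on_cmult_right int_gaussian_summable) auto
  thus ?thesis
  proof (rule summable_on_comparison_test)
    fix n :: int
    have "(real_of_int n)\<^sup>2 \<le> 2 * (of_int n + 1 / 2)\<^sup>2 + 1 / 2"
      using zero_le_power2[of "real_of_int n + 1"] by (simp add: power2_eq_square algebra_simps)
    hence "pi * y / 2 * (real_of_int n)\<^sup>2 \<le> pi * y / 2 * (2 * (of_int n + 1 / 2)\<^sup>2 + 1 / 2)"
      using y by (intro mult_left_mono) auto
    thus "exp (- pi * y * (of_int n + 1 / 2)\<^sup>2) \<le> exp (pi * y / 4) * exp (- (pi * y / 2) * (of_int n)\<^sup>2)"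
      by (simp add: exp_add[symmetric] algebra_simps)
  qed auto
qed

lemma theta_abs_summable:
  assumes "z \<in> upper_half"
  shows "(\<lambda>n::int. norm (1 * qexp ((of_int n)\<^sup>2) z)) summable_on UNIV"
    "(\<lambda>n::int. norm (alt_sign n * qexp ((of_int n)\<^sup>2) z)) summable_on UNIV"
    "(\<lambda>n::int. norm (1 * qexp ((of_int n + 1 / 2)\<^sup>2) z)) summable_on UNIV"
  using assms int_gaussian_summable[of "pi * Im z"] shifted_gaussian_summable[of "Im z"]
  by (auto simp: norm_mult norm_qexp upper_half_def)

lemma theta_holomorphic:
  "theta3 holomorphic_on upper_half" "theta4 holomorphic_on upper_half" "theta2 holomorphic_on upper_half"
  unfolding theta3_def[abs_def] theta4_def[abs_def] theta2_def[abs_def] qexp_def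
  by (rule exp_series_holomorphic; use int_gaussian_summable shifted_gaussian_summable in simp)+

lemma cis_int_pi: "cis (pi * of_int n) = alt_sign n"
  by (simp add: complex_eq_iff alt_sign_def cos_npi_int sin_npi_int)

lemma exp_pi_square: "exp (\<i> * of_real (pi * (of_int n)\<^sup>2)) = alt_sign n"
proof -
  have "exp (\<i> * of_real (pi * (of_int n)\<^sup>2)) = cis (pi * of_int (n\<^sup>2))" by (simp add: cis_conv_exp)
  thus ?thesis unfolding cis_int_pi by (simp add: alt_sign_def)
qed

lemma theta_T:
  "theta3 (z + 1) = theta4 z" "theta4 (z + 1) = theta3 z" "theta2 (z + 1) = exp (\<i> * of_real (pi / 4)) * theta2 z"
proof -
  have q: "qexp r (z + 1) = exp (\<i> * of_real (pi * r)) * qexp r z" for r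
    by (simp add: qexp_def exp_add[symmetric] algebra_simps)
  have sq: "alt_sign n * alt_sign n = 1" for n by (simp add: alt_sign_def)
  show "theta3 (z + 1) = theta4 z" "theta4 (z + 1) = theta3 z"
    unfolding theta3_def theta4_def q exp_pi_square mult.assoc[symmetric] sq by simp_all
  have "exp (\<i> * of_real (pi * (of_int n + 1 / 2)\<^sup>2)) = exp (\<i> * of_real (pi / 4))" for n :: int
  proof -
    have "pi * (of_int n + 1 / 2)\<^sup>2 = pi / 4 + pi * of_int (n * (n + 1))"
      by (simp add: power2_eq_square algebra_simps)
    hence "complex_of_real (pi * (of_int n + 1 / 2)\<^sup>2) = of_real (pi / 4) + of_real (pi * of_int (n * (n + 1)))"
      by (simp only: of_real_add)
    hence "exp (\<i> * of_real (pi * (of_int n + 1 / 2)\<^sup>2)) = exp (\<i> * of_real (pi / 4)) * cis (pi * of_int (n * (n + 1)))"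
      by (simp add: cis_conv_exp distrib_left exp_add)
    moreover have "cis (pi * of_int (n * (n + 1))) = 1"
      unfolding cis_int_pi by (simp add: alt_sign_def)
    ultimately show ?thesis by simp
  qed
  thus "theta2 (z + 1) = exp (\<i> * of_real (pi / 4)) * theta2 z"
    unfolding theta2_def q mult_1_left by (simp add: infsum_cmult_right')
qed

lemma theta_S_axis:
  assumes t: "t > 0"
  shows "theta3 (\<i> * of_real (1 / t)) = of_real (sqrt t) * theta3 (\<i> * of_real t)"
    and "theta4 (\<i> * of_real (1 / t)) = of_real (sqrt t) * theta2 (\<i> * of_real t)"
    and "theta2 (\<i> * of_real (1 / t)) = of_real (sqrt t) * theta4 (\<i> * of_real t)"
proof -
  have q: "qexp r (\<i> * of_real t) = of_real (exp (- pi * t * r))" for r t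
  proof -
    have "\<i> * of_real (pi * r) * (\<i> * of_real t) = of_real (- pi * t * r)" by (simp add: mult_ac)
    thus ?thesis unfolding qexp_def by (simp only: exp_of_real)
  qed
  have c: "cis (2 * pi * (of_int n * (1 / 2))) = alt_sign n" for n
  proof -
    have "2 * pi * (of_int n * (1 / 2)) = pi * of_int n" by simp
    thus ?thesis by (simp only: cis_int_pi)
  qed
  have s: "of_real (sqrt t) * of_real (1 / sqrt t) = (1 :: complex)"
    using t by (simp flip: of_real_mult)
  note tr = theta_transform_real
  have a: "theta3 (\<i> * of_real t) = of_real (1 / sqrt t) * theta3 (\<i> * of_real (1 / t))" if "t > 0" for t
    using tr[OF that, of 0] unfolding theta3_def q by simp
  have b: "theta2 (\<i> * of_real t) = of_real (1 / sqrt t) * theta4 (\<i> * of_real (1 / t))" if "t > 0" for t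
    using tr[OF that, of "1 / 2"] unfolding theta2_def theta4_def q c by (simp add: mult.commute)
  show "theta3 (\<i> * of_real (1 / t)) = of_real (sqrt t) * theta3 (\<i> * of_real t)"
    unfolding a[OF t] mult.assoc[symmetric] s by simp
  show "theta4 (\<i> * of_real (1 / t)) = of_real (sqrt t) * theta2 (\<i> * of_real t)"
    unfolding b[OF t] mult.assoc[symmetric] s by simp
  show "theta2 (\<i> * of_real (1 / t)) = of_real (sqrt t) * theta4 (\<i> * of_real t)"
    using b[of "1 / t"] t by (simp add: real_sqrt_divide)
qed

text \<open>
  In the eighth power the square root of \<open>t\<close> becomes \<open>t\<^sup>4 =
  (it)\<^sup>4\<close>, and no branch has to be chosen.
\<close>

lemma pow8_transform:
  assumes hol: "f holomorphic_on upper_half" "g holomorphic_on upper_half"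
    and eq: "\<And>t. t > 0 \<Longrightarrow> f (\<i> * of_real (1 / t)) = of_real (sqrt t) * g (\<i> * of_real t)"
    and z: "z \<in> upper_half"
  shows "f (- 1 / z) ^ 8 = z ^ 4 * g z ^ 8"
proof (rule upper_half_eq_if_imag_axis_eq[OF _ _ _ z])
  have "(f \<circ> (\<lambda>z. - 1 / z)) holomorphic_on upper_half"
  proof (rule holomorphic_on_compose_gen[OF _ hol(1)])
    show "(\<lambda>z. - 1 / z) holomorphic_on upper_half"
      by (intro holomorphic_intros) (auto simp: upper_half_def)
    show "(\<lambda>z. - 1 / z) ` upper_half \<subseteq> upper_half" using upper_half_S by blast
  qed
  thus "(\<lambda>z. f (- 1 / z) ^ 8) holomorphic_on upper_half" by (intro holomorphic_intros) (simp add: o_def)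
  show "(\<lambda>z. z ^ 4 * g z ^ 8) holomorphic_on upper_half" by (intro holomorphic_intros hol)
  fix t :: real assume t: "t > 0"
  have "- 1 / (\<i> * of_real t) = \<i> * of_real (1 / t)" using t by (simp add: field_simps)
  moreover have "sqrt t ^ 8 = t ^ 4"
    using t power_mult[of "sqrt t" 2 4] by simp
  hence "complex_of_real (sqrt t) ^ 8 = of_real t ^ 4" by (simp flip: of_real_power)
  ultimately show "f (- 1 / (\<i> * of_real t)) ^ 8 = (\<i> * of_real t) ^ 4 * g (\<i> * of_real t) ^ 8"
    using eq[OF t] by (simp add: power_mult_distrib)
qed

lemma theta_S:
  assumes z: "z \<in> upper_half"
  shows "theta3 (- 1 / z) ^ 8 = z ^ 4 * theta3 z ^ 8"
    and "theta4 (- 1 / z) ^ 8 = z ^ 4 * theta2 z ^ 8"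
    and "theta2 (- 1 / z) ^ 8 = z ^ 4 * theta4 z ^ 8"
  by (rule pow8_transform[OF _ _ _ z]; fact theta_holomorphic theta_S_axis)+

text \<open>
  The product is the sum of \<open>(-1)\<^sup>b q\<^bsup>(a\<^sup>2+b\<^sup>2)/2\<^esup>\<close>
  over pairs of integers. Pairs of different parity cancel under \<open>(a,b) \<mapsto>
  (b,a)\<close>; pairs of equal parity are \<open>(c+d, c-d)\<close> with
  \<open>a\<^sup>2+b\<^sup>2 = 2c\<^sup>2+2d\<^sup>2\<close>.
\<close>

lemma theta34_product:
  assumes z: "z \<in> upper_half"
  shows "theta3 z * theta4 z = theta4 (2 * z) ^ 2"
proof -
  have z2: "2 * z \<in> upper_half" using z by (simp add: upper_half_def)
  let ?q = "\<lambda>n::int. qexp ((of_int n)\<^sup>2)"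
  define F where "F = (\<lambda>(a, b). 1 * ?q a z * (alt_sign b * ?q b z))"
  have F: "(F has_sum (theta3 z * theta4 z)) (UNIV \<times> UNIV)" "(\<lambda>p. norm (F p)) summable_on (UNIV \<times> UNIV)"
    unfolding F_def theta3_def theta4_def
    by (rule infsum_mult_infsum[OF theta_abs_summable(1,2)[OF z]])+
  define ev where "ev = {(a, b). even (a + b :: int)}"
  define od where "od = {(a, b). odd (a + b :: int)}"
  have F_sub: "F summable_on X" for X
    using abs_summable_summable[OF summable_on_subset_banach[OF F(2)]] by simp
  have "infsum F (ev \<union> od) = infsum F ev + infsum F od"
    by (rule infsum_Un_disjoint[OF F_sub F_sub]) (auto simp: ev_def od_def)
  moreover have "ev \<union> od = UNIV \<times> UNIV" by (auto simp: ev_def od_def)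
  moreover have "infsum F od = 0"
  proof -
    have "bij_betw prod.swap od od"
      by (rule bij_betwI[of _ _ _ prod.swap]) (auto simp: od_def add.commute)
    hence "infsum F od = (\<Sum>\<^sub>\<infinity>p\<in>od. F (prod.swap p))"
      by (rule infsum_reindex_bij_betw[symmetric])
    also have "\<dots> = (\<Sum>\<^sub>\<infinity>p\<in>od. - F p)"
      by (intro infsum_cong) (auto simp: F_def od_def alt_sign_def)
    also have "\<dots> = - infsum F od" by (rule infsum_uminus)
    finally show ?thesis by simp
  qed
  moreover have "infsum F ev = theta4 (2 * z) ^ 2"
  proof -
    have half: "(a + b) div 2 + (a - b) div 2 = a" "(a + b) div 2 - (a - b) div 2 = b"
      if "even a \<longleftrightarrow> even b" for a b :: int
    proof -
      have "2 * ((a + b) div 2) = a + b" "2 * ((a - b) div 2) = a - b" using that by auto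
      thus "(a + b) div 2 + (a - b) div 2 = a" "(a + b) div 2 - (a - b) div 2 = b" by linarith+
    qed
    have "bij_betw (\<lambda>(c, d). (c + d, c - d)) UNIV ev"
      by (rule bij_betwI[of _ _ _ "\<lambda>(a, b). ((a + b) div 2, (a - b) div 2)"]) (auto simp: ev_def intro: half)
    hence "infsum F ev = (\<Sum>\<^sub>\<infinity>p. F ((\<lambda>(c, d). (c + d, c - d)) p))"
      by (rule infsum_reindex_bij_betw[symmetric])
    also have "\<dots> = (\<Sum>\<^sub>\<infinity>p\<in>UNIV \<times> UNIV. (\<lambda>(c, d). alt_sign c * ?q c (2 * z) * (alt_sign d * ?q d (2 * z))) p)"
    proof (rule infsum_cong_neutral)
      fix p :: "int \<times> int"
      obtain c d where p: "p = (c, d)" by (cases p)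
      have d: "qexp r (2 * z) = qexp (2 * r) z" for r by (simp add: qexp_def mult_ac)
      have "(real_of_int (c + d))\<^sup>2 + (of_int (c - d))\<^sup>2 = 2 * (of_int c)\<^sup>2 + 2 * (of_int d)\<^sup>2"
        by (simp add: power2_eq_square algebra_simps)
      moreover have "alt_sign (c - d) = alt_sign c * alt_sign d" by (simp add: alt_sign_def)
      ultimately show "F ((\<lambda>(c, d). (c + d, c - d)) p) = (\<lambda>(c, d). alt_sign c * ?q c (2 * z) * (alt_sign d * ?q d (2 * z))) p"
        unfolding p F_def d by (simp add: qexp_add[symmetric] mult_ac)
    qed auto
    also have "\<dots> = theta4 (2 * z) * theta4 (2 * z)"
      unfolding theta4_def by (rule infsumI, rule infsum_mult_infsum(1)[OF theta_abs_summable(2,2)[OF z2]])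
    finally show ?thesis by (simp add: power2_eq_square)
  qed
  ultimately show ?thesis using F(1) by (simp add: infsumI)
qed


text \<open>
  Both tails of the sum are at most \<open>\<Sum>\<^sub>k (1/4)\<^sup>k = 1/3\<close>, \<open>k
  \<ge> 1\<close>. The central part has one term for \<open>c = 1\<close>
  (\<open>\<theta>\<^sub>3\<close>, \<open>\<theta>\<^sub>4\<close>) and two for \<open>c =
  2\<close> (\<open>\<theta>\<^sub>2\<close>).
\<close>

lemma geometric_tails_bound:
  fixes f :: "int \<Rightarrow> complex" and c :: int
  assumes f: "(\<lambda>n. norm (f n)) summable_on UNIV" and c: "c \<ge> 1" and r: "0 \<le> r" "r \<le> 1 / 4"
    and pos: "\<And>k::nat. norm (f (int k + 1)) \<le> r ^ Suc k"
    and neg: "\<And>k::nat. norm (f (- int k - c)) \<le> r ^ Suc k"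
  shows "norm (infsum f UNIV - (\<Sum>n\<in>{1 - c..0}. f n)) \<le> 2 / 3"
proof -
  have sub: "(\<lambda>n. norm (f n)) summable_on X" for X
    by (rule summable_on_subset_banach[OF f]) simp
  have fs: "f summable_on X" for X
    by (rule abs_summable_summable[OF sub])
  have geo: "((\<lambda>k. r ^ Suc k) has_sum (r / (1 - r))) UNIV"
  proof (rule sums_nonneg_imp_has_sum)
    show "(\<lambda>k. r ^ Suc k) sums (r / (1 - r))"
      using sums_mult[OF geometric_sums[of r], of r] r by simp
  qed (use r in simp)
  have geo_le: "r / (1 - r) \<le> 1 / 3" using r by (simp add: field_simps)
  have tail: "norm (infsum f (range g)) \<le> 1 / 3" if g: "inj g" "\<And>k::nat. norm (f (g k)) \<le> r ^ Suc k" for g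
  proof -
    have s: "(\<lambda>k. norm (f (g k))) summable_on UNIV"
      using sub[of "range g"] summable_on_reindex[OF g(1), of "\<lambda>n. norm (f n)"] by (simp add: o_def)
    have "norm (infsum f (range g)) = norm (\<Sum>\<^sub>\<infinity>k. f (g k))"
      using infsum_reindex[OF g(1), of f] by (simp add: o_def)
    also have "\<dots> \<le> (\<Sum>\<^sub>\<infinity>k. norm (f (g k)))" by (rule norm_infsum_bound[OF s])
    also have "\<dots> \<le> (\<Sum>\<^sub>\<infinity>k. r ^ Suc k)"
      by (rule infsum_mono[OF s has_sum_imp_summable[OF geo] g(2)])
    also have "\<dots> = r / (1 - r)" by (rule infsumI[OF geo])
    also note geo_le
    finally show ?thesis .
  qed
  define U where "U = range (\<lambda>k. int k + 1)"
  define V where "V = range (\<lambda>k. - int k - c)"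
  have U: "n \<in> U \<longleftrightarrow> n \<ge> 1" for n
    unfolding U_def by (auto intro!: image_eqI[of _ _ "nat (n - 1)"])
  have V: "n \<in> V \<longleftrightarrow> n \<le> - c" for n
    unfolding V_def by (auto intro!: image_eqI[of _ _ "nat (- n - c)"])
  have "infsum f ({1 - c..0} \<union> (U \<union> V)) = infsum f {1 - c..0} + infsum f (U \<union> V)"
    by (rule infsum_Un_disjoint[OF fs fs]) (use c in \<open>auto simp: U V\<close>)
  also have "infsum f (U \<union> V) = infsum f U + infsum f V"
    by (rule infsum_Un_disjoint[OF fs fs]) (use c in \<open>auto simp: U V\<close>)
  also have "{1 - c..0} \<union> (U \<union> V) = UNIV" by (auto simp: U V)
  finally have "infsum f UNIV - (\<Sum>n\<in>{1 - c..0}. f n) = infsum f U + infsum f V" by simp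
  moreover have "norm (infsum f U) \<le> 1 / 3" "norm (infsum f V) \<le> 1 / 3"
    unfolding U_def V_def using pos neg by (intro tail; simp add: inj_def)+
  ultimately show ?thesis using norm_triangle_ineq[of "infsum f U" "infsum f V"] by simp
qed

lemma exp_minus_pi_le: "exp (- pi) \<le> 1 / 4"
proof -
  have "4 \<le> exp pi" using exp_ge_add_one_self[of pi] pi_gt3 by linarith
  hence "1 / exp pi \<le> 1 / 4" by (intro divide_left_mono) auto
  thus ?thesis by (simp add: exp_minus inverse_eq_divide)
qed

lemma norm_qexp_le_geometric:
  assumes "Im z \<ge> 1" "r \<ge> real (Suc k)"
  shows "norm (qexp r z) \<le> exp (- pi) ^ Suc k"
proof -
  have "real (Suc k) * 1 \<le> r * Im z" using assms by (intro mult_mono) auto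
  hence "pi * real (Suc k) \<le> pi * (r * Im z)" by simp
  thus ?thesis unfolding norm_qexp exp_of_nat_mult[symmetric] by (simp add: mult_ac)
qed

lemma square_ge_self: "real (Suc k) \<le> (real (Suc k))\<^sup>2"
  by (simp add: power2_eq_square)

lemma theta34_near_1:
  assumes z: "Im z \<ge> 1"
  shows "norm (theta3 z - 1) \<le> 2 / 3" "norm (theta4 z - 1) \<le> 2 / 3"
proof -
  have up: "z \<in> upper_half" using z by (simp add: upper_half_def)
  have sq: "(real_of_int (int k + 1))\<^sup>2 = (real (Suc k))\<^sup>2" "(real_of_int (- int k - 1))\<^sup>2 = (real (Suc k))\<^sup>2" for k
    by (simp_all add: power2_eq_square algebra_simps)
  have b: "norm (qexp ((real (Suc k))\<^sup>2) z) \<le> exp (- pi) ^ Suc k" for k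
    by (rule norm_qexp_le_geometric[OF z square_ge_self])
  show "norm (theta3 z - 1) \<le> 2 / 3"
    using geometric_tails_bound[OF theta_abs_summable(1)[OF up], of 1 "exp (- pi)"] exp_minus_pi_le b
    by (simp add: theta3_def sq qexp_def[of 0] of_nat_Suc[of 0] del: power_Suc of_nat_Suc of_int_add of_int_diff)
  show "norm (theta4 z - 1) \<le> 2 / 3"
    using geometric_tails_bound[OF theta_abs_summable(2)[OF up], of 1 "exp (- pi)"] exp_minus_pi_le b
    by (simp add: theta4_def sq norm_mult qexp_def[of 0] alt_sign_def[of 0] of_nat_Suc[of 0] del: power_Suc of_nat_Suc of_int_add of_int_diff)
qed

lemma theta34_lower_bound:
  assumes "Im z \<ge> 1"
  shows "norm (theta3 z) \<ge> 1 / 3" "norm (theta4 z) \<ge> 1 / 3"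
  using theta34_near_1[OF assms] norm_triangle_ineq2[of 1 "1 - theta3 z"] norm_triangle_ineq2[of 1 "1 - theta4 z"]
  by (simp_all add: norm_minus_commute)

text \<open>
  By \<open>theta34_product\<close> a zero of \<open>\<theta>\<^sub>3\<close> or
  \<open>\<theta>\<^sub>4\<close> at \<open>z\<close> is a zero of \<open>\<theta>\<^sub>4\<close>
  at \<open>2z\<close>; after finitely many doublings the imaginary part is at least 1, where
  \<open>\<theta>\<^sub>4\<close> is close to 1.
\<close>

lemma theta34_nonzero:
  assumes "z \<in> upper_half"
  shows "theta3 z \<noteq> 0 \<and> theta4 z \<noteq> 0"
proof -
  have y: "Im z > 0" using assms by (simp add: upper_half_def)
  obtain k :: nat where k: "1 / Im z < 2 ^ k"
    using real_arch_pow[of 2 "1 / Im z"] by auto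
  hence "2 ^ k * Im z \<ge> 1" using y by (simp add: field_simps)
  thus ?thesis using assms
  proof (induction k arbitrary: z)
    case 0
    hence "Im z \<ge> 1" by simp
    from theta34_lower_bound[OF this] show ?case by auto
  next
    case (Suc k)
    have "2 ^ k * Im (2 * z) \<ge> 1" using Suc.prems(1) by (simp add: mult_ac)
    moreover have "2 * z \<in> upper_half" using Suc.prems(2) by (simp add: upper_half_def)
    ultimately have "theta4 (2 * z) \<noteq> 0" using Suc.IH by blast
    thus ?case using theta34_product[OF Suc.prems(2)] by auto
  qed
qed

text \<open>
  \<open>\<theta>\<^sub>2\<close> is a transform of \<open>\<theta>\<^sub>4\<close>.
\<close>

lemma theta2_nonzero:
  assumes z: "z \<in> upper_half"
  shows "theta2 z \<noteq> 0"
  using theta_S(2)[OF z] theta34_nonzero[OF upper_half_S[OF z]] by auto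

lemma theta2_lower_bound:
  assumes z: "Im z \<ge> 1"
  shows "norm (theta2 z) \<ge> 4 / 3 * exp (- pi * Im z / 4)"
proof -
  have up: "z \<in> upper_half" using z by (simp add: upper_half_def)
  define f where "f n = qexp (of_int (n * (n + 1))) z" for n :: int
  have f: "1 * qexp ((of_int n + 1 / 2)\<^sup>2) z = qexp (1 / 4) z * f n" for n
  proof -
    have "(real_of_int n + 1 / 2)\<^sup>2 = 1 / 4 + of_int (n * (n + 1))"
      by (simp add: power2_eq_square algebra_simps)
    thus ?thesis by (simp only: f_def qexp_add mult_1_left)
  qed
  have nz: "norm (qexp (1 / 4) z) \<noteq> 0" by (simp add: norm_qexp)
  have "(\<lambda>n. norm (qexp (1 / 4) z) * norm (f n)) summable_on UNIV"
    using theta_abs_summable(3)[OF up] unfolding f norm_mult .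
  hence fs: "(\<lambda>n. norm (f n)) summable_on UNIV"
    using nz summable_on_cmult_right'[of "norm (qexp (1 / 4) z)"] by blast
  have eq: "(int k + 1) * (int k + 1 + 1) = int (Suc k * Suc (Suc k))"
    "(- int k - 2) * (- int k - 2 + 1) = int (Suc k * Suc (Suc k))" for k
    by (simp_all add: algebra_simps)
  have b: "norm (qexp (of_int (int (Suc k * Suc (Suc k)))) z) \<le> exp (- pi) ^ Suc k" for k
    by (rule norm_qexp_le_geometric[OF z]) (simp del: of_nat_Suc of_nat_mult)
  have "norm (infsum f UNIV - (\<Sum>n\<in>{1 - 2..0}. f n)) \<le> 2 / 3"
    by (rule geometric_tails_bound[OF fs, of 2 "exp (- pi)"])
      (use exp_minus_pi_le b in \<open>simp_all only: f_def eq\<close>, simp_all)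
  moreover have "(\<Sum>n\<in>{1 - 2..0}. f n) = 2"
  proof -
    have "{1 - 2..0::int} = {-1, 0}" by auto
    thus ?thesis by (simp add: f_def qexp_def)
  qed
  ultimately have "norm (infsum f UNIV) \<ge> 4 / 3"
    using norm_triangle_ineq2[of 2 "2 - infsum f UNIV"] by (simp add: norm_minus_commute)
  moreover have "theta2 z = qexp (1 / 4) z * infsum f UNIV"
    unfolding theta2_def f by (rule infsum_cmult_right')
  hence "norm (theta2 z) = exp (- pi * Im z / 4) * norm (infsum f UNIV)"
    by (simp add: norm_mult norm_qexp)
  ultimately show ?thesis by (simp add: mult.commute)
qed

text \<open>
  This is 256 times the modular discriminant \<open>\<Delta>\<close>.
\<close>

definition theta_disc :: "complex \<Rightarrow> complex" where
  "theta_disc z = theta2 z ^ 8 * theta3 z ^ 8 * theta4 z ^ 8"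

lemma theta_disc_holomorphic: "theta_disc holomorphic_on upper_half"
  unfolding theta_disc_def[abs_def] by (intro holomorphic_intros theta_holomorphic)

lemma theta_disc_nonzero: "z \<in> upper_half \<Longrightarrow> theta_disc z \<noteq> 0"
  using theta34_nonzero theta2_nonzero by (simp add: theta_disc_def)

lemma theta_disc_T: "theta_disc (z + 1) = theta_disc z"
proof -
  have "exp (\<i> * of_real (pi / 4)) ^ 8 = 1"
    unfolding cis_conv_exp[symmetric] Complex.DeMoivre by simp
  thus ?thesis by (simp add: theta_disc_def theta_T power_mult_distrib mult_ac)
qed

lemma theta_disc_S: "z \<in> upper_half \<Longrightarrow> theta_disc (- 1 / z) = z ^ 12 * theta_disc z"
proof -
  assume z: "z \<in> upper_half"
  have "z ^ 12 = z ^ 4 * z ^ 4 * z ^ 4" by (simp flip: power_add)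
  thus ?thesis unfolding theta_disc_def theta_S[OF z] by (simp only: mult_ac)
qed

lemma theta_disc_lower_bound:
  assumes z: "Im z \<ge> 1"
  shows "norm (theta_disc z) \<ge> (4 / 27) ^ 8 * exp (- 2 * pi * Im z)"
proof -
  have "(4 / 27) ^ 8 * exp (- 2 * pi * Im z) = (4 / 3 * exp (- pi * Im z / 4)) ^ 8 * (1 / 3) ^ 8 * (1 / 3) ^ 8"
    unfolding power_mult_distrib exp_of_nat_mult[symmetric] by (simp add: field_simps)
  also have "\<dots> \<le> norm (theta2 z) ^ 8 * norm (theta3 z) ^ 8 * norm (theta4 z) ^ 8"
    using theta2_lower_bound[OF z] theta34_lower_bound[OF z]
    by (intro mult_mono power_mono) auto
  finally show ?thesis by (simp add: theta_disc_def norm_mult norm_power)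
qed

section \<open>Harmonic sums over the shells of an even unimodular lattice\<close>

text \<open>
  Weight: \<open>(it)\<^bsup>12m+2\<^esup> = -t\<^bsup>12m+2\<^esup>\<close>, which absorbs the
  sign in \<open>theta_transform_harmonic\<close>. Order at infinity: \<open>P(0) = 0\<close> and
  all other vectors have norm at least \<open>2m\<close>.
\<close>

lemma lattice_theta_vanishes:
  fixes L :: "'a::euclidean_space set"
  assumes L: "self_dual_lattice L" and P: "harmonic_quadratic P"
    and even: "\<And>x. x \<in> L \<Longrightarrow> \<exists>k::int. x \<bullet> x = 2 * of_int k"
    and dim: "DIM('a) = 24 * m"
    and min: "\<And>x. x \<in> L \<Longrightarrow> x \<noteq> 0 \<Longrightarrow> 2 * real m \<le> x \<bullet> x"
    and z: "z \<in> upper_half"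
  shows "((\<lambda>x. of_real (P x) * qexp ((norm x)\<^sup>2) z) has_sum 0) L"
proof -
  define f where "f z = (\<Sum>\<^sub>\<infinity>x\<in>L. of_real (P x) * qexp ((norm x)\<^sup>2) z)" for z
  have s: "(\<lambda>x. \<bar>P x\<bar> * exp (- pi * y * (norm x)\<^sup>2)) summable_on L" if y: "y > 0" for y
  proof -
    have "gauss_decay (\<lambda>x. of_real (P x * exp (- (pi * y) * (norm x)\<^sup>2)))"
      by (rule gauss_decay_quadratic[OF harmonic_quadratic_continuous[OF P] harmonic_quadratic_bound[OF P]])
        (use y in simp)
    from self_dual_gauss_decay_summable[OF L this] show ?thesis
      by (simp add: abs_mult del: of_real_mult)
  qed
  have s': "(\<lambda>x. norm (complex_of_real (P x)) * exp (- pi * y * (norm x)\<^sup>2)) summable_on L" if "y > 0" for y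
    using s[OF that] by simp
  have abs: "(\<lambda>x. norm (of_real (P x) * qexp ((norm x)\<^sup>2) z)) summable_on L" if "z \<in> upper_half" for z
    unfolding qexp_def by (rule exp_series_abs_summable[OF s' that])
  have hol: "f holomorphic_on upper_half"
    unfolding f_def[abs_def] qexp_def by (rule exp_series_holomorphic[OF s']) auto
  have T: "f (z + 1) = f z" for z
    unfolding f_def
  proof (rule infsum_cong)
    fix x assume "x \<in> L"
    then obtain k :: int where k: "(norm x)\<^sup>2 = 2 * of_int k" using even by (auto simp: power2_norm_eq_inner)
    have "qexp r (z + 1) = qexp r z * exp (\<i> * of_real (pi * r))" for r
      by (simp add: qexp_def exp_add[symmetric] algebra_simps)
    hence "qexp ((norm x)\<^sup>2) (z + 1) = qexp ((norm x)\<^sup>2) z * exp (\<i> * of_real (pi * (2 * of_int k)))"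
      using k by simp
    also have "exp (\<i> * of_real (pi * (2 * of_int k))) = 1"
      using cis_multiple_2pi[of "of_int k"] by (simp add: cis_conv_exp mult_ac)
    finally show "of_real (P x) * qexp ((norm x)\<^sup>2) (z + 1) = of_real (P x) * qexp ((norm x)\<^sup>2) z" by simp
  qed
  have axis: "f (\<i> * of_real t) = of_real (\<Sum>\<^sub>\<infinity>x\<in>L. P x * exp (- pi * t * (norm x)\<^sup>2))" if t: "t > 0" for t
  proof -
    have q: "of_real (P x) * qexp r (\<i> * of_real t) = of_real (P x * exp (- pi * t * r))" for x r
    proof -
      have "\<i> * of_real (pi * r) * (\<i> * of_real t) = of_real (- pi * t * r)" by (simp add: mult_ac)
      hence "qexp r (\<i> * of_real t) = of_real (exp (- pi * t * r))"
        unfolding qexp_def by (simp only: exp_of_real)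
      thus ?thesis by simp
    qed
    show ?thesis unfolding f_def q
      by (rule infsum_complex_of_real) (use s[OF t] in \<open>simp add: abs_mult\<close>)
  qed
  have S: "f (- 1 / z) = z ^ (12 * m + 2) * f z" if z: "z \<in> upper_half" for z
  proof (rule upper_half_eq_if_imag_axis_eq[OF _ _ _ z])
    have "(f \<circ> (\<lambda>z. - 1 / z)) holomorphic_on upper_half"
    proof (rule holomorphic_on_compose_gen[OF _ hol])
      show "(\<lambda>z. - 1 / z) holomorphic_on upper_half"
        by (intro holomorphic_intros) (auto simp: upper_half_def)
      show "(\<lambda>z. - 1 / z) ` upper_half \<subseteq> upper_half" using upper_half_S by blast
    qed
    thus "(\<lambda>z. f (- 1 / z)) holomorphic_on upper_half" by (simp add: o_def)
    show "(\<lambda>z. z ^ (12 * m + 2) * f z) holomorphic_on upper_half" by (intro holomorphic_intros hol)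
    fix t :: real assume t: "t > 0"
    have e: "- 1 / (\<i> * of_real t) = \<i> * of_real (1 / t)" using t by (simp add: field_simps)
    have "sqrt t ^ DIM('a) = t ^ (12 * m)"
      using t power_mult[of "sqrt t" 2 "12 * m"] by (simp add: dim)
    hence "t\<^sup>2 * sqrt t ^ DIM('a) = t ^ (12 * m + 2)" by (simp add: power_add power2_eq_square)
    hence "(\<Sum>\<^sub>\<infinity>x\<in>L. P x * exp (- pi * t * (norm x)\<^sup>2))
       = - (1 / t ^ (12 * m + 2)) * (\<Sum>\<^sub>\<infinity>x\<in>L. P x * exp (- pi * (1 / t) * (norm x)\<^sup>2))"
      using theta_transform_harmonic[OF L P t] by simp
    hence "- (t ^ (12 * m + 2)) * (\<Sum>\<^sub>\<infinity>x\<in>L. P x * exp (- pi * t * (norm x)\<^sup>2))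
       = (\<Sum>\<^sub>\<infinity>x\<in>L. P x * exp (- pi * (1 / t) * (norm x)\<^sup>2))"
      using t by simp
    moreover have "(\<i> * complex_of_real t) ^ (12 * m + 2) = of_real (- (t ^ (12 * m + 2)))"
    proof -
      have "\<i> ^ (12 * m + 2) = (\<i> ^ 4) ^ (3 * m) * \<i>\<^sup>2" by (simp flip: power_mult power_add)
      also have "\<i> ^ 4 = (\<i>\<^sup>2)\<^sup>2" by (simp flip: power_mult)
      finally have "\<i> ^ (12 * m + 2) = - 1" by simp
      thus ?thesis by (simp only: power_mult_distrib) simp
    qed
    ultimately show "f (- 1 / (\<i> * of_real t)) = (\<i> * of_real t) ^ (12 * m + 2) * f (\<i> * of_real t)"
      unfolding e using axis[OF t] axis[of "1 / t"] t by (simp only: flip: of_real_mult) simp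
  qed
  define A where "A = exp (2 * pi) ^ m * (\<Sum>\<^sub>\<infinity>x\<in>L. \<bar>P x\<bar> * exp (- pi * 1 * (norm x)\<^sup>2))"
  have bound: "norm (f z) \<le> A * exp (- 2 * pi * Im z) ^ m" if y: "Im z \<ge> 1" for z
  proof -
    have z: "z \<in> upper_half" using y by (simp add: upper_half_def)
    have "norm (f z) \<le> (\<Sum>\<^sub>\<infinity>x\<in>L. norm (of_real (P x) * qexp ((norm x)\<^sup>2) z))"
      unfolding f_def by (rule norm_infsum_bound[OF abs[OF z]])
    also have "\<dots> \<le> (\<Sum>\<^sub>\<infinity>x\<in>L. exp (2 * pi) ^ m * exp (- 2 * pi * Im z) ^ m * (\<bar>P x\<bar> * exp (- pi * 1 * (norm x)\<^sup>2)))"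
    proof (rule infsum_mono[OF abs[OF z]])
      show "(\<lambda>x. exp (2 * pi) ^ m * exp (- 2 * pi * Im z) ^ m * (\<bar>P x\<bar> * exp (- pi * 1 * (norm x)\<^sup>2))) summable_on L"
        by (intro summable_on_cmult_right s) simp
      fix x assume x: "x \<in> L"
      show "norm (of_real (P x) * qexp ((norm x)\<^sup>2) z)
        \<le> exp (2 * pi) ^ m * exp (- 2 * pi * Im z) ^ m * (\<bar>P x\<bar> * exp (- pi * 1 * (norm x)\<^sup>2))"
      proof (cases "P x = 0")
        case False
        hence "x \<noteq> 0" using P by (auto simp: harmonic_quadratic_def)
        hence "2 * real m \<le> (norm x)\<^sup>2" using min[OF x] by (simp add: power2_norm_eq_inner)
        hence "pi * (Im z - 1) * (2 * real m) \<le> pi * (Im z - 1) * (norm x)\<^sup>2"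
          using y by (intro mult_left_mono) auto
        hence "exp (- pi * Im z * (norm x)\<^sup>2)
          \<le> exp (real m * (2 * pi)) * exp (real m * (- 2 * pi * Im z)) * exp (- pi * 1 * (norm x)\<^sup>2)"
          unfolding exp_add[symmetric] by (simp add: algebra_simps)
        hence "\<bar>P x\<bar> * exp (- pi * Im z * (norm x)\<^sup>2)
          \<le> \<bar>P x\<bar> * (exp (real m * (2 * pi)) * exp (real m * (- 2 * pi * Im z)) * exp (- pi * 1 * (norm x)\<^sup>2))"
          by (rule mult_left_mono) simp
        thus ?thesis
          unfolding exp_of_nat_mult norm_mult norm_qexp norm_of_real by (simp only: mult_ac)
      qed simp
    qed
    also have "\<dots> = A * exp (- 2 * pi * Im z) ^ m"
      unfolding A_def infsum_cmult_right' by (simp only: mult_ac)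
    finally show ?thesis .
  qed
  have "f z = 0"
    by (rule modular_vanishing[OF hol theta_disc_holomorphic theta_disc_nonzero T theta_disc_T S theta_disc_S bound
          theta_disc_lower_bound _ z]) auto
  thus ?thesis using has_sum_infsum[OF abs_summable_summable[OF abs[OF z]]] by (simp add: f_def)
qed

text \<open>
  A Gaussian is summable over the shell, on which it is constant.
\<close>

lemma finite_lattice_shell:
  fixes L :: "'a::euclidean_space set"
  assumes L: "self_dual_lattice L"
  shows "finite {x \<in> L. x \<bullet> x = l}"
proof -
  have "(\<lambda>x. exp (- 1 * (norm x)\<^sup>2)) summable_on {x \<in> L. x \<bullet> x = l}"
    by (rule summable_on_subset_banach[OF self_dual_gaussian_summable[OF L]]) auto
  hence "(\<lambda>x::'a. exp (- l)) summable_on {x \<in> L. x \<bullet> x = l}"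
    by (rule summable_on_cong[THEN iffD1, rotated]) (simp add: power2_norm_eq_inner)
  thus ?thesis using infsum_diverge_constant[of "{x \<in> L. x \<bullet> x = l}" "exp (- l)"] by auto
qed

text \<open>
  Grouped by shells, the vanishing theta series is a power series in \<open>q\<close>, so all its
  coefficients are 0.
\<close>

theorem shell_harmonic_sum_zero:
  fixes L :: "'a::euclidean_space set"
  assumes L: "self_dual_lattice L" and P: "harmonic_quadratic P"
    and even: "\<And>x. x \<in> L \<Longrightarrow> \<exists>k::int. x \<bullet> x = 2 * of_int k"
    and dim: "DIM('a) = 24 * m"
    and min: "\<And>x. x \<in> L \<Longrightarrow> x \<noteq> 0 \<Longrightarrow> 2 * real m \<le> x \<bullet> x"
  shows "(\<Sum>x | x \<in> L \<and> x \<bullet> x = l. P x) = 0"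
proof -
  define S where "S n = {x \<in> L. x \<bullet> x = 2 * real n}" for n
  define a where "a n = complex_of_real (\<Sum>x\<in>S n. P x)" for n
  have fin: "finite (S n)" for n unfolding S_def by (rule finite_lattice_shell[OF L])
  have P0: "P 0 = 0" using P by (auto simp: harmonic_quadratic_def)
  have level: "\<exists>n. x \<in> S n" if "x \<in> L" for x
  proof -
    obtain k :: int where k: "x \<bullet> x = 2 * of_int k" using even \<open>x \<in> L\<close> by blast
    hence "k \<ge> 0" using inner_ge_zero[of x] by (simp add: zero_le_mult_iff)
    thus ?thesis using k that by (intro exI[of _ "nat k"]) (simp add: S_def)
  qed
  have sums: "(\<lambda>n. a n * q ^ n) sums 0" if q: "norm q < 1" for q
  proof (cases "q = 0")
    case True
    have "S 0 = {0} \<inter> L" by (auto simp: S_def)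
    hence "a 0 = 0" by (auto simp: a_def P0 intro!: sum.neutral)
    hence z0: "a n * q ^ n = 0" for n using True by (cases n) auto
    show ?thesis by (simp only: z0 sums_zero)
  next
    case False
    define z where "z = Ln q / (2 * pi * \<i>)"
    have "Im z = - ln (norm q) / (2 * pi)"
      using False by (simp add: z_def Im_divide Re_Ln power2_eq_square)
    hence z: "z \<in> upper_half" using q False by (simp add: upper_half_def divide_neg_pos)
    have qz: "exp (2 * pi * \<i> * z) = q" using False by (simp add: z_def)
    have qn: "qexp ((norm x)\<^sup>2) z = q ^ n" if "x \<in> S n" for x n
    proof -
      have "qexp ((norm x)\<^sup>2) z = exp (of_nat n * (2 * pi * \<i> * z))"
        using that by (simp add: qexp_def S_def power2_norm_eq_inner mult_ac)
      thus ?thesis by (simp only: exp_of_nat_mult qz)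
    qed
    have bij: "bij_betw snd (SIGMA n:UNIV. S n) L"
      unfolding bij_betw_def
    proof
      show "inj_on snd (SIGMA n:UNIV. S n)" by (auto simp: inj_on_def S_def)
      show "snd ` (SIGMA n:UNIV. S n) = L" using level by (force simp: S_def)
    qed
    have "((\<lambda>x. of_real (P x) * qexp ((norm x)\<^sup>2) z) has_sum 0) L"
      by (rule lattice_theta_vanishes[OF L P even dim min z])
    hence "((\<lambda>p. of_real (P (snd p)) * qexp ((norm (snd p))\<^sup>2) z) has_sum 0) (SIGMA n:UNIV. S n)"
      using has_sum_reindex_bij_betw[OF bij, of "\<lambda>x. of_real (P x) * qexp ((norm x)\<^sup>2) z" 0] by simp
    moreover have "((\<lambda>x. of_real (P (snd (n, x))) * qexp ((norm (snd (n, x)))\<^sup>2) z) has_sum (a n * q ^ n)) (S n)" for n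
    proof (rule has_sum_finiteI[OF fin])
      show "a n * q ^ n = (\<Sum>x\<in>S n. of_real (P (snd (n, x))) * qexp ((norm (snd (n, x)))\<^sup>2) z)"
        by (simp add: a_def sum_distrib_right qn)
    qed
    ultimately have "((\<lambda>n. a n * q ^ n) has_sum 0) UNIV" by (rule has_sum_Sigma')
    thus ?thesis by (rule has_sum_imp_sums)
  qed
  have a0: "a n = 0" for n
  proof (rule ccontr)
    assume n: "a n \<noteq> 0"
    have "n > 0"
    proof (rule ccontr)
      assume "\<not> n > 0"
      hence "n = 0" by simp
      have "(\<lambda>n. a n * 0 ^ n) sums 0" using sums[of 0] by simp
      moreover have "(\<lambda>n. a n * 0 ^ n) sums (a 0)" by (rule powser_sums_zero)
      ultimately have "a 0 = 0" using sums_unique2 by blast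
      thus False using n \<open>n = 0\<close> by simp
    qed
    obtain s where s: "s > 0" "\<And>z::complex. z \<in> cball 0 s - {0} \<Longrightarrow> (\<lambda>_. 0::complex) z \<noteq> 0"
      by (rule powser_0_nonzero[of 1 0 a "\<lambda>_. 0" n]) (use sums n \<open>n > 0\<close> in auto)
    have "of_real s \<in> cball (0::complex) s - {0}" using s(1) by auto
    from s(2)[OF this] show False by simp
  qed
  show ?thesis
  proof (cases "{x \<in> L. x \<bullet> x = l} = {}")
    case False
    then obtain x where x: "x \<in> L" "x \<bullet> x = l" by auto
    obtain n where "x \<in> S n" using level[OF x(1)] by blast
    hence "{x \<in> L. x \<bullet> x = l} = S n" using x by (auto simp: S_def)
    thus ?thesis using a0[of n] unfolding a_def of_real_eq_0_iff by simp
  next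
    case True
    show ?thesis unfolding True by (rule sum.empty)
  qed
qed

section \<open>Spherical 3-designs\<close>

text \<open>
  Coordinate permutations with sign changes map boxes to boxes, which makes the invariance of
  Lebesgue measure easy to check; they are all the symmetries of the sphere that are used.
\<close>

definition signed_perm :: "('n::finite \<Rightarrow> bool) \<Rightarrow> ('n \<Rightarrow> 'n) \<Rightarrow> real ^ 'n \<Rightarrow> real ^ 'n" where
  "signed_perm s \<pi> x = (\<chi> k. if s k then - x $ \<pi> k else x $ \<pi> k)"

lemma linear_signed_perm: "linear (signed_perm s \<pi>)"
  by (intro linearI) (auto simp: signed_perm_def vec_eq_iff)

lemma norm_signed_perm:
  assumes "bij \<pi>"
  shows "norm (signed_perm s \<pi> x) = norm x"
proof -
  have "signed_perm s \<pi> x \<bullet> signed_perm s \<pi> x = (\<Sum>k\<in>UNIV. x $ \<pi> k * x $ \<pi> k)"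
    unfolding signed_perm_def inner_vec_def by (intro sum.cong) auto
  also have "\<dots> = (\<Sum>k\<in>UNIV. x $ k * x $ k)"
    using assms by (rule sum.reindex_bij_betw)
  finally show ?thesis by (simp add: norm_eq_sqrt_inner inner_vec_def)
qed

lemma signed_perm_measurable [measurable]: "signed_perm s \<pi> \<in> borel_measurable borel"
  by (intro borel_measurable_continuous_onI linear_continuous_on linear_linear[THEN iffD2] linear_signed_perm)

lemma prod_Basis_cart: "(\<Prod>b\<in>(Basis :: (real ^ 'n) set). f b) = (\<Prod>k\<in>UNIV. f (axis k 1))"
proof -
  have B: "(Basis :: (real ^ 'n) set) = range (\<lambda>k. axis k 1)" by (auto simp: Basis_vec_def)
  have inj: "inj (\<lambda>k :: 'n. axis k (1::real))" by (auto simp: inj_def axis_eq_axis)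
  show ?thesis unfolding B by (subst prod.reindex[OF inj]) (simp add: o_def)
qed

lemma lborel_distr_signed_perm:
  fixes \<pi> :: "'n::finite \<Rightarrow> 'n"
  assumes \<pi>: "bij \<pi>"
  shows "distr lborel borel (signed_perm s \<pi>) = lborel"
proof (rule lborel_eqI[symmetric])
  fix l u :: "real ^ 'n"
  assume lu: "\<And>b. b \<in> Basis \<Longrightarrow> l \<bullet> b \<le> u \<bullet> b"
  have lu': "l $ k \<le> u $ k" for k
    using lu[of "axis k 1"] by (auto simp: inner_axis Basis_vec_def)
  define l' where "l' = (\<chi> j. let k = inv \<pi> j in if s k then - u $ k else l $ k)"
  define u' where "u' = (\<chi> j. let k = inv \<pi> j in if s k then - l $ k else u $ k)"
  have inv: "inv \<pi> (\<pi> k) = k" "\<pi> (inv \<pi> j) = j" for k j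
    using \<pi> by (auto simp: bij_is_inj bij_is_surj surj_f_inv_f)
  have pre: "signed_perm s \<pi> -` box l u = box l' u'"
  proof (intro set_eqI)
    fix x :: "real ^ 'n"
    have "x \<in> signed_perm s \<pi> -` box l u \<longleftrightarrow> (\<forall>k. l' $ \<pi> k < x $ \<pi> k \<and> x $ \<pi> k < u' $ \<pi> k)"
      by (auto simp: mem_box_cart signed_perm_def l'_def u'_def inv)
    also have "\<dots> \<longleftrightarrow> (\<forall>j. l' $ j < x $ j \<and> x $ j < u' $ j)" using inv(2) by metis
    finally show "x \<in> signed_perm s \<pi> -` box l u \<longleftrightarrow> x \<in> box l' u'" by (simp add: mem_box_cart)
  qed
  have d: "(u' - l') $ j = (u - l) $ inv \<pi> j" for j by (simp add: l'_def u'_def Let_def)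
  have "l' $ j \<le> u' $ j" for j using lu'[of "inv \<pi> j"] by (simp add: l'_def u'_def Let_def)
  hence lu2: "l' \<bullet> b \<le> u' \<bullet> b" if "b \<in> Basis" for b
    using that by (auto simp: Basis_vec_def inner_axis)
  have "emeasure (distr lborel borel (signed_perm s \<pi>)) (box l u) = emeasure lborel (box l' u')"
    by (subst emeasure_distr) (auto simp: pre)
  also have "\<dots> = ennreal (\<Prod>b\<in>Basis. (u' - l') \<bullet> b)"
    using lu2 by (simp add: emeasure_lborel_box)
  also have "(\<Prod>b\<in>Basis. (u' - l') \<bullet> b) = (\<Prod>k\<in>UNIV. (u - l) $ inv \<pi> k)"
    by (simp add: prod_Basis_cart inner_axis d del: vector_minus_component)
  also have "\<dots> = (\<Prod>k\<in>UNIV. (u - l) $ k)"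
    using \<pi> by (intro prod.reindex_bij_betw) (rule bij_imp_bij_inv)
  also have "\<dots> = (\<Prod>b\<in>Basis. (u - l) \<bullet> b)"
    by (simp add: prod_Basis_cart inner_axis)
  finally show "emeasure (distr lborel borel (signed_perm s \<pi>)) (box l u) = (\<Prod>b\<in>Basis. (u - l) \<bullet> b)" .
qed simp

lemma finite_measure_sphere_measure: "finite_measure (sphere_measure :: 'a::euclidean_space measure)"
proof (rule finite_measureI)
  have "emeasure lborel (cball 0 1 :: 'a set) < \<infinity>" by (rule emeasure_bounded_finite) simp
  thus "emeasure (sphere_measure :: 'a measure) (space sphere_measure) \<noteq> \<infinity>"
    by (simp add: emeasure_sphere_measure_sphere ennreal_mult_eq_top_iff ennreal_of_nat_neq_top less_top[symmetric])
qed

lemma measure_sphere_measure_pos: "measure sphere_measure (sphere 0 1 :: 'a::euclidean_space set) > 0"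
proof -
  have "emeasure lborel (cball 0 1 :: 'a set) = ennreal (measure lborel (cball 0 1 :: 'a set))"
    by (rule emeasure_eq_ennreal_measure) (use emeasure_bounded_finite[of "cball 0 1 :: 'a set"] in simp)
  hence "measure sphere_measure (sphere 0 1 :: 'a set) = real DIM('a) * measure lborel (cball 0 1 :: 'a set)"
    by (simp add: measure_def[of sphere_measure] emeasure_sphere_measure_sphere enn2real_mult)
  moreover have "measure lborel (cball 0 1 :: 'a set) > 0"
    using content_cball_pos[of 1 "0::'a"] by (simp add: measure_completion)
  ultimately show ?thesis by simp
qed

text \<open>
  The surface measure is a push-forward of Lebesgue measure on the punctured ball.
\<close>

lemma sphere_integral:
  fixes f :: "'a::euclidean_space \<Rightarrow> real"
  assumes [measurable]: "f \<in> borel_measurable borel"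
  shows "integral\<^sup>L sphere_measure f = real DIM('a) * (\<integral>y. indicator (cball 0 1 - {0}) y * f (sgn y) \<partial>lborel)"
proof -
  have m: "f \<in> borel_measurable (restrict_space borel (sphere 0 1))"
    by (rule measurable_restrict_space1) simp
  have "integral\<^sup>L sphere_measure f = real DIM('a) *
      integral\<^sup>L (distr (restrict_space lborel (cball 0 1 - {0})) (restrict_space borel (sphere 0 1)) sgn) f"
  proof -
    let ?M = "distr (restrict_space lborel (cball 0 1 - {0})) (restrict_space borel (sphere 0 1)) (sgn :: 'a \<Rightarrow> 'a)"
    have eq: "sphere_measure = density ?M (\<lambda>_. ennreal (real DIM('a)))"
      unfolding sphere_measure_def
      by (rule measure_eqI) (auto simp: emeasure_density_const ennreal_of_nat_eq_real_of_nat)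
    have "integral\<^sup>L (density ?M (\<lambda>_. ennreal (real DIM('a)))) f = (\<integral>x. real DIM('a) *\<^sub>R f x \<partial>?M)"
      by (rule integral_density) (use m in auto)
    thus ?thesis unfolding eq by simp
  qed
  also have "integral\<^sup>L (distr (restrict_space lborel (cball 0 1 - {0})) (restrict_space borel (sphere 0 1)) sgn) f
      = (\<integral>y. f (sgn y) \<partial>restrict_space lborel (cball 0 1 - {0}))"
    by (rule integral_distr[OF measurable_sgn_punctured_ball m])
  also have "\<dots> = (\<integral>y. indicator (cball 0 1 - {0}) y *\<^sub>R f (sgn y) \<partial>lborel)"
    by (rule integral_restrict_space) simp
  finally show ?thesis by simp
qed

lemma sphere_integral_signed_perm:
  fixes f :: "real ^ 'n \<Rightarrow> real"
  assumes [measurable]: "f \<in> borel_measurable borel" and \<pi>: "bij \<pi>"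
  shows "(\<integral>x. f (signed_perm s \<pi> x) \<partial>sphere_measure) = integral\<^sup>L sphere_measure f"
proof -
  let ?T = "signed_perm s \<pi>"
  have sgnm [measurable]: "(sgn :: real ^ 'n \<Rightarrow> _) \<in> borel_measurable borel"
    unfolding sgn_div_norm[abs_def] by measurable
  have fs [measurable]: "(\<lambda>y. f (sgn y)) \<in> borel_measurable borel"
    by (rule measurable_compose[OF sgnm]) simp
  have gm: "(\<lambda>y. indicator (cball 0 1 - {0}) y * f (sgn y)) \<in> borel_measurable borel"
    by (intro borel_measurable_times borel_measurable_indicator fs) auto
  have n: "norm (?T y) = norm y" for y by (rule norm_signed_perm[OF \<pi>])
  have T0: "?T y = 0 \<longleftrightarrow> y = 0" for y using n[of y] by (metis norm_eq_zero)
  have sg: "sgn (?T y) = ?T (sgn y)" for y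
    by (simp add: sgn_div_norm n linear_scale[OF linear_signed_perm])
  let ?g = "\<lambda>y. indicator (cball 0 1 - {0}) y * f (sgn y)"
  have "(\<integral>x. f (?T x) \<partial>sphere_measure) = real DIM(real ^ 'n) * (\<integral>y. indicator (cball 0 1 - {0}) y * f (?T (sgn y)) \<partial>lborel)"
    by (rule sphere_integral[of "\<lambda>x. f (?T x)"]) measurable
  also have "(\<lambda>y. indicator (cball 0 1 - {0}) y * f (?T (sgn y))) = (\<lambda>y. ?g (?T y))"
    by (auto simp: fun_eq_iff indicator_def n T0 sg)
  also have "(\<integral>y. ?g (?T y) \<partial>lborel) = integral\<^sup>L (distr lborel borel ?T) ?g"
    by (rule integral_distr[symmetric]) (use gm in auto)
  also have "\<dots> = integral\<^sup>L lborel ?g" by (simp add: lborel_distr_signed_perm[OF \<pi>])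
  also have "real DIM(real ^ 'n) * integral\<^sup>L lborel ?g = integral\<^sup>L sphere_measure f"
    by (rule sphere_integral[symmetric]) simp
  finally show ?thesis .
qed

definition monomial :: "('n::finite \<Rightarrow> nat) \<Rightarrow> real ^ 'n \<Rightarrow> real" where
  "monomial \<alpha> x = (\<Prod>i\<in>UNIV. x $ i ^ \<alpha> i)"

lemma monomial_measurable [measurable]: "monomial \<alpha> \<in> borel_measurable borel"
  unfolding monomial_def[abs_def] by (intro borel_measurable_continuous_onI continuous_intros)

lemma monomial_minus: "monomial \<alpha> (- x) = (- 1) ^ (\<Sum>i\<in>UNIV. \<alpha> i) * monomial \<alpha> x"
proof -
  have "monomial \<alpha> (- x) = (\<Prod>i\<in>UNIV. (- 1) ^ \<alpha> i * x $ i ^ \<alpha> i)"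
    unfolding monomial_def by (intro prod.cong refl) (simp add: power_minus[of "x $ _"])
  thus ?thesis by (simp add: prod.distrib power_sum monomial_def)
qed

lemma monomial_Suc:
  fixes \<alpha> :: "'n::finite \<Rightarrow> nat"
  assumes "(\<Sum>i\<in>UNIV. \<alpha> i) = Suc k"
  obtains i \<beta> where "(\<Sum>i\<in>UNIV. \<beta> i) = k" "\<And>x. monomial \<alpha> x = x $ i * monomial \<beta> x"
proof -
  obtain i where i: "\<alpha> i \<noteq> 0" using assms by (metis nat.distinct(1) sum.neutral)
  define \<beta> where "\<beta> = \<alpha>(i := \<alpha> i - 1)"
  show ?thesis
  proof (rule that[of \<beta> i])
    have "(\<Sum>j\<in>UNIV. \<alpha> j) = \<alpha> i + (\<Sum>j\<in>UNIV - {i}. \<alpha> j)" "(\<Sum>j\<in>UNIV. \<beta> j) = \<beta> i + (\<Sum>j\<in>UNIV - {i}. \<beta> j)"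
      by (simp_all add: sum.remove[of UNIV i])
    moreover have "(\<Sum>j\<in>UNIV - {i}. \<beta> j) = (\<Sum>j\<in>UNIV - {i}. \<alpha> j)"
      by (intro sum.cong) (auto simp: \<beta>_def)
    ultimately show "(\<Sum>i\<in>UNIV. \<beta> i) = k" using assms i by (simp add: \<beta>_def)
    fix x :: "real ^ 'n"
    have "(\<Prod>j\<in>UNIV - {i}. x $ j ^ \<beta> j) = (\<Prod>j\<in>UNIV - {i}. x $ j ^ \<alpha> j)"
      by (intro prod.cong) (auto simp: \<beta>_def)
    moreover have "x $ i ^ \<alpha> i = x $ i * x $ i ^ \<beta> i" using i by (simp add: \<beta>_def flip: power_Suc)
    ultimately show "monomial \<alpha> x = x $ i * monomial \<beta> x"
      unfolding monomial_def by (simp add: prod.remove[of UNIV i])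
  qed
qed

lemma monomial_degree_0: "(\<Sum>i\<in>UNIV. \<alpha> i) = 0 \<Longrightarrow> monomial \<alpha> x = 1"
  by (simp add: monomial_def)

lemma monomial_degree_2:
  fixes \<alpha> :: "'n::finite \<Rightarrow> nat"
  assumes "(\<Sum>i\<in>UNIV. \<alpha> i) = 2"
  obtains i j where "\<And>x. monomial \<alpha> x = x $ i * x $ j"
proof -
  have "(\<Sum>i\<in>UNIV. \<alpha> i) = Suc 1" using assms by simp
  then obtain i \<beta> where 1: "(\<Sum>i\<in>UNIV. \<beta> i) = 1" "\<And>x. monomial \<alpha> x = x $ i * monomial \<beta> x"
    using monomial_Suc by blast
  from 1(1) have "(\<Sum>i\<in>UNIV. \<beta> i) = Suc 0" by simp
  then obtain j \<gamma> where 2: "(\<Sum>i\<in>UNIV. \<gamma> i) = 0" "\<And>x. monomial \<beta> x = x $ j * monomial \<gamma> x"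
    using monomial_Suc by blast
  show ?thesis by (rule that[of i j]) (simp add: 1(2) 2(2) monomial_degree_0[OF 2(1)])
qed

lemma abs_monomial_le_1: "norm x = 1 \<Longrightarrow> \<bar>monomial \<alpha> x\<bar> \<le> 1"
  unfolding monomial_def abs_prod using component_le_norm_cart[of x]
  by (intro prod_le_1) (auto simp: power_abs power_le_one)

lemma monomial_sphere_integrable: "integrable sphere_measure (monomial \<alpha> :: real ^ 'n \<Rightarrow> real)"
proof (rule finite_measure.integrable_const_bound[OF finite_measure_sphere_measure, where B = 1])
  show "AE x in sphere_measure. norm (monomial \<alpha> x :: real) \<le> 1"
    by (rule AE_I2) (simp add: abs_monomial_le_1)
  show "monomial \<alpha> \<in> borel_measurable sphere_measure"
    by (subst measurable_cong_sets[OF sets_sphere_measure refl]) (rule measurable_restrict_space1, simp)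
qed

lemma measurable_component_product [measurable]: "(\<lambda>x :: real ^ 'n. x $ i * x $ j) \<in> borel_measurable borel"
  by (intro borel_measurable_continuous_onI continuous_intros)

lemma sphere_integral_off_diagonal:
  fixes i j :: "'n::finite"
  assumes ij: "i \<noteq> j"
  shows "(\<integral>x. x $ i * x $ j \<partial>(sphere_measure :: (real ^ 'n) measure)) = 0"
proof -
  have "(\<integral>x. x $ i * x $ j \<partial>(sphere_measure :: (real ^ 'n) measure))
      = (\<integral>x. signed_perm (\<lambda>k. k = i) id x $ i * signed_perm (\<lambda>k. k = i) id x $ j \<partial>(sphere_measure :: (real ^ 'n) measure))"
    by (rule sphere_integral_signed_perm[symmetric]) auto
  also have "\<dots> = - (\<integral>x. x $ i * x $ j \<partial>(sphere_measure :: (real ^ 'n) measure))"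
    using ij by (simp add: signed_perm_def)
  finally show "(\<integral>x. x $ i * x $ j \<partial>(sphere_measure :: (real ^ 'n) measure)) = 0" by simp
qed

text \<open>
  By symmetry all \<open>x\<^sub>i\<^sup>2\<close> have the same integral, and they sum to 1 on
  the sphere.
\<close>

lemma sphere_integral_diagonal:
  fixes i :: "'n::finite"
  shows "(\<integral>x. x $ i * x $ i \<partial>(sphere_measure :: (real ^ 'n) measure))
    = measure sphere_measure (sphere 0 1 :: (real ^ 'n) set) / real CARD('n)"
proof -
  define I where "I k = (\<integral>x. x $ k * x $ k \<partial>(sphere_measure :: (real ^ 'n) measure))" for k
  have I: "I k = I i" for k
  proof -
    let ?T = "signed_perm (\<lambda>_. False) (Transposition.transpose i k)"
    have "I k = (\<integral>x. ?T x $ k * ?T x $ k \<partial>(sphere_measure :: (real ^ 'n) measure))"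
      unfolding I_def by (rule sphere_integral_signed_perm[symmetric]) auto
    thus ?thesis by (simp add: I_def signed_perm_def)
  qed
  have int: "integrable sphere_measure (\<lambda>x :: real ^ 'n. x $ k * x $ k)" for k
  proof (rule finite_measure.integrable_const_bound[OF finite_measure_sphere_measure, where B = 1])
    show "AE x in (sphere_measure :: (real ^ 'n) measure). norm (x $ k * x $ k) \<le> 1"
    proof (rule AE_I2)
      fix x :: "real ^ 'n" assume "x \<in> space sphere_measure"
      hence "\<bar>x $ k\<bar> \<le> 1" using component_le_norm_cart[of x k] by simp
      thus "norm (x $ k * x $ k) \<le> 1" unfolding real_norm_def abs_mult by (intro mult_le_one) auto
    qed
    show "(\<lambda>x :: real ^ 'n. x $ k * x $ k) \<in> borel_measurable sphere_measure"
      by (subst measurable_cong_sets[OF sets_sphere_measure refl]) (rule measurable_restrict_space1, simp)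
  qed
  have "(\<Sum>k\<in>UNIV. I k) = (\<Sum>k\<in>(UNIV :: 'n set). I i)" by (intro sum.cong refl I)
  hence "real CARD('n) * I i = (\<Sum>k\<in>UNIV. I k)" by simp
  also have "\<dots> = (\<integral>x. (\<Sum>k\<in>UNIV. x $ k * x $ k) \<partial>(sphere_measure :: (real ^ 'n) measure))"
    unfolding I_def by (rule Bochner_Integration.integral_sum[symmetric]) (rule int)
  also have "\<dots> = (\<integral>x. 1 \<partial>(sphere_measure :: (real ^ 'n) measure))"
  proof (rule Bochner_Integration.integral_cong[OF refl])
    fix x :: "real ^ 'n" assume "x \<in> space sphere_measure"
    hence "x \<bullet> x = 1" by (simp add: norm_eq_1)
    thus "(\<Sum>k\<in>UNIV. x $ k * x $ k) = 1" by (simp add: inner_vec_def)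
  qed
  also have "\<dots> = measure sphere_measure (sphere 0 1 :: (real ^ 'n) set)" by simp
  finally show "(\<integral>x. x $ i * x $ i \<partial>(sphere_measure :: (real ^ 'n) measure)) = measure sphere_measure (sphere 0 1 :: (real ^ 'n) set) / real CARD('n)"
    by (simp add: I_def field_simps)
qed

text \<open>
  It suffices to compare monomials of degree at most 3. Those of odd degree integrate and sum to 0
  by symmetry under \<open>x \<mapsto> -x\<close>; those of degree 2 are products \<open>x\<^sub>i
  x\<^sub>j\<close>.
\<close>

theorem spherical_3_designI:
  fixes X :: "(real ^ 'n) set"
  assumes X: "finite X" "X \<noteq> {}" "X \<subseteq> sphere 0 1"
    and sym: "\<And>x. x \<in> X \<Longrightarrow> - x \<in> X"
    and off: "\<And>i j. i \<noteq> j \<Longrightarrow> (\<Sum>x\<in>X. x $ i * x $ j) = 0"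
    and diag: "\<And>i j. (\<Sum>x\<in>X. (x $ i)\<^sup>2) = (\<Sum>x\<in>X. (x $ j)\<^sup>2)"
  shows "spherical_design 3 X"
proof -
  define M where "M = measure sphere_measure (sphere 0 1 :: (real ^ 'n) set)"
  have M: "M > 0" unfolding M_def by (rule measure_sphere_measure_pos)
  have cX: "real (card X) > 0" using X by (simp add: card_gt_0_iff)
  have mono: "1 / real (card X) * (\<Sum>x\<in>X. monomial \<alpha> x) = 1 / M * integral\<^sup>L sphere_measure (monomial \<alpha>)"
    if deg: "(\<Sum>i\<in>UNIV. \<alpha> i) \<le> 3" for \<alpha> :: "'n \<Rightarrow> nat"
  proof (cases "odd (\<Sum>i\<in>UNIV. \<alpha> i)")
    case True
    hence odd: "monomial \<alpha> (- x) = - monomial \<alpha> x" for x by (simp add: monomial_minus)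
    have "bij_betw uminus X X" by (rule bij_betwI[of _ _ _ uminus]) (auto simp: sym)
    hence "(\<Sum>x\<in>X. monomial \<alpha> x) = (\<Sum>x\<in>X. monomial \<alpha> (- x))" by (rule sum.reindex_bij_betw[symmetric])
    hence "(\<Sum>x\<in>X. monomial \<alpha> x) = 0" by (simp add: odd sum_negf)
    moreover have "signed_perm (\<lambda>_. True) id x = - x" for x :: "real ^ 'n"
      by (simp add: signed_perm_def vec_eq_iff)
    hence "integral\<^sup>L sphere_measure (monomial \<alpha>) = 0"
      using sphere_integral_signed_perm[OF monomial_measurable bij_id, of \<alpha> "\<lambda>_. True"] by (simp add: odd)
    ultimately show ?thesis by simp
  next
    case False
    moreover have "d = 0 \<or> d = 2" if "\<not> odd d" "d \<le> 3" for d :: nat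
      using that by presburger
    ultimately have "(\<Sum>i\<in>UNIV. \<alpha> i) = 0 \<or> (\<Sum>i\<in>UNIV. \<alpha> i) = 2" using deg by blast
    thus ?thesis
    proof
      assume "(\<Sum>i\<in>UNIV. \<alpha> i) = 0"
      hence 1: "monomial \<alpha> = (\<lambda>_. 1)" using monomial_degree_0 by blast
      show ?thesis using cX M by (simp add: 1 M_def)
    next
      assume "(\<Sum>i\<in>UNIV. \<alpha> i) = 2"
      then obtain i j where ij: "\<And>x. monomial \<alpha> x = x $ i * x $ j" using monomial_degree_2 by blast
      hence ij': "monomial \<alpha> = (\<lambda>x. x $ i * x $ j)" by blast
      show ?thesis
      proof (cases "i = j")
        case False
        thus ?thesis using off by (simp add: ij' sphere_integral_off_diagonal)
      next
        case True
        have "real CARD('n) * (\<Sum>x\<in>X. (x $ i)\<^sup>2) = (\<Sum>k\<in>UNIV. \<Sum>x\<in>X. (x $ k)\<^sup>2)"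
        proof -
          have "(\<Sum>k\<in>UNIV. \<Sum>x\<in>X. (x $ k)\<^sup>2) = (\<Sum>k\<in>(UNIV :: 'n set). \<Sum>x\<in>X. (x $ i)\<^sup>2)"
            by (intro sum.cong refl diag)
          thus ?thesis by simp
        qed
        also have "\<dots> = (\<Sum>x\<in>X. \<Sum>k\<in>UNIV. (x $ k)\<^sup>2)" by (rule sum.swap)
        also have "\<dots> = (\<Sum>x\<in>X. 1)"
        proof (rule sum.cong[OF refl])
          fix x assume "x \<in> X"
          hence "x \<bullet> x = 1" using X(3) by (auto simp: norm_eq_1)
          thus "(\<Sum>k\<in>UNIV. (x $ k)\<^sup>2) = 1" by (simp add: inner_vec_def power2_eq_square)
        qed
        finally have "real CARD('n) * (\<Sum>x\<in>X. (x $ i)\<^sup>2) = real (card X)" by simp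
        hence "(\<Sum>x\<in>X. x $ i * x $ i) = real (card X) / real CARD('n)"
          by (simp add: field_simps power2_eq_square)
        thus ?thesis using True cX M by (simp add: ij' M_def sphere_integral_diagonal)
      qed
    qed
  qed
  show ?thesis
    unfolding spherical_design_def
  proof (intro conjI allI impI X)
    fix f :: "real ^ 'n \<Rightarrow> real"
    assume "polynomial_function_deg_le 3 f"
    then obtain A c where A: "finite A" "\<And>\<alpha>. \<alpha> \<in> A \<Longrightarrow> (\<Sum>i\<in>UNIV. \<alpha> i) \<le> 3"
      and f: "f = (\<lambda>x. \<Sum>\<alpha>\<in>A. c \<alpha> * monomial \<alpha> x)"
      unfolding polynomial_function_deg_le_def monomial_def by blast
    have "1 / real (card X) * (\<Sum>x\<in>X. f x) = (\<Sum>\<alpha>\<in>A. c \<alpha> * (1 / real (card X) * (\<Sum>x\<in>X. monomial \<alpha> x)))"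
      unfolding f by (subst sum.swap) (simp add: sum_distrib_left sum_divide_distrib)
    also have "\<dots> = (\<Sum>\<alpha>\<in>A. c \<alpha> * (1 / M * integral\<^sup>L sphere_measure (monomial \<alpha>)))"
    proof (intro sum.cong refl)
      fix \<alpha> assume "\<alpha> \<in> A"
      thus "c \<alpha> * (1 / real (card X) * (\<Sum>x\<in>X. monomial \<alpha> x)) = c \<alpha> * (1 / M * integral\<^sup>L sphere_measure (monomial \<alpha>))"
        by (simp only: mono[OF A(2)])
    qed
    also have "\<dots> = 1 / M * (\<Sum>\<alpha>\<in>A. \<integral>x. c \<alpha> * monomial \<alpha> x \<partial>sphere_measure)"
      unfolding sum_distrib_left by (intro sum.cong refl) simp
    also have "(\<Sum>\<alpha>\<in>A. \<integral>x. c \<alpha> * monomial \<alpha> x \<partial>sphere_measure) = integral\<^sup>L sphere_measure f"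
      unfolding f by (rule Bochner_Integration.integral_sum[symmetric])
        (intro integrable_mult_right monomial_sphere_integrable)
    finally show "1 / real (card X) * (\<Sum>x\<in>X. f x) =
        1 / measure sphere_measure (sphere 0 1 :: (real ^ 'n) set) * integral\<^sup>L sphere_measure f"
      by (simp add: M_def)
  qed
qed

section \<open>Shells as designs\<close>

text \<open>
  The coordinate polynomials \<open>x\<^sub>i x\<^sub>j\<close> and \<open>x\<^sub>i\<^sup>2 -
  x\<^sub>j\<^sup>2\<close> are harmonic, so their sums over the shell vanish.
\<close>

theorem lattice_shell_spherical_3_design:
  fixes L :: "(real ^ 'n) set"
  assumes dim: "CARD('n) = 24 * m" and ev: "even_lattice L" and uni: "unimodular_lattice L"
    and min: "has_min_norm L (2 * real m)" and l: "l > 0" "lattice_shell L l \<noteq> {}"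
  shows "supports_spherical_design 3 L l"
proof -
  have L: "self_dual_lattice L"
    using uni unfolding self_dual_lattice_def unimodular_lattice_def integral_lattice_def is_lattice_def
      int_span_def dual_lattice_def by blast
  have even: "\<exists>k::int. x \<bullet> x = 2 * of_int k" if "x \<in> L" for x
    using ev that by (simp add: even_lattice_def)
  have min': "2 * real m \<le> x \<bullet> x" if "x \<in> L" "x \<noteq> 0" for x
    using min that by (simp add: has_min_norm_def)
  have dim': "DIM(real ^ 'n) = 24 * m" using dim by simp
  define S where "S = lattice_shell L l"
  have S: "S = {x \<in> L. x \<bullet> x = l}" by (simp add: S_def lattice_shell_def)
  have fin: "finite S" unfolding S by (rule finite_lattice_shell[OF L])
  have zero: "(\<Sum>x\<in>S. P x) = 0" if "harmonic_quadratic P" for P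
    unfolding S by (rule shell_harmonic_sum_zero[OF L that even dim' min'])
  have neg: "- x \<in> L" if "x \<in> L" for x
    using self_dual_lattice_tiling[OF L] lattice_tiling.minus_L[OF _ that] by metis
  have ax: "axis i 1 \<in> (Basis :: (real ^ 'n) set)" for i by (auto simp: Basis_vec_def)
  have ax_ne: "axis i 1 \<noteq> (axis j 1 :: real ^ 'n)" if "i \<noteq> j" for i j using that by (simp add: axis_eq_axis)
  have off: "(\<Sum>x\<in>S. x $ i * x $ j) = 0" if "i \<noteq> j" for i j
  proof -
    have "harmonic_quadratic (\<lambda>x :: real ^ 'n. (x \<bullet> axis i 1) * (x \<bullet> axis j 1))"
      unfolding harmonic_quadratic_def
      by (rule bexI[of _ "axis i 1"], rule bexI[of _ "axis j 1"]) (simp_all add: ax ax_ne[OF that])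
    from zero[OF this] show ?thesis by (simp add: inner_axis)
  qed
  have diag: "(\<Sum>x\<in>S. (x $ i)\<^sup>2) = (\<Sum>x\<in>S. (x $ j)\<^sup>2)" for i j
  proof (cases "i = j")
    case False
    have "harmonic_quadratic (\<lambda>x :: real ^ 'n. (x \<bullet> axis i 1)\<^sup>2 - (x \<bullet> axis j 1)\<^sup>2)"
      unfolding harmonic_quadratic_def
      by (rule bexI[of _ "axis i 1"], rule bexI[of _ "axis j 1"]) (simp_all add: ax ax_ne[OF False])
    from zero[OF this] show ?thesis by (simp add: inner_axis sum_subtractf)
  qed simp
  let ?g = "\<lambda>x :: real ^ 'n. (1 / sqrt l) *\<^sub>R x"
  have inj: "inj_on ?g S" using l by (auto simp: inj_on_def)
  have sq: "1 / sqrt l * (1 / sqrt l) = 1 / l" using l by simp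
  show ?thesis
    unfolding supports_spherical_design_def S_def[symmetric]
  proof (rule spherical_3_designI)
    show "finite (?g ` S)" using fin by simp
    show "?g ` S \<noteq> {}" using l by (simp add: S_def)
    show "?g ` S \<subseteq> sphere 0 1" using l by (auto simp: S norm_eq_sqrt_inner)
    show "- x \<in> ?g ` S" if x: "x \<in> ?g ` S" for x
    proof -
      obtain y where y: "y \<in> S" "x = ?g y" using x by blast
      have "- y \<in> S" using y(1) neg by (simp add: S)
      thus ?thesis using y(2) by (intro image_eqI[of _ _ "- y"]) auto
    qed
    have red: "(\<Sum>x\<in>?g ` S. x $ i * x $ j) = (1 / l) * (\<Sum>x\<in>S. x $ i * x $ j)" for i j
      unfolding sum.reindex[OF inj] sum_distrib_left sq[symmetric] by (simp add: mult_ac)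
    show "(\<Sum>x\<in>?g ` S. x $ i * x $ j) = 0" if "i \<noteq> j" for i j
      unfolding red using off[OF that] by simp
    show "(\<Sum>x\<in>?g ` S. (x $ i)\<^sup>2) = (\<Sum>x\<in>?g ` S. (x $ j)\<^sup>2)" for i j
      using diag[of i j] by (simp only: power2_eq_square red)
  qed
qed

theorem theorem1p1:
  fixes m :: nat
  assumes "m > 0"
  shows
    "(\<forall>C :: (('a::field) ^ ('n1::finite)) set.
        CARD('a) = 2 \<and> CARD('n1) = 24 * m \<and>
        self_dual_code C \<and> doubly_even C \<and> has_min_weight C (4 * m) \<longrightarrow>
        (\<forall>l. code_shell C l \<noteq> {} \<longrightarrow> is_combinatorial_design 1 (code_shell C l))) \<and>
     (\<forall>C :: (('b::field) ^ ('n2::finite)) set.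
        CARD('b) = 3 \<and> CARD('n2) = 12 * m \<and>
        self_dual_code C \<and> has_min_weight C (3 * m) \<longrightarrow>
        (\<forall>l. l \<le> 6 * m - 3 \<longrightarrow> is_combinatorial_design 1 (code_shell C l))) \<and>
     (\<forall>C :: (('c::field) ^ ('n3::finite)) set.
        CARD('c) = 4 \<and> CARD('n3) = 6 * m \<and>
        hermitian_self_dual_code C \<and> has_min_weight C (2 * m) \<longrightarrow>
        (\<forall>l. l \<le> 3 * m - 1 \<longrightarrow> is_combinatorial_design 1 (code_shell C l))) \<and>
     (\<forall>L :: (real ^ ('n4::finite)) set.
        CARD('n4) = 24 * m \<and>
        even_lattice L \<and> unimodular_lattice L \<and> has_min_norm L (2 * real m) \<longrightarrow>
        (\<forall>l. l > 0 \<and> lattice_shell L l \<noteq> {} \<longrightarrow> supports_spherical_design 3 L l))"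
proof (intro conjI allI impI)
  fix C :: "('a ^ 'n1) set" and l
  assume "CARD('a) = 2 \<and> CARD('n1) = 24 * m \<and> self_dual_code C \<and> doubly_even C \<and> has_min_weight C (4 * m)"
  thus "is_combinatorial_design 1 (code_shell C l)"
    using binary_shells_are_1_designs[of m C l] assms by blast
next
  fix C :: "('b ^ 'n2) set" and l
  assume "CARD('b) = 3 \<and> CARD('n2) = 12 * m \<and> self_dual_code C \<and> has_min_weight C (3 * m)"
    and "l \<le> 6 * m - 3"
  thus "is_combinatorial_design 1 (code_shell C l)"
    using ternary_shells_are_1_designs[of m C l] assms by blast
next
  fix C :: "('c ^ 'n3) set" and l
  assume "CARD('c) = 4 \<and> CARD('n3) = 6 * m \<and> hermitian_self_dual_code C \<and> has_min_weight C (2 * m)"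
    and "l \<le> 3 * m - 1"
  thus "is_combinatorial_design 1 (code_shell C l)"
    using quaternary_shells_are_1_designs[of m C l] assms by blast
next
  fix L :: "(real ^ 'n4) set" and l
  assume "CARD('n4) = 24 * m \<and> even_lattice L \<and> unimodular_lattice L \<and> has_min_norm L (2 * real m)"
    and "l > 0 \<and> lattice_shell L l \<noteq> {}"
  thus "supports_spherical_design 3 L l"
    using lattice_shell_spherical_3_design[of m L l] by blast
qed

end
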